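(* Let $(X_t,P^\mu)$ be a Markov process on $\mathcal X=\mathcal Q\times\mathcal P$ with generator $A$ on $L^2(\mu_* )$, invariant ergodic probability measure $\mu_*=\nu_*\times\rho_*$ and initial distribution $\mu$ (all as in the context). Let $\lambda_q,\lambda_p,R_0>0$ be the constants of the model, let $\epsilon\in(0,1)$ satisfy $$0<\epsilon<\frac{4\lambda_q\lambda_p}{4\lambda_q+R_0^2},$$ let $$\Lambda(\epsilon)=\frac{(\lambda_q-1)\epsilon+\lambda_p-\sqrt{\left((\lambda_q+1)\epsilon-\lambda_p\right)^2+\epsilon^2R_0^2}}{2}$$ (which is positive), and suppose that the process satisfies the hypocoercive estimate $$\langle -Ag,g\rangle_\epsilon\ \ge\ \Lambda(\epsilon)\,\mathrm{Var}_{\mu_*}(g)\qquad\text{for all } g\in D(A),$$ where $\langle\cdot,\cdot\rangle_\epsilon$ is the modified scalar product defined in the context. Then for any bounded measurable $f:\mathcal X\to\mathbb R$, any time $T>0$ and any $\delta$ with $0<1-\delta<1$, $$P^\mu\left(\left|\frac1T\int_0^T f(X_t)\,dt-\mu_*[f]\right|\le r\right)\ \ge\ 1-\delta,$$ where $$r=\sqrt{2v\,\frac1T\log\left(\frac{2N}{\delta}\right)}+b\,\frac1T\log\left(\frac{2N}{\delta}\right),$$ $$v=\frac{(1+\epsilon)\left(1-\frac{\epsilon^2}{4}\right)}{1-\epsilon}\,\frac{2\,\mathrm{Var}_{\mu_*}[f]}{\Lambda(\epsilon)},\qquad b=\frac{(1+\epsilon)^2}{1-\epsilon}\,\frac{\|\widehat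 f\|_\infty}{\Lambda(\epsilon)},\qquad N=\frac{1}{\sqrt{1-\epsilon}}\left\|\frac{d\mu}{d\mu_*}\right\|,\qquad \widehat f=f-\mu_*[f].$$
   Context: Setting. $\mathcal X=\mathcal Q\times\mathcal P$ is an extended phase space (a Polish space) with $\mathcal Q\subset\mathbb R^d$ and $\mathcal P$ the momentum/velocity space (for example $\mathbb R^d$ or $\{-1,1\}^d$). $\nu_*$ is the probability measure $d\nu_*=Z^{-1}e^{-\beta V(q)}dq$ on $\mathcal Q$, $\rho_*$ is a probability measure on $\mathcal P$ with mean zero and nonzero covariance, and $\mu_*=\nu_*\times\rho_*$. $\langle\cdot,\cdot\rangle$ and $\|\cdot\|$ are the scalar product and norm of the real Hilbert space $L^2(\mu_* )$; $\mu_*[f]=\int f\,d\mu_*$ and $\mathrm{Var}_{\mu_*}$ is the variance under $\mu_*$. $(X_t,P^x)$, $x\in\mathcal X$, are time-homogeneous càdlàg $\mathcal X$-valued Markov processes with $X_0=x$ $P^x$-a.s., and $P^\mu=\int P^x\,d\mu(x)$ is the law with $X_0\sim\mu$. The measure $\mu_*$ is invariant and ergodic, $T_t[g](x)=E^x[g(X_t)]$ defines a strongly continuous semigroup on $L^2(\mu_* )$, and $(A,D(A))$ is its generator. The initial distribution $\mu$ is absolutely continuous with respect to $\mu_*$ with $\left\|\frac{d\mu}{d\mu_*}\right\|<\infty$. Modified scalar product. Write $A=S+T$ with $S=\frac{A+A^*}{2}$ symmetric and $T=\frac{A-A^*}{2}$ antisymmetric on $L^2(\mu_* )$ (this operator $T$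 is not to be confused with the time $T$). Let $\Pi$ be the projection $\Pi(f)(q)=\int f(q,p)\,d\rho_*(p)$ and $$B=\left(I+(T\Pi)^*(T\Pi)\right)^{-1}(-T\Pi)^*.$$ Standing properties: $B$ is a bounded operator on $L^2(\mu_* )$ with $B=\Pi B(I-\Pi)$, $\|Bf\|\le\frac12\|(I-\Pi)f\|$ and $B1=B^*1=0$. Put $G=B+B^*$ (so $G$ is bounded and self-adjoint, $\|G\|\le1$, $G1=0$) and, for $\epsilon\in(0,1)$, $$\langle f,g\rangle_\epsilon=\langle f,(I+\epsilon G)g\rangle .$$ Constants. The positive constants $\lambda_q,\lambda_p,R_0$ (with $\lambda_q\in(0,1)$) are those for which, for suitable $f$ with $\mu_*[f]=0$, $\langle f,-Sf\rangle\ge\lambda_p\|(I-\Pi)f\|^2$, $\langle -BT\Pi f,\Pi f\rangle\ge\lambda_q\|\Pi f\|^2$ and $\|BT(I-\Pi)f\|+\|BS(I-\Pi)f\|\le R_0\|(I-\Pi)f\|$. The number $\Lambda(\epsilon)$ is the smallest eigenvalue of the matrix $\begin{bmatrix}\epsilon\lambda_q&-\epsilon R_0/2\\-\epsilon R_0/2&\lambda_p-\epsilon\end{bmatrix}$. *)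

theory Defs
  imports "HOL-Probability.Probability"
begin

section \<open>The real Hilbert space \<open>L\<^sup>2(M)\<close> and its operators\<close>

text \<open>
  Elements of \<open>L\<^sup>2(M)\<close> are represented by square-integrable functions, equality being almost
  everywhere equality. A possibly unbounded operator is represented by its graph, a set of pairs
  of square-integrable functions that is saturated under a.e. equality in both components.
\<close>

definition L2_fun :: "'x measure \<Rightarrow> ('x \<Rightarrow> real) set" where
  "L2_fun M = {f \<in> borel_measurable M. integrable M (\<lambda>x. (f x)\<^sup>2)}"

definition ip :: "'x measure \<Rightarrow> ('x \<Rightarrow> real) \<Rightarrow> ('x \<Rightarrow> real) \<Rightarrow> real" where
  "ip M f g = (LINT x|M. f x * g x)"

definition nrm :: "'x measure \<Rightarrow> ('x \<Rightarrow> real) \<Rightarrow> real" where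
  "nrm M f = sqrt (ip M f f)"

type_synonym 'x operator = "(('x \<Rightarrow> real) \<times> ('x \<Rightarrow> real)) set"

definition op_of :: "'x measure \<Rightarrow> (('x \<Rightarrow> real) \<Rightarrow> ('x \<Rightarrow> real)) \<Rightarrow> 'x operator" where
  "op_of M F = {(f, g). f \<in> L2_fun M \<and> g \<in> L2_fun M \<and> (AE x in M. g x = F f x)}"

abbreviation op_id :: "'x measure \<Rightarrow> 'x operator" where
  "op_id M \<equiv> op_of M (\<lambda>f. f)"

definition op_add :: "'x measure \<Rightarrow> 'x operator \<Rightarrow> 'x operator \<Rightarrow> 'x operator" where
  "op_add M R S = {(f, h). h \<in> L2_fun M \<and>
     (\<exists>u v. (f, u) \<in> R \<and> (f, v) \<in> S \<and> (AE x in M. h x = u x + v x))}"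

definition op_scale :: "'x measure \<Rightarrow> real \<Rightarrow> 'x operator \<Rightarrow> 'x operator" where
  "op_scale M c R = {(f, h). h \<in> L2_fun M \<and> (\<exists>u. (f, u) \<in> R \<and> (AE x in M. h x = c * u x))}"

abbreviation op_minus :: "'x measure \<Rightarrow> 'x operator \<Rightarrow> 'x operator \<Rightarrow> 'x operator" where
  "op_minus M R S \<equiv> op_add M R (op_scale M (-1) S)"

text \<open>The operator product \<open>R S\<close>: first \<open>S\<close>, then \<open>R\<close>.\<close>

abbreviation op_comp :: "'x operator \<Rightarrow> 'x operator \<Rightarrow> 'x operator" where
  "op_comp R S \<equiv> S O R"

definition op_adj :: "'x measure \<Rightarrow> 'x operator \<Rightarrow> 'x operator" where
  "op_adj M R = {(g, h). g \<in> L2_fun M \<and> h \<in> L2_fun M \<and>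
     (\<forall>(f, f') \<in> R. ip M f' g = ip M f h)}"

definition op_closure :: "'x measure \<Rightarrow> 'x operator \<Rightarrow> 'x operator" where
  "op_closure M R = {(f, g). f \<in> L2_fun M \<and> g \<in> L2_fun M \<and>
     (\<forall>e>0. \<exists>(u, v) \<in> R. nrm M (\<lambda>x. f x - u x) < e \<and> nrm M (\<lambda>x. g x - v x) < e)}"

text \<open>The value at \<open>f\<close>; a meaningful (a.e. unique) function only for \<open>f\<close> in the domain.\<close>

definition op_app :: "'x operator \<Rightarrow> ('x \<Rightarrow> real) \<Rightarrow> ('x \<Rightarrow> real)" where
  "op_app R f = (SOME g. (f, g) \<in> R)"

definition bounded_op :: "'x measure \<Rightarrow> 'x operator \<Rightarrow> bool" where
  "bounded_op M R \<longleftrightarrow> R \<subseteq> L2_fun M \<times> L2_fun M \<and> Domain R = L2_fun M \<and>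
     (\<forall>(f, g) \<in> R. \<forall>(f', g') \<in> R. \<forall>a b.
        ((\<lambda>x. a * f x + b * f' x), (\<lambda>x. a * g x + b * g' x)) \<in> R) \<and>
     (\<exists>c. \<forall>(f, g) \<in> R. nrm M g \<le> c * nrm M f)"

definition L2_dense :: "'x measure \<Rightarrow> ('x \<Rightarrow> real) set \<Rightarrow> bool" where
  "L2_dense M C \<longleftrightarrow> C \<subseteq> L2_fun M \<and>
     (\<forall>f \<in> L2_fun M. \<forall>e>0. \<exists>g \<in> C. nrm M (\<lambda>x. f x - g x) < e)"

definition strongly_continuous_semigroup ::
  "'x measure \<Rightarrow> (real \<Rightarrow> ('x \<Rightarrow> real) \<Rightarrow> ('x \<Rightarrow> real)) \<Rightarrow> bool" where
  "strongly_continuous_semigroup M U \<longleftrightarrow>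
     (\<forall>t\<ge>0. bounded_op M (op_of M (U t))) \<and>
     (\<forall>t\<ge>0. \<forall>f \<in> L2_fun M. U t f \<in> L2_fun M) \<and>
     (\<forall>f \<in> L2_fun M. AE x in M. U 0 f x = f x) \<and>
     (\<forall>s\<ge>0. \<forall>t\<ge>0. \<forall>f \<in> L2_fun M. AE x in M. U (s + t) f x = U s (U t f) x) \<and>
     (\<forall>f \<in> L2_fun M. ((\<lambda>t. nrm M (\<lambda>x. U t f x - f x)) \<longlongrightarrow> 0) (at_right 0))"

definition generator ::
  "'x measure \<Rightarrow> (real \<Rightarrow> ('x \<Rightarrow> real) \<Rightarrow> ('x \<Rightarrow> real)) \<Rightarrow> 'x operator" where
  "generator M U = {(f, g). f \<in> L2_fun M \<and> g \<in> L2_fun M \<and>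
     ((\<lambda>t. nrm M (\<lambda>x. (U t f x - f x) / t - g x)) \<longlongrightarrow> 0) (at_right 0)}"

section \<open>Markov processes\<close>

text \<open>A subset of a Euclidean space is separable, so it is Polish iff it is completely metrizable.\<close>

abbreviation polish_set :: "'x::euclidean_space set \<Rightarrow> bool" where
  "polish_set S \<equiv> completely_metrizable_space (top_of_set S)"

definition cadlag_on :: "'x::topological_space set \<Rightarrow> (real \<Rightarrow> 'x) \<Rightarrow> bool" where
  "cadlag_on S c \<longleftrightarrow> (\<forall>t\<ge>0. c t \<in> S \<and> (c \<longlongrightarrow> c t) (at_right t)) \<and>
     (\<forall>t>0. \<exists>l \<in> S. (c \<longlongrightarrow> l) (at_left t))"

definition natural_filtration ::
  "'x::topological_space set \<Rightarrow> 'w measure \<Rightarrow> (real \<Rightarrow> 'w \<Rightarrow> 'x) \<Rightarrow> real \<Rightarrow> 'w measure" where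
  "natural_filtration S \<Omega> X s = sigma (space \<Omega>)
     {X u -` E \<inter> space \<Omega> | u E. u \<in> {0..s} \<and> E \<in> sets (restrict_space borel S)}"

definition transition ::
  "(real \<Rightarrow> 'w \<Rightarrow> 'x) \<Rightarrow> ('x \<Rightarrow> 'w measure) \<Rightarrow> real \<Rightarrow> ('x \<Rightarrow> real) \<Rightarrow> ('x \<Rightarrow> real)" where
  "transition X Pr t g = (\<lambda>x. LINT \<omega>|Pr x. g (X t \<omega>))"

text \<open>
  \<open>\<Omega>\<close> only serves as a measurable space; \<open>Pr x\<close> is the law of the process started at \<open>x\<close>.
\<close>

definition cadlag_markov_process ::
  "'x::topological_space set \<Rightarrow> 'w measure \<Rightarrow> (real \<Rightarrow> 'w \<Rightarrow> 'x) \<Rightarrow> ('x \<Rightarrow> 'w measure) \<Rightarrow> bool"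
where
  "cadlag_markov_process S \<Omega> X Pr \<longleftrightarrow>
     (\<forall>t\<ge>0. X t \<in> measurable \<Omega> (restrict_space borel S)) \<and>
     (\<forall>\<omega> \<in> space \<Omega>. cadlag_on S (\<lambda>t. X t \<omega>)) \<and>
     Pr \<in> measurable (restrict_space borel S) (prob_algebra \<Omega>) \<and>
     (\<forall>x \<in> S. AE \<omega> in Pr x. X 0 \<omega> = x) \<and>
     (\<forall>x \<in> S. \<forall>s\<ge>0. \<forall>t\<ge>0. \<forall>g \<in> borel_measurable (restrict_space borel S).
        bounded (g ` S) \<longrightarrow>
        (AE \<omega> in Pr x. real_cond_exp (Pr x) (natural_filtration S \<Omega> X s) (\<lambda>\<omega>. g (X (s + t) \<omega>)) \<omega>
           = transition X Pr t g (X s \<omega>)))"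

text \<open>The law \<open>\<integral> P\<^sup>x d\<mu>(x)\<close> of the process with initial distribution \<open>\<mu>\<close>.\<close>

abbreviation path_law :: "('x \<Rightarrow> 'w measure) \<Rightarrow> 'x measure \<Rightarrow> 'w measure" where
  "path_law Pr \<mu> \<equiv> \<mu> \<bind> Pr"

definition invariant_measure ::
  "(real \<Rightarrow> 'w \<Rightarrow> 'x) \<Rightarrow> ('x \<Rightarrow> 'w measure) \<Rightarrow> 'x measure \<Rightarrow> bool" where
  "invariant_measure X Pr M \<longleftrightarrow> (\<forall>t\<ge>0. distr (path_law Pr M) M (X t) = M)"

definition ergodic_measure ::
  "(real \<Rightarrow> 'w \<Rightarrow> 'x) \<Rightarrow> ('x \<Rightarrow> 'w measure) \<Rightarrow> 'x measure \<Rightarrow> bool" where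
  "ergodic_measure X Pr M \<longleftrightarrow> (\<forall>E \<in> sets M.
     (\<forall>t\<ge>0. AE x in M. transition X Pr t (indicator E) x = indicator E x) \<longrightarrow>
     measure M E = 0 \<or> measure M E = 1)"

section \<open>Phase space measures and the modified scalar product\<close>

definition gibbs_measure :: "real \<Rightarrow> ('a::euclidean_space \<Rightarrow> real) \<Rightarrow> 'a set \<Rightarrow> 'a measure" where
  "gibbs_measure \<beta> V Q = (let L = restrict_space lborel Q; Z = (LINT q|L. exp (- \<beta> * V q)) in
     density L (\<lambda>q. ennreal (exp (- \<beta> * V q) / Z)))"

text \<open>Mean zero and nonzero covariance matrix (second moments being finite).\<close>

definition momentum_measure :: "'b::euclidean_space set \<Rightarrow> 'b measure \<Rightarrow> bool" where
  "momentum_measure P \<rho> \<longleftrightarrow> prob_space \<rho> \<and> sets \<rho> = sets (restrict_space borel P) \<and>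
     integrable \<rho> (\<lambda>p. (norm p)\<^sup>2) \<and> (LINT p|\<rho>. p) = 0 \<and>
     (\<exists>i \<in> Basis. \<exists>j \<in> Basis. (LINT p|\<rho>. (p \<bullet> i) * (p \<bullet> j)) \<noteq> 0)"

definition momentum_proj :: "('a \<times> 'b) measure \<Rightarrow> 'b measure \<Rightarrow> ('a \<times> 'b) operator" where
  "momentum_proj M \<rho> = op_of M (\<lambda>f (q, p). LINT p'|\<rho>. f (q, p'))"

definition sym_part :: "'x measure \<Rightarrow> 'x operator \<Rightarrow> 'x operator" where
  "sym_part M A = op_scale M (1/2) (op_add M A (op_adj M A))"

definition antisym_part :: "'x measure \<Rightarrow> 'x operator \<Rightarrow> 'x operator" where
  "antisym_part M A = op_scale M (1/2) (op_minus M A (op_adj M A))"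

text \<open>
  \<open>B = (I + (T\<Pi>)\<^sup>*(T\<Pi>))\<^sup>-\<^sup>1 (-T\<Pi>)\<^sup>*\<close>. The product on the right is defined literally only on a
  subspace (the domain of the unbounded operator \<open>(T\<Pi>)\<^sup>*\<close>); \<open>B\<close> is its extension by continuity,
  that is, the operator whose graph is the closure.
\<close>

definition dms_B :: "'x measure \<Rightarrow> 'x operator \<Rightarrow> 'x operator \<Rightarrow> 'x operator" where
  "dms_B M Pj A = (let TPj = op_comp (antisym_part M A) Pj in
     op_closure M (op_comp ((op_add M (op_id M) (op_comp (op_adj M TPj) TPj))\<inverse>)
                           (op_adj M (op_scale M (-1) TPj))))"

definition dms_standing :: "'x measure \<Rightarrow> 'x operator \<Rightarrow> 'x operator \<Rightarrow> bool" where
  "dms_standing M Pj B \<longleftrightarrow> (let IPj = op_minus M (op_id M) Pj in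
     bounded_op M B \<and>
     B = op_comp Pj (op_comp B IPj) \<and>
     (\<forall>f \<in> L2_fun M. nrm M (op_app B f) \<le> 1/2 * nrm M (op_app IPj f)) \<and>
     ((\<lambda>_. 1), (\<lambda>_. 0)) \<in> B \<and> ((\<lambda>_. 1), (\<lambda>_. 0)) \<in> op_adj M B)"

definition ip_eps ::
  "'x measure \<Rightarrow> 'x operator \<Rightarrow> real \<Rightarrow> ('x \<Rightarrow> real) \<Rightarrow> ('x \<Rightarrow> real) \<Rightarrow> real" where
  "ip_eps M B \<epsilon> f g = (let G = op_add M B (op_adj M B) in
     ip M f (op_app (op_add M (op_id M) (op_scale M \<epsilon> G)) g))"

text \<open>
  The inequalities that \<open>\<lambda>\<^sub>q\<close>, \<open>\<lambda>\<^sub>p\<close>, \<open>R\<^sub>0\<close> stand for, on a class \<open>C\<close> of test functions that is dense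
  in \<open>L\<^sup>2(M)\<close> and on which all the operators involved are defined.
\<close>

definition hypocoercivity_constants ::
  "'x measure \<Rightarrow> 'x operator \<Rightarrow> 'x operator \<Rightarrow> ('x \<Rightarrow> real) set \<Rightarrow> real \<Rightarrow> real \<Rightarrow> real \<Rightarrow> bool"
where
  "hypocoercivity_constants M Pj A C lam_q lam_p R0 \<longleftrightarrow>
    (let S = sym_part M A; T = antisym_part M A; B = dms_B M Pj A;
         IPj = op_minus M (op_id M) Pj
     in L2_dense M C \<and>
        C \<subseteq> Domain S \<and> C \<subseteq> Domain (op_comp T Pj) \<and>
        C \<subseteq> Domain (op_comp S IPj) \<and> C \<subseteq> Domain (op_comp T IPj) \<and>
        (\<forall>f \<in> C. (LINT x|M. f x) = 0 \<longrightarrow>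
           ip M f (\<lambda>x. - op_app S f x) \<ge> lam_p * (nrm M (op_app IPj f))\<^sup>2 \<and>
           ip M (\<lambda>x. - op_app (op_comp B (op_comp T Pj)) f x) (op_app Pj f)
             \<ge> lam_q * (nrm M (op_app Pj f))\<^sup>2 \<and>
           nrm M (op_app (op_comp B (op_comp T IPj)) f) + nrm M (op_app (op_comp B (op_comp S IPj)) f)
             \<le> R0 * nrm M (op_app IPj f)))"

definition hypo_Lambda :: "real \<Rightarrow> real \<Rightarrow> real \<Rightarrow> real \<Rightarrow> real" where
  "hypo_Lambda lam_q lam_p R0 \<epsilon> =
     ((lam_q - 1) * \<epsilon> + lam_p - sqrt (((lam_q + 1) * \<epsilon> - lam_p)\<^sup>2 + \<epsilon>\<^sup>2 * R0\<^sup>2)) / 2"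

end

theory Submission
  imports Defs
begin

text \<open>
  The proof is the Chernoff method for the additive functional \<open>\<integral>\<^sub>0\<^sup>T f(X\<^sub>t) dt\<close> of a centred bounded \<open>f\<close>.
  Its exponential moment is \<open>\<integral> u\<^sub>T d\<mu>\<close>, where \<open>u\<^sub>t(x) = E\<^sup>x[exp (\<integral>\<^sub>0\<^sup>t W(X\<^sub>s) ds)]\<close> with \<open>W = \<lambda> f\<close> is the
  Feynman--Kac semigroup applied to the constant \<open>1\<close>. By Cauchy--Schwarz
  it is at most \<open>\<parallel>d\<mu>/d\<mu>\<^sub>*\<parallel> \<parallel>u\<^sub>T\<parallel>\<close>, and since \<open>(1 - \<epsilon>) \<parallel>u\<parallel>\<^sup>2 \<le> \<langle>u, u\<rangle>\<^sub>\<epsilon>\<close> it suffices to bound the modified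
  norm of \<open>u\<^sub>T\<close>. Formally \<open>u\<close> solves \<open>\<partial>\<^sub>t u = (A + W) u\<close>, so that norm grows at most at
  rate \<open>\<Psi>\<close> as soon as \<open>\<langle>(A + W) g, g\<rangle>\<^sub>\<epsilon> \<le> \<Psi> \<langle>g, g\<rangle>\<^sub>\<epsilon>\<close>. Two things have to be shown.

  The first is the rate. Write \<open>g = c + h\<close> with \<open>c\<close> the mean of \<open>g\<close>. The hypocoercive estimate supplies
  \<open>- \<Lambda> \<parallel>h\<parallel>\<^sup>2\<close>. Since \<open>f\<close> is centred and \<open>G 1 = 0\<close>, the potential contributes nothing of order \<open>c\<^sup>2\<close>, a
  cross term of size \<open>\<lambda> (2 + \<epsilon>) |c| \<parallel>f\<parallel> \<parallel>h\<parallel>\<close> and a term of size \<open>\<lambda> (1 + \<epsilon>) \<parallel>f\<parallel>\<^sub>\<infinity> \<parallel>h\<parallel>\<^sup>2\<close>. Completing the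
  square gives \<open>\<Psi> = \<lambda>\<^sup>2 (1 + \<epsilon>/2)\<^sup>2 \<parallel>f\<parallel>\<^sup>2 / (\<Lambda> - \<lambda> (1 + \<epsilon>) \<parallel>f\<parallel>\<^sub>\<infinity>)\<close> (\<open>mform_potential_bound\<close>). This is a rate
  function of Bernstein type, whose Legendre transform yields \<open>r\<close> (\<open>Bernstein_exponent\<close>).

  The second is to make the differential equation rigorous for a potential that is only measurable and
  paths that are only cadlag. Duhamel's formula (\<open>Duhamel\<close>) follows from the Markov property at
  single times, because the exponential weight is adapted. Iterating it gives the semigroup property
  (\<open>FK_semigroup\<close>), and strong continuity of the transition semigroup gives the derivative at time
  \<open>0\<close> in \<open>L\<^sup>2\<close> (\<open>FK_perturbation\<close>). Together they place \<open>u\<^sub>t\<close> in the domain of \<open>A\<close>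
  (\<open>FK_one_generator\<close>). This uses that \<open>u\<^sub>t\<close> is bounded, as it starts from the
  constant \<open>1\<close>. The differential inequality is integrated by Euler steps whose errors are uniform in time
  (\<open>FK_one_growth\<close>).

  The modified scalar product involves the adjoint of \<open>B\<close>, whose graph could a priori be too small; it is
  everywhere defined by the Riesz representation theorem (\<open>L2_Riesz\<close>).
\<close>

section \<open>The Hilbert space \<open>L\<^sup>2\<close> and the Riesz representation theorem\<close>

lemma ip_commute: "ip M f g = ip M g f"
  by (simp add: ip_def mult.commute)

lemma L2_fun_measurable: "f \<in> L2_fun M \<Longrightarrow> f \<in> borel_measurable M"
  by (simp add: L2_fun_def)

lemma L2_fun_mult_integrable:
  assumes "f \<in> L2_fun M" "g \<in> L2_fun M"
  shows "integrable M (\<lambda>x. f x * g x)"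
proof (rule Bochner_Integration.integrable_bound[where f="\<lambda>x. (f x)\<^sup>2 + (g x)\<^sup>2"])
  show "integrable M (\<lambda>x. (f x)\<^sup>2 + (g x)\<^sup>2)" "(\<lambda>x. f x * g x) \<in> borel_measurable M"
    using assms by (auto simp: L2_fun_def)
  have "\<bar>a * b\<bar> \<le> a\<^sup>2 + b\<^sup>2" for a b :: real
    using sum_squares_bound[of "\<bar>a\<bar>" "\<bar>b\<bar>"] abs_ge_zero[of "a * b"]
    unfolding abs_mult power2_abs by linarith
  then show "AE x in M. norm (f x * g x) \<le> norm ((f x)\<^sup>2 + (g x)\<^sup>2)"
    by auto
qed

lemma L2_fun_lin:
  assumes "f \<in> L2_fun M" "g \<in> L2_fun M"
  shows "(\<lambda>x. a * f x + b * g x) \<in> L2_fun M"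
proof -
  have "(a * f x + b * g x)\<^sup>2 = a\<^sup>2 * (f x)\<^sup>2 + 2 * a * b * (f x * g x) + b\<^sup>2 * (g x)\<^sup>2" for x
    by (simp add: power2_eq_square algebra_simps)
  then show ?thesis
    using assms L2_fun_mult_integrable[OF assms] by (auto simp: L2_fun_def)
qed

lemma L2_fun_add: "f \<in> L2_fun M \<Longrightarrow> g \<in> L2_fun M \<Longrightarrow> (\<lambda>x. f x + g x) \<in> L2_fun M"
  using L2_fun_lin[of f M g 1 1] by simp

lemma L2_fun_diff: "f \<in> L2_fun M \<Longrightarrow> g \<in> L2_fun M \<Longrightarrow> (\<lambda>x. f x - g x) \<in> L2_fun M"
  using L2_fun_lin[of f M g 1 "-1"] by simp

lemma L2_fun_scale: "f \<in> L2_fun M \<Longrightarrow> (\<lambda>x. a * f x) \<in> L2_fun M"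
  using L2_fun_lin[of f M f a 0] by simp

lemma (in finite_measure) L2_fun_bounded:
  assumes "f \<in> borel_measurable M" "\<And>x. x \<in> space M \<Longrightarrow> \<bar>f x\<bar> \<le> c"
  shows "f \<in> L2_fun M"
proof -
  have "integrable M (\<lambda>x. (f x)\<^sup>2)"
    using assms by (intro integrable_const_bound[of _ "c\<^sup>2"]) (auto intro!: AE_I2 abs_le_square_iff[THEN iffD1] order_trans[OF _ abs_ge_self])
  then show ?thesis
    using assms by (auto simp: L2_fun_def)
qed

lemma (in finite_measure) L2_fun_integrable: "f \<in> L2_fun M \<Longrightarrow> integrable M f"
  by (auto simp: L2_fun_def intro: square_integrable_imp_integrable)

lemma ip_cong_AE:
  assumes "f \<in> borel_measurable M" "g \<in> borel_measurable M"
    "f' \<in> borel_measurable M" "g' \<in> borel_measurable M"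
    "AE x in M. f x = f' x" "AE x in M. g x = g' x"
  shows "ip M f g = ip M f' g'"
  unfolding ip_def using assms by (intro integral_cong_AE) auto

lemma ip_lin_left:
  assumes "f \<in> L2_fun M" "g \<in> L2_fun M" "h \<in> L2_fun M"
  shows "ip M (\<lambda>x. a * f x + b * g x) h = a * ip M f h + b * ip M g h"
proof -
  have "ip M (\<lambda>x. a * f x + b * g x) h = (LINT x|M. a * (f x * h x) + b * (g x * h x))"
    unfolding ip_def by (intro Bochner_Integration.integral_cong) (auto simp: algebra_simps)
  also have "\<dots> = a * ip M f h + b * ip M g h"
    unfolding ip_def using L2_fun_mult_integrable[OF assms(1,3)] L2_fun_mult_integrable[OF assms(2,3)]
    by simp
  finally show ?thesis .
qed

lemma ip_lin_right:
  assumes "f \<in> L2_fun M" "g \<in> L2_fun M" "h \<in> L2_fun M"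
  shows "ip M h (\<lambda>x. a * f x + b * g x) = a * ip M h f + b * ip M h g"
  using ip_lin_left[OF assms] by (simp add: ip_commute)

lemma ip_lin_self:
  assumes "f \<in> L2_fun M" "g \<in> L2_fun M"
  shows "ip M (\<lambda>x. a * f x + b * g x) (\<lambda>x. a * f x + b * g x)
    = a\<^sup>2 * ip M f f + 2 * a * b * ip M f g + b\<^sup>2 * ip M g g"
  using assms L2_fun_lin[OF assms, of a b]
  by (simp add: ip_lin_left ip_lin_right ip_commute[of M g f] power2_eq_square algebra_simps)

lemma ip_self_nonneg: "ip M f f \<ge> 0"
  by (simp add: ip_def)

lemma nrm_nonneg [simp]: "nrm M f \<ge> 0"
  by (simp add: nrm_def ip_self_nonneg)

lemma nrm_square: "(nrm M f)\<^sup>2 = ip M f f"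
  by (simp add: nrm_def ip_self_nonneg)

lemma nrm_cong_AE:
  assumes "f \<in> borel_measurable M" "g \<in> borel_measurable M" "AE x in M. f x = g x"
  shows "nrm M f = nrm M g"
  using ip_cong_AE[of f M f g g] assms by (simp add: nrm_def)

lemma nrm_cong: "(\<And>x. x \<in> space M \<Longrightarrow> f x = g x) \<Longrightarrow> nrm M f = nrm M g"
  unfolding nrm_def ip_def by (simp cong: Bochner_Integration.integral_cong)

lemma nrm_scale: "nrm M (\<lambda>x. a * f x) = \<bar>a\<bar> * nrm M f"
proof -
  have "ip M (\<lambda>x. a * f x) (\<lambda>x. a * f x) = a\<^sup>2 * ip M f f"
    unfolding ip_def by (subst integral_mult_right_zero[symmetric]) (simp add: power2_eq_square ac_simps)
  then show ?thesis
    by (simp add: nrm_def real_sqrt_mult)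
qed

text \<open>The quadratic form \<open>(a, b) \<mapsto> \<parallel>a f + b g\<parallel>\<^sup>2\<close> is nonnegative.\<close>

lemma ip_Cauchy_Schwarz:
  assumes f: "f \<in> L2_fun M" and g: "g \<in> L2_fun M"
  shows "\<bar>ip M f g\<bar> \<le> nrm M f * nrm M g"
proof -
  have q: "0 \<le> a\<^sup>2 * ip M f f + 2 * a * b * ip M f g + b\<^sup>2 * ip M g g" for a b
  proof -
    have "0 \<le> ip M (\<lambda>x. a * f x + b * g x) (\<lambda>x. a * f x + b * g x)"
      by (rule ip_self_nonneg)
    also have "\<dots> = a\<^sup>2 * ip M f f + 2 * a * b * ip M f g + b\<^sup>2 * ip M g g"
      by (rule ip_lin_self[OF f g])
    finally show ?thesis .
  qed
  have "(ip M f g)\<^sup>2 \<le> ip M f f * ip M g g"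
  proof (cases "ip M g g = 0")
    case True
    have "ip M f g = 0"
    proof (rule ccontr)
      assume "ip M f g \<noteq> 0"
      then show False
        using q[of 1 "- (ip M f f + 1) / (2 * ip M f g)"] True ip_self_nonneg[of M f] by (simp add: field_simps)
    qed
    then show ?thesis
      using True by simp
  next
    case False
    then have pos: "ip M g g > 0"
      using ip_self_nonneg[of M g] by simp
    have "0 \<le> ip M g g * (ip M f f * ip M g g - (ip M f g)\<^sup>2)"
      using q[of "ip M g g" "- ip M f g"] by (simp add: power2_eq_square algebra_simps)
    then show ?thesis
      using pos by (simp add: zero_le_mult_iff)
  qed
  then have "sqrt ((ip M f g)\<^sup>2) \<le> sqrt (ip M f f * ip M g g)"
    by (rule real_sqrt_le_mono)
  then show ?thesis
    by (simp add: nrm_def real_sqrt_mult)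
qed

lemma nrm_lin_le:
  assumes f: "f \<in> L2_fun M" and g: "g \<in> L2_fun M"
  shows "nrm M (\<lambda>x. a * f x + b * g x) \<le> \<bar>a\<bar> * nrm M f + \<bar>b\<bar> * nrm M g"
proof (rule power2_le_imp_le)
  have "2 * (a * b * ip M f g) \<le> 2 * (\<bar>a\<bar> * \<bar>b\<bar> * (nrm M f * nrm M g))"
  proof -
    have "a * b * ip M f g \<le> \<bar>a * b * ip M f g\<bar>" by simp
    also have "\<dots> \<le> \<bar>a\<bar> * \<bar>b\<bar> * (nrm M f * nrm M g)"
      unfolding abs_mult by (intro mult_left_mono ip_Cauchy_Schwarz f g) auto
    finally show ?thesis by simp
  qed
  moreover have "(nrm M (\<lambda>x. a * f x + b * g x))\<^sup>2
      = a\<^sup>2 * ip M f f + 2 * (a * b * ip M f g) + b\<^sup>2 * ip M g g"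
    unfolding nrm_square ip_lin_self[OF f g] by simp
  ultimately show "(nrm M (\<lambda>x. a * f x + b * g x))\<^sup>2 \<le> (\<bar>a\<bar> * nrm M f + \<bar>b\<bar> * nrm M g)\<^sup>2"
    by (simp add: power2_sum nrm_square power_mult_distrib mult.assoc mult.left_commute)
qed simp

lemma nrm_add_le:
  assumes "f \<in> L2_fun M" "g \<in> L2_fun M"
  shows "nrm M (\<lambda>x. f x + g x) \<le> nrm M f + nrm M g"
  using nrm_lin_le[OF assms, of 1 1] by simp

lemma nrm_diff_le:
  assumes "f \<in> L2_fun M" "g \<in> L2_fun M"
  shows "nrm M (\<lambda>x. f x - g x) \<le> nrm M f + nrm M g"
  using nrm_lin_le[OF assms, of 1 "-1"] by simp

lemma nrm_mono:
  assumes "f \<in> borel_measurable M" "g \<in> L2_fun M" "AE x in M. \<bar>f x\<bar> \<le> \<bar>g x\<bar>"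
  shows "nrm M f \<le> nrm M g"
proof -
  have "AE x in M. f x * f x \<le> g x * g x"
    using assms(3) by eventually_elim (metis abs_le_square_iff power2_eq_square)
  then have "ip M f f \<le> ip M g g"
    unfolding ip_def using assms L2_fun_mult_integrable[OF assms(2,2)]
    by (intro integral_mono_AE')  auto
  then show ?thesis
    by (simp add: nrm_def)
qed

lemma (in prob_space) nrm_bounded:
  assumes "f \<in> borel_measurable M" "\<And>x. x \<in> space M \<Longrightarrow> \<bar>f x\<bar> \<le> c"
  shows "nrm M f \<le> c"
proof -
  obtain x where "x \<in> space M" using not_empty by auto
  then have c: "0 \<le> c" using assms(2)[of x] by linarith
  have "nrm M f \<le> nrm M (\<lambda>_. c)"
    using assms c by (intro nrm_mono L2_fun_bounded[of _ c]) auto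
  also have "\<dots> = c" using c by (simp add: nrm_def ip_def prob_space)
  finally show ?thesis .
qed

lemma nrm_eq_0_AE:
  assumes "f \<in> L2_fun M" "nrm M f = 0"
  shows "AE x in M. f x = 0"
proof -
  have "(LINT x|M. f x * f x) = 0"
    using assms(2) by (simp add: nrm_def ip_def)
  then have "AE x in M. f x * f x = 0"
    using L2_fun_mult_integrable[OF assms(1,1)]
    by (subst (asm) integral_nonneg_eq_0_iff_AE) auto
  then show ?thesis by auto
qed

lemma L2_fun_AE_limit:
  assumes [measurable]: "\<And>i. s i \<in> borel_measurable M" "h \<in> borel_measurable M"
    and lim: "AE x in M. (\<lambda>i. s i x) \<longlonglongrightarrow> h x"
    and bnd: "\<And>i. i \<ge> n \<Longrightarrow> s i \<in> L2_fun M \<and> nrm M (s i) \<le> c" and c: "0 \<le> c"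
  shows "h \<in> L2_fun M \<and> nrm M h \<le> c"
proof -
  have sq: "(\<integral>\<^sup>+x. ennreal ((s i x)\<^sup>2) \<partial>M) \<le> ennreal (c\<^sup>2)" if "i \<ge> n" for i
  proof -
    have "(\<integral>\<^sup>+x. ennreal ((s i x)\<^sup>2) \<partial>M) = ennreal (ip M (s i) (s i))"
      using bnd[OF that] unfolding ip_def power2_eq_square[symmetric] L2_fun_def
      by (intro nn_integral_eq_integral) auto
    also have "\<dots> \<le> ennreal (c\<^sup>2)"
      using bnd[OF that] by (intro ennreal_leI) (simp add: nrm_square[symmetric] power_mono)
    finally show ?thesis .
  qed
  have "(\<integral>\<^sup>+x. ennreal ((h x)\<^sup>2) \<partial>M) \<le> (\<integral>\<^sup>+x. liminf (\<lambda>i. ennreal ((s i x)\<^sup>2)) \<partial>M)"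
  proof (intro nn_integral_mono_AE)
    show "AE x in M. ennreal ((h x)\<^sup>2) \<le> liminf (\<lambda>i. ennreal ((s i x)\<^sup>2))"
      using lim
    proof eventually_elim
      case (elim x)
      then have "(\<lambda>i. ennreal ((s i x)\<^sup>2)) \<longlonglongrightarrow> ennreal ((h x)\<^sup>2)"
        by (intro tendsto_ennrealI tendsto_intros)
      from lim_imp_Liminf[OF sequentially_bot this] show ?case by simp
    qed
  qed
  also have "\<dots> \<le> liminf (\<lambda>i. \<integral>\<^sup>+x. ennreal ((s i x)\<^sup>2) \<partial>M)"
    by (intro nn_integral_liminf) auto
  also have "\<dots> \<le> ennreal (c\<^sup>2)"
    using sq by (intro Liminf_le) (auto simp: eventually_sequentially)
  finally have le: "(\<integral>\<^sup>+x. ennreal ((h x)\<^sup>2) \<partial>M) \<le> ennreal (c\<^sup>2)" .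
  then have int: "integrable M (\<lambda>x. (h x)\<^sup>2)"
    by (intro integrableI_bounded) (auto simp: le_less_trans)
  then have "ennreal (ip M h h) = (\<integral>\<^sup>+x. ennreal ((h x)\<^sup>2) \<partial>M)"
    unfolding ip_def power2_eq_square[symmetric] by (intro nn_integral_eq_integral[symmetric]) auto
  with le have "ennreal ((nrm M h)\<^sup>2) \<le> ennreal (c\<^sup>2)"
    by (simp add: nrm_square)
  then have "(nrm M h)\<^sup>2 \<le> c\<^sup>2"
    by (subst (asm) ennreal_le_iff) auto
  then have "nrm M h \<le> c"
    using c by (rule power2_le_imp_le)
  then show ?thesis
    using int by (simp add: L2_fun_def)
qed

text \<open>
  Riesz--Fischer. On a probability space an \<open>L\<^sup>2\<close>-Cauchy sequence is \<open>L\<^sup>1\<close>-Cauchy, so a subsequence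
  converges almost everywhere; Fatou's lemma identifies the pointwise limit as the \<open>L\<^sup>2\<close>-limit.
\<close>

lemma (in prob_space) L2_complete:
  assumes s: "\<And>i. s i \<in> L2_fun M"
    and cauchy: "\<And>e. e > 0 \<Longrightarrow> \<exists>n. \<forall>i\<ge>n. \<forall>j\<ge>n. nrm M (\<lambda>x. s i x - s j x) < e"
  obtains h where "h \<in> L2_fun M" "(\<lambda>i. nrm M (\<lambda>x. h x - s i x)) \<longlonglongrightarrow> 0"
proof -
  have [measurable]: "s i \<in> borel_measurable M" for i
    using s by (rule L2_fun_measurable)
  have one: "(\<lambda>_. 1) \<in> L2_fun M"
    by (rule L2_fun_bounded[of _ 1]) auto
  have nrm1: "nrm M (\<lambda>_. 1) = 1"
    by (simp add: nrm_def ip_def prob_space)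
  have L1: "(LINT x|M. norm (s i x - s j x)) \<le> nrm M (\<lambda>x. s i x - s j x)" for i j
  proof -
    have d: "(\<lambda>x. s i x - s j x) \<in> L2_fun M"
      by (intro L2_fun_diff s)
    have a: "(\<lambda>x. \<bar>s i x - s j x\<bar>) \<in> L2_fun M"
      using d by (auto simp: L2_fun_def)
    have "(LINT x|M. norm (s i x - s j x)) = ip M (\<lambda>x. \<bar>s i x - s j x\<bar>) (\<lambda>_. 1)"
      by (simp add: ip_def)
    also have "\<dots> \<le> nrm M (\<lambda>x. \<bar>s i x - s j x\<bar>) * nrm M (\<lambda>_. 1)"
      using ip_Cauchy_Schwarz[OF a one] by linarith
    also have "\<dots> = nrm M (\<lambda>x. s i x - s j x)"
      unfolding nrm1 by (simp add: nrm_def ip_def)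
    finally show ?thesis .
  qed
  obtain r where r: "strict_mono r" "AE x in M. Cauchy (\<lambda>i. s (r i) x)"
  proof (rule cauchy_L1_AE_cauchy_subseq)
    show "integrable M (s n)" for n
      using s by (rule L2_fun_integrable)
    show "\<exists>N. \<forall>i\<ge>N. \<forall>j\<ge>N. (LINT x|M. norm (s i x - s j x)) < e" if "e > 0" for e
      using cauchy[OF that] L1 by (meson le_less_trans)
  qed blast
  define h where "h x = lim (\<lambda>i. s (r i) x)" for x
  have [measurable]: "h \<in> borel_measurable M"
    unfolding h_def by measurable
  have lim: "AE x in M. (\<lambda>i. s (r i) x) \<longlonglongrightarrow> h x"
    using r(2) by eventually_elim (auto simp: h_def Cauchy_convergent_iff convergent_LIMSEQ_iff)
  have key: "\<exists>n. \<forall>j\<ge>n. (\<lambda>x. h x - s j x) \<in> L2_fun M \<and> nrm M (\<lambda>x. h x - s j x) \<le> e" if e: "e > 0" for e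
  proof -
    obtain n where n: "\<And>i j. i \<ge> n \<Longrightarrow> j \<ge> n \<Longrightarrow> nrm M (\<lambda>x. s i x - s j x) < e"
      using cauchy[OF e] by blast
    have "(\<lambda>x. h x - s j x) \<in> L2_fun M \<and> nrm M (\<lambda>x. h x - s j x) \<le> e" if j: "j \<ge> n" for j
    proof (rule L2_fun_AE_limit[where s="\<lambda>i x. s (r i) x - s j x" and n=n])
      show "AE x in M. (\<lambda>i. s (r i) x - s j x) \<longlonglongrightarrow> h x - s j x"
        using lim by eventually_elim (intro tendsto_intros)
      show "(\<lambda>x. s (r i) x - s j x) \<in> L2_fun M \<and> nrm M (\<lambda>x. s (r i) x - s j x) \<le> e" if "i \<ge> n" for i
        using n[of "r i" j] j seq_suble[OF r(1), of i] that
        by (auto intro!: L2_fun_diff s less_imp_le)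
    qed (use \<open>e > 0\<close> in auto)
    then show ?thesis by blast
  qed
  have "h \<in> L2_fun M"
  proof -
    obtain n where "(\<lambda>x. h x - s n x) \<in> L2_fun M"
      using key[of 1] by auto
    from L2_fun_add[OF this s[of n]] show ?thesis by simp
  qed
  moreover have "(\<lambda>i. nrm M (\<lambda>x. h x - s i x)) \<longlonglongrightarrow> 0"
  proof (rule LIMSEQ_I)
    fix e :: real assume "e > 0"
    with key[of "e/2"] obtain n where "\<forall>j\<ge>n. nrm M (\<lambda>x. h x - s j x) \<le> e / 2"
      by auto
    then show "\<exists>n. \<forall>j\<ge>n. norm (nrm M (\<lambda>x. h x - s j x) - 0) < e"
      using \<open>e > 0\<close> by (intro exI[of _ n]) fastforce
  qed
  ultimately show thesis
    by (rule that)
qed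

text \<open>
  The representing element minimizes \<open>J(f) = \<parallel>f\<parallel>\<^sup>2 - 2 \<phi>(f)\<close>: by the parallelogram identity minimizing
  sequences are Cauchy, and the derivative of \<open>J\<close> vanishes at the minimum.
\<close>

lemma (in prob_space) L2_Riesz:
  assumes lin: "\<And>f g a b. f \<in> L2_fun M \<Longrightarrow> g \<in> L2_fun M \<Longrightarrow>
      \<phi> (\<lambda>x. a * f x + b * g x) = a * \<phi> f + b * \<phi> g"
    and bnd: "\<And>f. f \<in> L2_fun M \<Longrightarrow> \<bar>\<phi> f\<bar> \<le> c * nrm M f"
  obtains h where "h \<in> L2_fun M" "\<And>f. f \<in> L2_fun M \<Longrightarrow> \<phi> f = ip M f h"
proof -
  define J where "J f = (nrm M f)\<^sup>2 - 2 * \<phi> f" for f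
  have zero: "(\<lambda>_. 0) \<in> L2_fun M"
    by (rule L2_fun_bounded[of _ 0]) auto
  have J_ge: "J f \<ge> - c\<^sup>2" if "f \<in> L2_fun M" for f
    using bnd[OF that] sum_squares_bound[of "nrm M f" c] unfolding J_def by (simp add: mult.commute abs_le_iff)
  define m where "m = Inf (J ` L2_fun M)"
  have bdd: "bdd_below (J ` L2_fun M)"
    using J_ge by (intro bdd_belowI2) auto
  have m_le: "m \<le> J f" if "f \<in> L2_fun M" for f
    unfolding m_def using bdd that by (intro cINF_lower) auto
  have "\<exists>f\<in>L2_fun M. J f < m + 1 / (real n + 1)" for n :: nat
  proof -
    have "Inf (J ` L2_fun M) < m + 1 / (real n + 1)"
      by (simp add: m_def)
    then show ?thesis
      using zero cInf_less_iff[OF _ bdd] by blast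
  qed
  then obtain s where s: "\<And>n. s n \<in> L2_fun M" "\<And>n. J (s n) < m + 1 / (real n + 1)"
    by metis
  have para: "(nrm M (\<lambda>x. f x - g x))\<^sup>2 \<le> 2 * J f + 2 * J g - 4 * m"
    if f: "f \<in> L2_fun M" and g: "g \<in> L2_fun M" for f g
  proof -
    let ?k = "\<lambda>x. (1/2) * f x + (1/2) * g x"
    have k: "?k \<in> L2_fun M" by (rule L2_fun_lin[OF f g])
    have 1: "(nrm M ?k)\<^sup>2 = (ip M f f + 2 * ip M f g + ip M g g) / 4"
      unfolding nrm_square ip_lin_self[OF f g] by (simp add: power2_eq_square field_simps)
    have 2: "(nrm M (\<lambda>x. 1 * f x + (-1) * g x))\<^sup>2 = ip M f f - 2 * ip M f g + ip M g g"
      unfolding nrm_square ip_lin_self[OF f g] by simp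
    have "J ?k = (ip M f f + 2 * ip M f g + ip M g g) / 4 - \<phi> f - \<phi> g"
      unfolding J_def 1 lin[OF f g] by simp
    with m_le[OF k] have "4 * m \<le> ip M f f + 2 * ip M f g + ip M g g - 4 * \<phi> f - 4 * \<phi> g"
      by argo
    with 2 show ?thesis
      by (simp add: J_def nrm_square)
  qed
  obtain h where h: "h \<in> L2_fun M" "(\<lambda>i. nrm M (\<lambda>x. h x - s i x)) \<longlonglongrightarrow> 0"
  proof (rule L2_complete)
    fix e :: real assume e: "e > 0"
    obtain n :: nat where n: "4 / e\<^sup>2 < real n"
      using reals_Archimedean2 by blast
    have "nrm M (\<lambda>x. s i x - s j x) < e" if "i \<ge> n" "j \<ge> n" for i j
    proof (rule power2_less_imp_less)
      have *: "1 / (real k + 1) \<le> 1 / (real n + 1)" if "k \<ge> n" for k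
        using that by (simp add: frac_le)
      have "(nrm M (\<lambda>x. s i x - s j x))\<^sup>2 \<le> 2 * J (s i) + 2 * J (s j) - 4 * m"
        by (intro para s)
      also have "\<dots> < 4 / (real n + 1)"
        using s(2)[of i] s(2)[of j] *[OF that(1)] *[OF that(2)] by simp
      also have "\<dots> < e\<^sup>2"
        using n e by (simp add: field_simps) (smt (verit) zero_less_power)
      finally show "(nrm M (\<lambda>x. s i x - s j x))\<^sup>2 < e\<^sup>2" .
    qed (use e in simp)
    then show "\<exists>n. \<forall>i\<ge>n. \<forall>j\<ge>n. nrm M (\<lambda>x. s i x - s j x) < e"
      by blast
  qed (use s in auto)
  have Jh: "J h \<le> m"
  proof (rule LIMSEQ_le_const)
    let ?d = "\<lambda>i. nrm M (\<lambda>x. h x - s i x)"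
    have "J h \<le> m + 1 / (real i + 1) + ?d i * (2 * nrm M h + ?d i + 2 * c)" for i
    proof -
      have d: "(\<lambda>x. h x - s i x) \<in> L2_fun M" by (intro L2_fun_diff h s)
      have a: "nrm M h \<le> nrm M (s i) + ?d i"
        using nrm_add_le[OF s(1)[of i] d] by simp
      have a': "nrm M (s i) \<le> nrm M h + ?d i"
        using nrm_diff_le[OF h(1) d] by simp
      have "(nrm M h)\<^sup>2 - (nrm M (s i))\<^sup>2 = (nrm M h - nrm M (s i)) * (nrm M h + nrm M (s i))"
        by (simp add: power2_eq_square algebra_simps)
      also have "\<dots> \<le> ?d i * (2 * nrm M h + ?d i)"
        using a a' by (intro mult_mono) auto
      finally have 1: "(nrm M h)\<^sup>2 - (nrm M (s i))\<^sup>2 \<le> ?d i * (2 * nrm M h + ?d i)" .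
      have "\<phi> (s i) - \<phi> h \<le> c * ?d i"
        using bnd[OF d] lin[OF h(1) s(1)[of i], of 1 "-1"] by simp
      with 1 s(2)[of i] show ?thesis
        unfolding J_def by (simp add: algebra_simps)
    qed
    then show "\<exists>N. \<forall>i\<ge>N. J h \<le> m + 1 / (real i + 1) + ?d i * (2 * nrm M h + ?d i + 2 * c)"
      by blast
    have "(\<lambda>i. m + 1 / (real i + 1) + ?d i * (2 * nrm M h + ?d i + 2 * c)) \<longlonglongrightarrow>
        m + 0 + 0 * (2 * nrm M h + 0 + 2 * c)"
      using LIMSEQ_inverse_real_of_nat by (intro tendsto_intros h) (simp add: inverse_eq_divide add.commute)
    then show "(\<lambda>i. m + 1 / (real i + 1) + ?d i * (2 * nrm M h + ?d i + 2 * c)) \<longlonglongrightarrow> m"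
      by simp
  qed
  have "\<phi> f = ip M f h" if f: "f \<in> L2_fun M" for f
  proof -
    have pos: "0 \<le> 2 * t * (ip M f h - \<phi> f) + t\<^sup>2 * ip M f f" for t
    proof -
      have k: "(\<lambda>x. 1 * h x + t * f x) \<in> L2_fun M" by (rule L2_fun_lin[OF h(1) f])
      have "J h \<le> J (\<lambda>x. 1 * h x + t * f x)"
        using Jh m_le[OF k] by linarith
      moreover have "(nrm M (\<lambda>x. 1 * h x + t * f x))\<^sup>2 = ip M h h + 2 * t * ip M f h + t\<^sup>2 * ip M f f"
        unfolding nrm_square ip_lin_self[OF h(1) f] by (simp add: ip_commute[of M h f])
      ultimately show ?thesis
        unfolding J_def lin[OF h(1) f] by (simp add: nrm_square algebra_simps)
    qed
    \<comment> \<open>The optimal step is \<open>- d / \<parallel>f\<parallel>\<^sup>2\<close>; enlarging the denominator avoids a division by zero.\<close>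
    define d where "d = ip M f h - \<phi> f"
    define q where "q = ip M f f + 1"
    have q: "q > 0" "ip M f f < q" using ip_self_nonneg[of M f] by (auto simp: q_def)
    have "0 \<le> - 2 * (d/q) * d + (d/q)\<^sup>2 * ip M f f"
      using pos[of "-d/q"] unfolding d_def[symmetric] by (simp add: power_divide)
    also have "\<dots> \<le> - 2 * (d/q) * d + (d/q)\<^sup>2 * q"
      using q by (intro add_left_mono mult_left_mono) auto
    also have "\<dots> = - d\<^sup>2 / q"
      using q by (simp add: power2_eq_square field_simps)
    finally have "d\<^sup>2 \<le> 0" using q by (simp add: field_simps)
    then show ?thesis by (simp add: d_def)
  qed
  with h(1) show thesis
    by (rule that)
qed

section \<open>Bounded operators given by their graphs\<close>

lemma bounded_op_app:
  assumes "bounded_op M R" "f \<in> L2_fun M"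
  shows "(f, op_app R f) \<in> R" "op_app R f \<in> L2_fun M"
proof -
  have "f \<in> Domain R" using assms by (simp add: bounded_op_def)
  then obtain g where "(f, g) \<in> R" by blast
  then show 1: "(f, op_app R f) \<in> R"
    unfolding op_app_def by (rule someI[where P="\<lambda>g. (f, g) \<in> _"])
  then show "op_app R f \<in> L2_fun M"
    using assms(1) by (auto simp: bounded_op_def)
qed

lemma bounded_op_lin:
  assumes "bounded_op M R" "(f, g) \<in> R" "(f', g') \<in> R"
  shows "((\<lambda>x. a * f x + b * f' x), (\<lambda>x. a * g x + b * g' x)) \<in> R"
proof -
  have "\<forall>(f, g) \<in> R. \<forall>(f', g') \<in> R. \<forall>a b.
      ((\<lambda>x. a * f x + b * f' x), (\<lambda>x. a * g x + b * g' x)) \<in> R"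
    using assms(1) unfolding bounded_op_def by blast
  then show ?thesis using assms(2,3) by fast
qed

lemma bounded_op_bound:
  assumes "bounded_op M R"
  obtains c where "\<And>f g. (f, g) \<in> R \<Longrightarrow> nrm M g \<le> c * nrm M f"
proof -
  from assms obtain c where "\<forall>(f, g) \<in> R. nrm M g \<le> c * nrm M f"
    unfolding bounded_op_def by blast
  then show thesis by (intro that) auto
qed

lemma op_addI:
  assumes "(f, u) \<in> R" "(f, v) \<in> S" "h \<in> L2_fun M" "AE x in M. h x = u x + v x"
  shows "(f, h) \<in> op_add M R S"
  using assms unfolding op_add_def by blast

lemma op_addE:
  assumes "(f, h) \<in> op_add M R S"
  obtains u v where "h \<in> L2_fun M" "(f, u) \<in> R" "(f, v) \<in> S" "AE x in M. h x = u x + v x"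
  using assms unfolding op_add_def by blast

text \<open>
  A graph determines the values of a bounded operator only up to null sets. The bound, applied to a
  difference of two pairs, shows that it determines them that far.
\<close>

lemma bounded_op_AE_unique:
  assumes R: "bounded_op M R" and fg: "(f, g) \<in> R" "(f', g') \<in> R" "AE x in M. f x = f' x"
  shows "AE x in M. g x = g' x"
proof -
  have L2: "f \<in> L2_fun M" "f' \<in> L2_fun M" "g \<in> L2_fun M" "g' \<in> L2_fun M"
    using R fg by (auto simp: bounded_op_def)
  obtain c where c: "\<And>f g. (f, g) \<in> R \<Longrightarrow> nrm M g \<le> c * nrm M f"
    using bounded_op_bound[OF R] by blast
  have "nrm M (\<lambda>x. 1 * f x + (-1) * f' x) = nrm M (\<lambda>_. 0)"
    using fg(3) L2[THEN L2_fun_measurable] by (intro nrm_cong_AE) auto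
  also have "\<dots> = 0" by (simp add: nrm_def ip_def)
  finally have "nrm M (\<lambda>x. 1 * g x + (-1) * g' x) \<le> 0"
    using c[OF bounded_op_lin[OF R fg(1,2), of 1 "-1"]] by simp
  then have "nrm M (\<lambda>x. 1 * g x + (-1) * g' x) = 0"
    using nrm_nonneg by (rule antisym)
  then have "AE x in M. 1 * g x + (-1) * g' x = 0"
    using L2 by (intro nrm_eq_0_AE L2_fun_lin)
  then show ?thesis by simp
qed

lemma bounded_op_app_lin:
  assumes "bounded_op M R" "f \<in> L2_fun M" "g \<in> L2_fun M"
  shows "AE x in M. op_app R (\<lambda>x. a * f x + b * g x) x = a * op_app R f x + b * op_app R g x"
  by (rule bounded_op_AE_unique[OF assms(1) bounded_op_app(1)[OF assms(1) L2_fun_lin[OF assms(2,3)]]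
        bounded_op_lin[OF assms(1) bounded_op_app(1)[OF assms(1,2)] bounded_op_app(1)[OF assms(1,3)]]])
    simp

text \<open>
  The value \<open>op_app R g\<close> is arbitrary for \<open>g\<close> outside the domain of \<open>R\<close>. The modified scalar product,
  which applies an operator built from an adjoint, is therefore meaningful only because that adjoint is total.
\<close>

lemma (in prob_space) bounded_op_adj_total:
  assumes R: "bounded_op M R" and g: "g \<in> L2_fun M"
  shows "\<exists>h. (g, h) \<in> op_adj M R"
proof -
  obtain c where c: "\<And>f g. (f, g) \<in> R \<Longrightarrow> nrm M g \<le> c * nrm M f"
    using bounded_op_bound[OF R] by blast
  note app = bounded_op_app[OF R]
  obtain h where h: "h \<in> L2_fun M" "\<And>f. f \<in> L2_fun M \<Longrightarrow> ip M (op_app R f) g = ip M f h"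
  proof (rule L2_Riesz[where \<phi>="\<lambda>f. ip M (op_app R f) g" and c="c * nrm M g"])
    fix f k :: "'a \<Rightarrow> real" and a b assume f: "f \<in> L2_fun M" and k: "k \<in> L2_fun M"
    have "ip M (op_app R (\<lambda>x. a * f x + b * k x)) g
        = ip M (\<lambda>x. a * op_app R f x + b * op_app R k x) g"
      using f k g app bounded_op_app_lin[OF R f k, of a b]
      by (intro ip_cong_AE) (auto intro!: L2_fun_measurable L2_fun_lin)
    also have "\<dots> = a * ip M (op_app R f) g + b * ip M (op_app R k) g"
      using f k g app by (intro ip_lin_left)
    finally show "ip M (op_app R (\<lambda>x. a * f x + b * k x)) g = \<dots>" .
  next
    fix f :: "'a \<Rightarrow> real" assume f: "f \<in> L2_fun M"
    have "\<bar>ip M (op_app R f) g\<bar> \<le> nrm M (op_app R f) * nrm M g"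
      by (intro ip_Cauchy_Schwarz app f g)
    also have "\<dots> \<le> c * nrm M f * nrm M g"
      using c[OF app(1)[OF f]] by (intro mult_right_mono) auto
    finally show "\<bar>ip M (op_app R f) g\<bar> \<le> c * nrm M g * nrm M f" by (simp add: ac_simps)
  qed blast
  have "(g, h) \<in> op_adj M R"
    unfolding op_adj_def
  proof (clarsimp simp: g h(1))
    fix f f' assume ff': "(f, f') \<in> R"
    then have f: "f \<in> L2_fun M" "f' \<in> L2_fun M" using R by (auto simp: bounded_op_def)
    have "ip M f' g = ip M (op_app R f) g"
      using f g app bounded_op_AE_unique[OF R ff' app(1)[OF f(1)]]
      by (intro ip_cong_AE) (auto intro: L2_fun_measurable)
    then show "ip M f' g = ip M f h" using h(2)[OF f(1)] by simp
  qed
  then show ?thesis by blast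
qed

text \<open>
  The form \<open>\<langle>f, (I + \<epsilon> (b + b\<^sup>*)) g\<rangle>\<close> with the adjoint moved to the other factor: in this form
  it refers to \<open>b\<close> only, and its symmetry is evident.
\<close>

definition mform ::
  "'x measure \<Rightarrow> (('x \<Rightarrow> real) \<Rightarrow> ('x \<Rightarrow> real)) \<Rightarrow> real \<Rightarrow> ('x \<Rightarrow> real) \<Rightarrow> ('x \<Rightarrow> real) \<Rightarrow> real" where
  "mform M b \<epsilon> f g = ip M f g + \<epsilon> * (ip M f (b g) + ip M (b f) g)"

lemma (in prob_space) ip_eps_eq_mform:
  assumes B: "bounded_op M B" and f: "f \<in> L2_fun M" and g: "g \<in> L2_fun M"
  shows "ip_eps M B \<epsilon> f g = mform M (op_app B) \<epsilon> f g"
proof -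
  note app = bounded_op_app[OF B]
  let ?K = "op_add M (op_id M) (op_scale M \<epsilon> (op_add M B (op_adj M B)))"
  obtain h where h: "(g, h) \<in> op_adj M B"
    using bounded_op_adj_total[OF B g] by blast
  then have hL: "h \<in> L2_fun M" by (auto simp: op_adj_def)
  have 1: "(g, \<lambda>x. op_app B g x + h x) \<in> op_add M B (op_adj M B)"
    using app[OF g] h hL by (intro op_addI[OF _ h] L2_fun_add) auto
  then have 2: "(g, \<lambda>x. \<epsilon> * (op_app B g x + h x)) \<in> op_scale M \<epsilon> (op_add M B (op_adj M B))"
    unfolding op_scale_def using app[OF g] hL by (auto intro!: L2_fun_scale L2_fun_add)
  have 3: "(g, g) \<in> op_id M" using g by (auto simp: op_of_def)
  have "(g, \<lambda>x. g x + \<epsilon> * (op_app B g x + h x)) \<in> ?K"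
    using app[OF g] hL by (intro op_addI[OF 3 2] L2_fun_add[OF g] L2_fun_scale L2_fun_add) auto
  then have "(g, op_app ?K g) \<in> ?K"
    unfolding op_app_def[of ?K] by (rule someI[where P="\<lambda>k. (g, k) \<in> _"])
  then obtain u v where k: "op_app ?K g \<in> L2_fun M"
    and u: "(g, u) \<in> op_id M" and v: "(g, v) \<in> op_scale M \<epsilon> (op_add M B (op_adj M B))"
    and kuv: "AE x in M. op_app ?K g x = u x + v x"
    by (rule op_addE)
  from v obtain w where w: "(g, w) \<in> op_add M B (op_adj M B)" "AE x in M. v x = \<epsilon> * w x"
    by (auto simp: op_scale_def)
  from w(1) obtain p q where p: "(g, p) \<in> B" and q: "(g, q) \<in> op_adj M B"
    and wpq: "AE x in M. w x = p x + q x"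
    by (rule op_addE)
  have qL: "q \<in> L2_fun M" using q by (auto simp: op_adj_def)
  have ae: "AE x in M. op_app ?K g x = 1 * g x + \<epsilon> * (1 * op_app B g x + 1 * q x)"
    using kuv w(2) wpq bounded_op_AE_unique[OF B p app(1)[OF g]] u
    by (auto simp: op_of_def)
  have s: "(\<lambda>x. 1 * op_app B g x + 1 * q x) \<in> L2_fun M"
    by (intro L2_fun_lin app g qL)
  have "ip_eps M B \<epsilon> f g = ip M f (op_app ?K g)"
    by (simp add: ip_eps_def)
  also have "\<dots> = ip M f (\<lambda>x. 1 * g x + \<epsilon> * (1 * op_app B g x + 1 * q x))"
    using f k ae by (intro ip_cong_AE L2_fun_measurable L2_fun_lin[OF g s]) auto
  also have "\<dots> = 1 * ip M f g + \<epsilon> * ip M f (\<lambda>x. 1 * op_app B g x + 1 * q x)"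
    by (rule ip_lin_right[OF g s f])
  also have "ip M f (\<lambda>x. 1 * op_app B g x + 1 * q x) = 1 * ip M f (op_app B g) + 1 * ip M f q"
    by (rule ip_lin_right[OF app(2)[OF g] qL f])
  also have "ip M f q = ip M (op_app B f) g"
    using q app(1)[OF f] by (auto simp: op_adj_def)
  finally show ?thesis by (simp add: mform_def)
qed

text \<open>
  Stated with values in the extended nonnegative reals, so that it applies on every fibre of a product
  space, also where the restriction of a square-integrable function fails to be square-integrable.
\<close>

lemma (in prob_space) nn_integral_centered_square_le:
  fixes h :: "'a \<Rightarrow> real"
  assumes [measurable]: "h \<in> borel_measurable M"
  shows "(\<integral>\<^sup>+x. ennreal ((h x - expectation h)\<^sup>2) \<partial>M) \<le> (\<integral>\<^sup>+x. ennreal ((h x)\<^sup>2) \<partial>M)"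
    and "ennreal ((expectation h)\<^sup>2) \<le> (\<integral>\<^sup>+x. ennreal ((h x)\<^sup>2) \<partial>M)"
proof -
  have "(\<integral>\<^sup>+x. ennreal ((h x - expectation h)\<^sup>2) \<partial>M) \<le> (\<integral>\<^sup>+x. ennreal ((h x)\<^sup>2) \<partial>M) \<and>
    ennreal ((expectation h)\<^sup>2) \<le> (\<integral>\<^sup>+x. ennreal ((h x)\<^sup>2) \<partial>M)"
  proof (cases "(\<integral>\<^sup>+x. ennreal ((h x)\<^sup>2) \<partial>M) = \<infinity>")
    case False
    then have sq: "integrable M (\<lambda>x. (h x)\<^sup>2)"
      by (intro integrableI_bounded) (auto simp: less_top)
    then have h: "integrable M h"
      by (rule square_integrable_imp_integrable[rotated]) simp
    have eq: "(\<integral>\<^sup>+x. ennreal ((h x)\<^sup>2) \<partial>M) = ennreal (expectation (\<lambda>x. (h x)\<^sup>2))"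
      using sq by (intro nn_integral_eq_integral) auto
    have sq': "integrable M (\<lambda>x. (h x - expectation h)\<^sup>2)"
      using sq h by (auto simp: power2_diff)
    have eq': "(\<integral>\<^sup>+x. ennreal ((h x - expectation h)\<^sup>2) \<partial>M) = ennreal (variance h)"
      using sq' by (intro nn_integral_eq_integral) auto
    have "variance h = expectation (\<lambda>x. (h x)\<^sup>2) - (expectation h)\<^sup>2"
      using h sq by (rule variance_eq)
    moreover have "variance h \<ge> 0" by (rule variance_positive)
    ultimately show ?thesis
      unfolding eq eq' by (intro conjI ennreal_leI) (auto simp del: variance_positive)
  qed auto
  then show "(\<integral>\<^sup>+x. ennreal ((h x - expectation h)\<^sup>2) \<partial>M) \<le> (\<integral>\<^sup>+x. ennreal ((h x)\<^sup>2) \<partial>M)"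
    and "ennreal ((expectation h)\<^sup>2) \<le> (\<integral>\<^sup>+x. ennreal ((h x)\<^sup>2) \<partial>M)" by auto
qed

lemma L2_funI_nn_integral_le:
  assumes f: "f \<in> L2_fun M" and [measurable]: "g \<in> borel_measurable M"
    and le: "(\<integral>\<^sup>+x. ennreal ((g x)\<^sup>2) \<partial>M) \<le> (\<integral>\<^sup>+x. ennreal ((f x)\<^sup>2) \<partial>M)"
  shows "g \<in> L2_fun M" "nrm M g \<le> nrm M f"
proof -
  have "(\<integral>\<^sup>+x. ennreal ((f x)\<^sup>2) \<partial>M) = ennreal (ip M f f)"
    unfolding ip_def power2_eq_square[symmetric] using f
    by (intro nn_integral_eq_integral) (auto simp: L2_fun_def)
  with le have le': "(\<integral>\<^sup>+x. ennreal ((g x)\<^sup>2) \<partial>M) \<le> ennreal (ip M f f)" by simp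
  then have int: "integrable M (\<lambda>x. (g x)\<^sup>2)"
    by (intro integrableI_bounded) (auto simp: le_less_trans)
  then show "g \<in> L2_fun M" by (simp add: L2_fun_def)
  have "ennreal (ip M g g) = (\<integral>\<^sup>+x. ennreal ((g x)\<^sup>2) \<partial>M)"
    unfolding ip_def power2_eq_square[symmetric] using int
    by (intro nn_integral_eq_integral[symmetric]) auto
  with le' have "ennreal (ip M g g) \<le> ennreal (ip M f f)" by simp
  then have "ip M g g \<le> ip M f f"
    by (subst (asm) ennreal_le_iff) (simp_all add: ip_self_nonneg)
  then show "nrm M g \<le> nrm M f" by (simp add: nrm_def)
qed

text \<open>
  On each fibre, subtracting the projection subtracts the mean, and a variance is at most the second moment.
\<close>

lemma momentum_proj_complement_contraction:
  assumes \<nu>: "prob_space \<nu>" and \<rho>: "prob_space \<rho>"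
    and f: "f \<in> L2_fun (\<nu> \<Otimes>\<^sub>M \<rho>)" (is "f \<in> L2_fun ?M")
  shows "nrm ?M (op_app (op_minus ?M (op_id ?M) (momentum_proj ?M \<rho>)) f) \<le> nrm ?M f"
proof -
  interpret \<nu>: prob_space \<nu> by fact
  interpret \<rho>: prob_space \<rho> by fact
  have [measurable]: "f \<in> borel_measurable ?M" using f by (rule L2_fun_measurable)
  define p where "p = (\<lambda>(q, p::'b). LINT p'|\<rho>. f (q, p'))"
  have pm [measurable]: "p \<in> borel_measurable ?M"
    unfolding p_def by measurable
  have p: "p \<in> L2_fun ?M"
  proof (rule L2_funI_nn_integral_le(1)[OF f pm])
    have "(\<integral>\<^sup>+x. ennreal ((p x)\<^sup>2) \<partial>?M) = (\<integral>\<^sup>+q. \<integral>\<^sup>+p'. ennreal ((p (q, p'))\<^sup>2) \<partial>\<rho> \<partial>\<nu>)"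
      by (rule \<rho>.nn_integral_fst[symmetric]) measurable
    also have "\<dots> \<le> (\<integral>\<^sup>+q. \<integral>\<^sup>+p'. ennreal ((f (q, p'))\<^sup>2) \<partial>\<rho> \<partial>\<nu>)"
    proof (rule nn_integral_mono)
      fix q assume q: "q \<in> space \<nu>"
      have "(\<integral>\<^sup>+p'. ennreal ((p (q, p'))\<^sup>2) \<partial>\<rho>) = ennreal ((LINT p'|\<rho>. f (q, p'))\<^sup>2)"
        by (simp add: p_def \<rho>.emeasure_space_1)
      also have "\<dots> \<le> (\<integral>\<^sup>+p'. ennreal ((f (q, p'))\<^sup>2) \<partial>\<rho>)"
        using q by (intro \<rho>.nn_integral_centered_square_le(2)) measurable
      finally show "(\<integral>\<^sup>+p'. ennreal ((p (q, p'))\<^sup>2) \<partial>\<rho>) \<le> \<dots>" .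
    qed
    also have "\<dots> = (\<integral>\<^sup>+x. ennreal ((f x)\<^sup>2) \<partial>?M)"
      by (rule \<rho>.nn_integral_fst) measurable
    finally show "(\<integral>\<^sup>+x. ennreal ((p x)\<^sup>2) \<partial>?M) \<le> (\<integral>\<^sup>+x. ennreal ((f x)\<^sup>2) \<partial>?M)" .
  qed
  let ?I = "op_minus ?M (op_id ?M) (momentum_proj ?M \<rho>)"
  have "(f, \<lambda>x. (-1) * p x) \<in> op_scale ?M (-1) (momentum_proj ?M \<rho>)"
    using f p L2_fun_scale[OF p, of "-1"] by (auto simp: op_scale_def momentum_proj_def op_of_def p_def)
  moreover have "(\<lambda>x. f x - p x) \<in> L2_fun ?M"
    by (rule L2_fun_diff[OF f p])
  ultimately have "(f, \<lambda>x. f x - p x) \<in> ?I"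
    using f by (intro op_addI[where u=f and v="\<lambda>x. (-1) * p x"]) (auto simp: op_of_def)
  then have "(f, op_app ?I f) \<in> ?I"
    unfolding op_app_def by (rule someI[where P="\<lambda>g. (f, g) \<in> _"])
  then obtain u v where k: "op_app ?I f \<in> L2_fun ?M" and u: "(f, u) \<in> op_id ?M"
    and v: "(f, v) \<in> op_scale ?M (-1) (momentum_proj ?M \<rho>)"
    and kuv: "AE x in ?M. op_app ?I f x = u x + v x"
    by (rule op_addE)
  from v obtain w where w: "(f, w) \<in> momentum_proj ?M \<rho>" "AE x in ?M. v x = - 1 * w x"
    unfolding op_scale_def by blast
  have "AE x in ?M. w x = p x"
    using w(1) by (simp add: momentum_proj_def op_of_def p_def)
  moreover have "AE x in ?M. u x = f x"
    using u by (simp add: op_of_def)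
  ultimately have ae: "AE x in ?M. op_app ?I f x = f x - p x"
    using kuv w(2) by eventually_elim simp
  have "nrm ?M (op_app ?I f) = nrm ?M (\<lambda>x. f x - p x)"
    using k ae by (intro nrm_cong_AE) (auto intro: L2_fun_measurable)
  also have "\<dots> \<le> nrm ?M f"
  proof (rule L2_funI_nn_integral_le(2)[OF f])
    have "(\<integral>\<^sup>+x. ennreal ((f x - p x)\<^sup>2) \<partial>?M)
        = (\<integral>\<^sup>+q. \<integral>\<^sup>+p'. ennreal ((f (q, p') - p (q, p'))\<^sup>2) \<partial>\<rho> \<partial>\<nu>)"
      by (rule \<rho>.nn_integral_fst[symmetric]) measurable
    also have "\<dots> \<le> (\<integral>\<^sup>+q. \<integral>\<^sup>+p'. ennreal ((f (q, p'))\<^sup>2) \<partial>\<rho> \<partial>\<nu>)"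
      unfolding p_def prod.case
      by (rule nn_integral_mono, rule \<rho>.nn_integral_centered_square_le(1)) measurable
    also have "\<dots> = (\<integral>\<^sup>+x. ennreal ((f x)\<^sup>2) \<partial>?M)"
      by (rule \<rho>.nn_integral_fst) measurable
    finally show "(\<integral>\<^sup>+x. ennreal ((f x - p x)\<^sup>2) \<partial>?M) \<le> (\<integral>\<^sup>+x. ennreal ((f x)\<^sup>2) \<partial>?M)" .
  qed measurable
  finally show ?thesis .
qed

section \<open>The modified scalar product\<close>

text \<open>
  The properties of the operator \<open>B\<close> on which the estimates rest, for a choice \<open>b\<close> of representatives of its
  values; linearity then holds almost everywhere only. The bound \<open>1/2\<close> makes \<open>b + b\<^sup>*\<close> a contraction, and
  the conditions on \<open>1\<close> say that \<open>b + b\<^sup>*\<close> annihilates the constants.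
\<close>

locale half_contraction = prob_space M for M :: "'x measure" +
  fixes b :: "('x \<Rightarrow> real) \<Rightarrow> ('x \<Rightarrow> real)" and \<epsilon> :: real
  assumes b_L2: "f \<in> L2_fun M \<Longrightarrow> b f \<in> L2_fun M"
    and b_lin: "f \<in> L2_fun M \<Longrightarrow> g \<in> L2_fun M \<Longrightarrow>
      AE x in M. b (\<lambda>x. a * f x + a' * g x) x = a * b f x + a' * b g x"
    and b_bound: "f \<in> L2_fun M \<Longrightarrow> nrm M (b f) \<le> nrm M f / 2"
    and b_one: "AE x in M. b (\<lambda>_. 1) x = 0"
    and b_mean: "f \<in> L2_fun M \<Longrightarrow> (LINT x|M. b f x) = 0"
    and eps: "0 < \<epsilon>" "\<epsilon> < 1"
begin

lemma L2_one [simp]: "(\<lambda>_. 1) \<in> L2_fun M"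
  by (rule L2_fun_bounded[of _ 1]) auto

lemma mform_commute: "mform M b \<epsilon> f g = mform M b \<epsilon> g f"
  by (simp add: mform_def ip_commute[of M f g] ip_commute[of M f "b g"] ip_commute[of M "b f" g])

lemma mform_lin_left:
  assumes "f \<in> L2_fun M" "g \<in> L2_fun M" "h \<in> L2_fun M"
  shows "mform M b \<epsilon> (\<lambda>x. a * f x + a' * g x) h = a * mform M b \<epsilon> f h + a' * mform M b \<epsilon> g h"
proof -
  have "ip M (b (\<lambda>x. a * f x + a' * g x)) h = ip M (\<lambda>x. a * b f x + a' * b g x) h"
    using assms b_lin[OF assms(1,2), of a a']
    by (intro ip_cong_AE) (auto intro!: L2_fun_measurable L2_fun_lin b_L2)
  then show ?thesis
    using assms by (simp add: mform_def ip_lin_left b_L2 algebra_simps)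
qed

lemma mform_lin_right:
  assumes "f \<in> L2_fun M" "g \<in> L2_fun M" "h \<in> L2_fun M"
  shows "mform M b \<epsilon> h (\<lambda>x. a * f x + a' * g x) = a * mform M b \<epsilon> h f + a' * mform M b \<epsilon> h g"
  using mform_lin_left[OF assms] by (simp add: mform_commute)

lemma mform_bound:
  assumes f: "f \<in> L2_fun M" and g: "g \<in> L2_fun M"
  shows "\<bar>mform M b \<epsilon> f g\<bar> \<le> (1 + \<epsilon>) * (nrm M f * nrm M g)"
proof -
  have "\<bar>ip M f (b g)\<bar> \<le> nrm M f * (nrm M g / 2)"
    using ip_Cauchy_Schwarz[OF f b_L2[OF g]] mult_left_mono[OF b_bound[OF g], of "nrm M f"] by simp
  moreover have "\<bar>ip M (b f) g\<bar> \<le> nrm M f / 2 * nrm M g"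
    using ip_Cauchy_Schwarz[OF b_L2[OF f] g] mult_right_mono[OF b_bound[OF f], of "nrm M g"] by simp
  ultimately have "\<bar>ip M f (b g) + ip M (b f) g\<bar> \<le> nrm M f * nrm M g" by linarith
  then have "\<bar>\<epsilon> * (ip M f (b g) + ip M (b f) g)\<bar> \<le> \<epsilon> * (nrm M f * nrm M g)"
    using eps by (simp add: abs_mult)
  then show ?thesis
    using ip_Cauchy_Schwarz[OF f g] unfolding mform_def by (simp add: algebra_simps abs_le_iff)
qed

lemma mform_self_ge:
  assumes f: "f \<in> L2_fun M"
  shows "(1 - \<epsilon>) * (nrm M f)\<^sup>2 \<le> mform M b \<epsilon> f f"
proof -
  have "\<bar>ip M f (b f)\<bar> \<le> nrm M f * (nrm M f / 2)"
    using ip_Cauchy_Schwarz[OF f b_L2[OF f]] mult_left_mono[OF b_bound[OF f], of "nrm M f"] by simp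
  then have "- (nrm M f)\<^sup>2 \<le> ip M f (b f) + ip M (b f) f"
    by (simp add: ip_commute[of M "b f" f] power2_eq_square)
  then have "\<epsilon> * (- (nrm M f)\<^sup>2) \<le> \<epsilon> * (ip M f (b f) + ip M (b f) f)"
    using eps by (intro mult_left_mono) auto
  then show ?thesis
    by (simp add: mform_def nrm_square[symmetric] algebra_simps)
qed

lemma mform_self_nonneg: "f \<in> L2_fun M \<Longrightarrow> 0 \<le> mform M b \<epsilon> f f"
  using mform_self_ge[of f] eps by (smt (verit) mult_nonneg_nonneg zero_le_power2)

lemma mform_one:
  assumes f: "f \<in> L2_fun M"
  shows "mform M b \<epsilon> f (\<lambda>_. 1) = (LINT x|M. f x)"
proof -
  have "ip M f (b (\<lambda>_. 1)) = ip M f (\<lambda>_. 0)"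
    using f b_one b_L2[OF L2_one] by (intro ip_cong_AE) (auto intro: L2_fun_measurable)
  moreover have "ip M (b f) (\<lambda>_. 1) = 0"
    using b_mean[OF f] by (simp add: ip_def)
  ultimately show ?thesis
    by (simp add: mform_def ip_def)
qed

lemma mform_cong_AE_left:
  assumes f: "f \<in> L2_fun M" and f': "f' \<in> L2_fun M" and ae: "AE x in M. f x = f' x"
    and g: "g \<in> L2_fun M"
  shows "mform M b \<epsilon> f g = mform M b \<epsilon> f' g"
proof -
  have d: "(\<lambda>x. f x - f' x) \<in> L2_fun M" by (rule L2_fun_diff[OF f f'])
  have "nrm M (\<lambda>x. f x - f' x) = nrm M (\<lambda>_. 0)"
    using ae d by (intro nrm_cong_AE) (auto intro: L2_fun_measurable)
  then have "mform M b \<epsilon> (\<lambda>x. f x - f' x) g = 0"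
    using mform_bound[OF d g] by (simp add: nrm_def ip_def)
  then show ?thesis
    using mform_lin_left[OF f f' g, of 1 "-1"] by simp
qed

text \<open>
  Split \<open>g = c + h\<close> into its mean and a centred part. The form does not see the interaction of
  constants with centred functions, so the potential \<open>f\<close> enters through a term linear in
  \<open>c \<parallel>h\<parallel>\<close>, controlled by \<open>\<parallel>f\<parallel>\<close> only, and a term quadratic in \<open>\<parallel>h\<parallel>\<close>, controlled by the sup norm.
  The dissipation \<open>\<Lambda> \<parallel>h\<parallel>\<^sup>2\<close> absorbs the second, and completing the square leaves a multiple of
  \<open>c\<^sup>2\<close>.
\<close>

lemma mform_potential_bound:
  assumes f [measurable]: "f \<in> borel_measurable M" and F: "\<And>x. x \<in> space M \<Longrightarrow> \<bar>f x\<bar> \<le> F"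
    and mean: "(LINT x|M. f x) = 0" and g: "g \<in> L2_fun M"
    and lam: "0 \<le> lam" "lam * (1 + \<epsilon>) * F < \<Lambda>"
  shows "lam * mform M b \<epsilon> (\<lambda>x. f x * g x) g - \<Lambda> * variance g
    \<le> (lam * (1 + \<epsilon> / 2) * nrm M f)\<^sup>2 / (\<Lambda> - lam * (1 + \<epsilon>) * F) * mform M b \<epsilon> g g"
proof -
  obtain x0 where "x0 \<in> space M" using not_empty by auto
  then have F0: "0 \<le> F" using F[of x0] by linarith
  define c where "c = (LINT x|M. g x)"
  define h where "h = (\<lambda>x. 1 * g x + (-c) * 1)"
  define s where "s = nrm M f"
  define H where "H = nrm M h"
  define fh where "fh = (\<lambda>x. f x * h x)"
  have fL: "f \<in> L2_fun M" using f F by (rule L2_fun_bounded)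
  have hL: "h \<in> L2_fun M" unfolding h_def by (rule L2_fun_lin[OF g L2_one])
  have [measurable]: "h \<in> borel_measurable M" using hL by (rule L2_fun_measurable)
  have g_eq: "g = (\<lambda>x. 1 * h x + c * 1)" by (auto simp: h_def)
  have h_mean: "(LINT x|M. h x) = 0"
    using L2_fun_integrable[OF g] by (simp add: h_def c_def prob_space)
  have var: "variance g = H\<^sup>2"
    unfolding H_def nrm_square by (simp add: ip_def h_def c_def power2_eq_square)
  have le: "AE x in M. \<bar>fh x\<bar> \<le> \<bar>F * h x\<bar>"
    using F F0 by (auto simp: fh_def abs_mult intro!: AE_I2 mult_right_mono)
  have fhL: "fh \<in> L2_fun M"
  proof -
    have "integrable M (\<lambda>x. (fh x)\<^sup>2)"
    proof (rule Bochner_Integration.integrable_bound)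
      show "integrable M (\<lambda>x. (F * h x)\<^sup>2)" using L2_fun_scale[OF hL, of F] by (simp add: L2_fun_def)
      show "AE x in M. norm ((fh x)\<^sup>2) \<le> norm ((F * h x)\<^sup>2)"
        using le by eventually_elim (simp add: abs_le_square_iff)
    qed (simp add: fh_def)
    then show ?thesis by (simp add: L2_fun_def fh_def)
  qed
  have fh_nrm: "nrm M fh \<le> F * H"
    using nrm_mono[OF L2_fun_measurable[OF fhL] L2_fun_scale[OF hL, of F] le] F0
    by (simp add: nrm_scale H_def)
  have fg: "(\<lambda>x. f x * g x) = (\<lambda>x. 1 * fh x + c * f x)"
    by (auto simp: g_eq fh_def algebra_simps)
  have fgL: "(\<lambda>x. 1 * fh x + c * f x) \<in> L2_fun M" by (rule L2_fun_lin[OF fhL fL])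
  have "mform M b \<epsilon> (\<lambda>x. f x * g x) g = mform M b \<epsilon> (\<lambda>x. 1 * fh x + c * f x) (\<lambda>x. 1 * h x + c * 1)"
    using g_eq fg by simp
  also have "\<dots> = 1 * mform M b \<epsilon> (\<lambda>x. 1 * fh x + c * f x) h
      + c * mform M b \<epsilon> (\<lambda>x. 1 * fh x + c * f x) (\<lambda>_. 1)"
    by (rule mform_lin_right[OF hL L2_one fgL])
  also have "mform M b \<epsilon> (\<lambda>x. 1 * fh x + c * f x) (\<lambda>_. 1) = (LINT x|M. fh x)"
    unfolding mform_one[OF fgL] using L2_fun_integrable[OF fhL] L2_fun_integrable[OF fL] mean by simp
  also have "(LINT x|M. fh x) = ip M f h" by (simp add: ip_def fh_def)
  also have "mform M b \<epsilon> (\<lambda>x. 1 * fh x + c * f x) h = 1 * mform M b \<epsilon> fh h + c * mform M b \<epsilon> f h"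
    by (rule mform_lin_left[OF fhL fL hL])
  finally have eq: "mform M b \<epsilon> (\<lambda>x. f x * g x) g = mform M b \<epsilon> fh h + c * (mform M b \<epsilon> f h + ip M f h)"
    by (simp add: algebra_simps)
  have 1: "mform M b \<epsilon> fh h \<le> (1 + \<epsilon>) * F * H\<^sup>2"
  proof -
    have "mform M b \<epsilon> fh h \<le> (1 + \<epsilon>) * (nrm M fh * H)"
      using mform_bound[OF fhL hL] by (simp add: H_def abs_le_iff)
    also have "\<dots> \<le> (1 + \<epsilon>) * (F * H * H)"
      using fh_nrm eps by (intro mult_left_mono mult_right_mono) (auto simp: H_def)
    finally show ?thesis by (simp add: power2_eq_square ac_simps)
  qed
  have 2: "c * (mform M b \<epsilon> f h + ip M f h) \<le> \<bar>c\<bar> * ((2 + \<epsilon>) * (s * H))"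
  proof -
    have "c * (mform M b \<epsilon> f h + ip M f h) \<le> \<bar>c\<bar> * \<bar>mform M b \<epsilon> f h + ip M f h\<bar>"
      by (metis abs_ge_self abs_mult)
    also have "\<dots> \<le> \<bar>c\<bar> * ((2 + \<epsilon>) * (s * H))"
      using mform_bound[OF fL hL] ip_Cauchy_Schwarz[OF fL hL] unfolding s_def H_def
      by (intro mult_left_mono) (auto simp: algebra_simps abs_le_iff)
    finally show ?thesis .
  qed
  have mg: "c\<^sup>2 \<le> mform M b \<epsilon> g g"
  proof -
    have "mform M b \<epsilon> g g = mform M b \<epsilon> (\<lambda>x. 1 * h x + c * 1) (\<lambda>x. 1 * h x + c * 1)"
      using g_eq by simp
    also have "\<dots> = 1 * mform M b \<epsilon> h (\<lambda>x. 1 * h x + c * 1) + c * mform M b \<epsilon> (\<lambda>_. 1) (\<lambda>x. 1 * h x + c * 1)"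
      by (intro mform_lin_left hL L2_one L2_fun_lin)
    also have "mform M b \<epsilon> h (\<lambda>x. 1 * h x + c * 1) = 1 * mform M b \<epsilon> h h + c * mform M b \<epsilon> h (\<lambda>_. 1)"
      by (intro mform_lin_right hL L2_one)
    also have "mform M b \<epsilon> h (\<lambda>_. 1) = 0" using mform_one[OF hL] h_mean by simp
    also have "mform M b \<epsilon> (\<lambda>_. 1) (\<lambda>x. 1 * h x + c * 1) = c"
      using mform_one[OF g] mform_commute[of "\<lambda>_. 1" g] unfolding g_eq[symmetric] c_def[symmetric] by simp
    finally show ?thesis
      using mform_self_nonneg[OF hL] by (simp add: power2_eq_square)
  qed
  define D where "D = \<Lambda> - lam * (1 + \<epsilon>) * F"
  have D: "D > 0" using lam by (simp add: D_def)
  define a where "a = lam * (1 + \<epsilon> / 2) * s"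
  have sq: "2 * a * \<bar>c\<bar> * H - D * H\<^sup>2 \<le> a\<^sup>2 / D * c\<^sup>2"
  proof -
    have "0 \<le> (a * \<bar>c\<bar> - D * H)\<^sup>2 / D" using D by simp
    also have "\<dots> = a\<^sup>2 / D * c\<^sup>2 - (2 * a * \<bar>c\<bar> * H - D * H\<^sup>2)"
      using D by (simp add: power2_eq_square field_simps)
    finally show ?thesis by simp
  qed
  have "lam * mform M b \<epsilon> (\<lambda>x. f x * g x) g
      \<le> lam * ((1 + \<epsilon>) * F * H\<^sup>2 + \<bar>c\<bar> * ((2 + \<epsilon>) * (s * H)))"
    unfolding eq using 1 2 lam by (intro mult_left_mono) auto
  then have "lam * mform M b \<epsilon> (\<lambda>x. f x * g x) g - \<Lambda> * variance g \<le> 2 * a * \<bar>c\<bar> * H - D * H\<^sup>2"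
    unfolding var a_def D_def by (simp add: algebra_simps)
  also note sq
  also have "a\<^sup>2 / D * c\<^sup>2 \<le> a\<^sup>2 / D * mform M b \<epsilon> g g"
    using mg D by (intro mult_left_mono) auto
  finally show ?thesis by (simp add: a_def D_def s_def)
qed

end

section \<open>The exponential of an absolutely continuous path\<close>

lemma abs_exp_minus_one_le: "\<bar>exp x - 1\<bar> \<le> \<bar>x\<bar> * exp \<bar>x\<bar>" for x :: real
proof (cases "0 \<le> x")
  case True
  have "exp x * (1 - exp (- x)) \<le> exp x * x"
    using exp_ge_add_one_self[of "- x"] by (intro mult_left_mono) auto
  then show ?thesis
    using True by (simp add: algebra_simps exp_minus_inverse)
next
  case False
  have "1 - exp x \<le> - x" using exp_ge_add_one_self[of x] by linarith
  also have "\<dots> \<le> (- x) * exp (- x)" using False by (simp add: mult_le_cancel_left1)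
  finally show ?thesis using False by simp
qed

lemma abs_exp_minus_linear_le: "\<bar>exp x - 1 - x\<bar> \<le> x\<^sup>2 * exp \<bar>x\<bar>" for x :: real
proof -
  have nn: "0 \<le> exp x - 1 - x" using exp_ge_add_one_self[of x] by linarith
  have "exp x - 1 - x \<le> x * (exp x - 1)"
  proof -
    have "exp x * (1 - x) \<le> exp x * exp (- x)"
      using exp_ge_add_one_self[of "- x"] by (intro mult_left_mono) auto
    then show ?thesis by (simp add: algebra_simps exp_minus_inverse)
  qed
  also have "\<dots> \<le> \<bar>x\<bar> * \<bar>exp x - 1\<bar>" by (metis abs_ge_self abs_mult)
  also have "\<dots> \<le> \<bar>x\<bar> * (\<bar>x\<bar> * exp \<bar>x\<bar>)"
    by (intro mult_left_mono abs_exp_minus_one_le) auto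
  finally show ?thesis using nn by (simp add: power2_eq_square mult.assoc[symmetric])
qed

lemma quadratic_increments_imp_constant:
  fixes D :: "real \<Rightarrow> real"
  assumes T: "0 \<le> T" and inc: "\<And>a b. 0 \<le> a \<Longrightarrow> a \<le> b \<Longrightarrow> b \<le> T \<Longrightarrow> \<bar>D b - D a\<bar> \<le> C * (b - a)\<^sup>2"
  shows "D T = D 0"
proof -
  have "\<bar>D T - D 0\<bar> \<le> C * T\<^sup>2 * inverse (real (Suc n))" for n
  proof -
    define h where "h = T / real (Suc n)"
    have h: "0 \<le> h" "h * real (Suc n) = T" using T by (simp_all add: h_def)
    have "\<bar>D (real k * h) - D 0\<bar> \<le> real k * (C * h\<^sup>2)" if "k \<le> Suc n" for k
      using that
    proof (induction k)
      case (Suc k)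
      have "real (Suc k) * h \<le> T"
        using Suc.prems mult_left_mono[OF _ h(1), of "real (Suc k)" "real (Suc n)"] h(2)
        by (simp add: mult.commute)
      then have "\<bar>D (real (Suc k) * h) - D (real k * h)\<bar> \<le> C * (real (Suc k) * h - real k * h)\<^sup>2"
        using h by (intro inc) (auto intro: mult_right_mono)
      also have "real (Suc k) * h - real k * h = h" by (simp add: algebra_simps)
      finally show ?case using Suc by (simp add: algebra_simps)
    qed simp
    from this[of "Suc n"] have "\<bar>D T - D 0\<bar> \<le> real (Suc n) * (C * h\<^sup>2)"
      using h by (simp add: mult.commute)
    also have "\<dots> = C * T\<^sup>2 * inverse (real (Suc n))"
      by (simp add: h_def power2_eq_square field_simps del: of_nat_Suc)
    finally show ?thesis .
  qed
  moreover have "(\<lambda>n. C * T\<^sup>2 * inverse (real (Suc n))) \<longlonglongrightarrow> C * T\<^sup>2 * 0"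
    by (intro tendsto_intros LIMSEQ_inverse_real_of_nat)
  ultimately have "\<bar>D T - D 0\<bar> \<le> C * T\<^sup>2 * 0"
    by (intro LIMSEQ_le_const) auto
  then show ?thesis by simp
qed

lemma set_integrable_bounded_Icc:
  fixes w :: "real \<Rightarrow> real"
  assumes [measurable]: "w \<in> borel_measurable borel" and "\<And>r. r \<in> {a..b} \<Longrightarrow> \<bar>w r\<bar> \<le> c"
  shows "set_integrable lborel {a..b} w"
proof -
  have "set_integrable lborel {a..b} (\<lambda>_. c)"
    unfolding set_integrable_def by (intro integrable_scaleR_left impI integrable_real_indicator) (simp_all add: emeasure_lborel_Icc_eq)
  then show ?thesis
  proof (rule set_integrable_bound)
    show "set_borel_measurable lborel {a..b} w"
      unfolding set_borel_measurable_def by measurable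
    show "AE x in lborel. x \<in> {a..b} \<longrightarrow> norm (w x) \<le> norm c"
      using assms(2) by (intro AE_I2) (force intro: order_trans[OF _ abs_ge_self])
  qed
qed

lemma set_integral_bounded_Icc:
  fixes w :: "real \<Rightarrow> real"
  assumes ab: "a \<le> b" and w: "\<And>r. r \<in> {a..b} \<Longrightarrow> \<bar>w r\<bar> \<le> c"
  shows "\<bar>LINT r:{a..b}|lborel. w r\<bar> \<le> c * (b - a)"
proof -
  have "0 \<le> c" using w[of a] ab by force
  have "norm (LINT r:{a..b}|lborel. w r) \<le> (LINT r|lborel. norm (indicator {a..b} r *\<^sub>R w r))"
    unfolding set_lebesgue_integral_def by (rule integral_norm_bound)
  also have "\<dots> \<le> (LINT r|lborel. indicator {a..b} r *\<^sub>R c)"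
  proof (rule integral_mono_AE')
    show "integrable lborel (\<lambda>r. indicator {a..b} r *\<^sub>R c)"
      by (intro integrable_scaleR_left impI integrable_real_indicator) (simp_all add: emeasure_lborel_Icc_eq)
  qed (use w \<open>0 \<le> c\<close> in \<open>auto simp: indicator_def\<close>)
  also have "\<dots> = c * (b - a)" using ab by simp
  finally show ?thesis by simp
qed

lemma set_integral_Icc_split:
  fixes w :: "real \<Rightarrow> real"
  assumes "a \<le> b" "b \<le> c" "set_integrable lborel {a..c} w"
  shows "(LINT r:{a..c}|lborel. w r) = (LINT r:{a..b}|lborel. w r) + (LINT r:{b..c}|lborel. w r)"
proof -
  have i: "set_integrable lborel {a..b} w" "set_integrable lborel {b..c} w"
    using assms by (auto intro: set_integrable_subset)
  have "w integrable_on {a..c}"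
    using set_borel_integral_eq_integral(1)[OF assms(3)] .
  from Henstock_Kurzweil_Integration.integral_combine[OF assms(1,2) this] show ?thesis
    by (simp add: set_borel_integral_eq_integral(2) i assms(3))
qed

lemma set_integral_Icc_shift:
  fixes w :: "real \<Rightarrow> real"
  shows "(LINT r:{s..s + t}|lborel. w r) = (LINT r:{0..t}|lborel. w (s + r))"
proof -
  have "(LINT r:{s..s + t}|lborel. w r) = (LINT r|lborel. indicator {s..s + t} (s + 1 * r) *\<^sub>R w (s + 1 * r))"
    unfolding set_lebesgue_integral_def
    by (subst lborel_integral_real_affine[where c=1 and t=s]) auto
  also have "\<dots> = (LINT r:{0..t}|lborel. w (s + r))"
    unfolding set_lebesgue_integral_def
    by (intro Bochner_Integration.integral_cong) (auto simp: indicator_def)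
  finally show ?thesis .
qed

text \<open>
  The path \<open>I\<close> is only absolutely continuous. The difference of the two sides has increments of
  second order, hence is constant; this replaces differentiation almost everywhere.
\<close>

lemma exp_set_integral:
  fixes w :: "real \<Rightarrow> real"
  assumes [measurable]: "w \<in> borel_measurable borel" and w: "\<And>r. \<bar>w r\<bar> \<le> c" and T: "0 \<le> T"
  defines "I \<equiv> \<lambda>t. LINT r:{0..t}|lborel. w r"
  shows "exp (I T) = 1 + (LINT r:{0..T}|lborel. w r * exp (I r))"
proof -
  have [measurable]: "I \<in> borel_measurable borel"
  proof -
    have "I = (\<lambda>t. LINT r|lborel. (if 0 \<le> r \<and> r \<le> t then w r else 0))"
      unfolding I_def set_lebesgue_integral_def
      by (intro ext Bochner_Integration.integral_cong) (auto simp: indicator_def)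
    also have "\<dots> \<in> borel_measurable borel" by measurable
    finally show ?thesis .
  qed
  have c: "0 \<le> c" using w[of 0] by linarith
  have I_inc: "I b - I a = (LINT r:{a..b}|lborel. w r)" "\<bar>I b - I a\<bar> \<le> c * (b - a)" if "0 \<le> a" "a \<le> b" for a b
  proof -
    show 1: "I b - I a = (LINT r:{a..b}|lborel. w r)"
      unfolding I_def using that w
      by (subst set_integral_Icc_split[of 0 a b]) (auto intro!: set_integrable_bounded_Icc[of _ _ _ c])
    show "\<bar>I b - I a\<bar> \<le> c * (b - a)"
      unfolding 1 using that w by (intro set_integral_bounded_Icc) auto
  qed
  have I0: "I 0 = 0" 
    using set_integral_bounded_Icc[of 0 0 w c] w by (simp add: I_def)
  have I_bd: "\<bar>I t\<bar> \<le> c * T" if "0 \<le> t" "t \<le> T" for t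
    using I_inc(2)[of 0 t] that I0 c by (smt (verit) mult_left_mono)
  define e where "e = exp (c * T)"
  have wI: "\<bar>w r * exp (I r)\<bar> \<le> c * e" if "r \<in> {0..T}" for r
  proof -
    have "exp (I r) \<le> e" using I_bd[of r] that by (auto simp: e_def)
    then show ?thesis using w[of r] c by (auto simp: abs_mult intro!: mult_mono)
  qed
  define J where "J t = (LINT r:{0..t}|lborel. w r * exp (I r))" for t
  have "exp (I T) - J T = exp (I 0) - J 0"
  proof (rule quadratic_increments_imp_constant[where C="2 * e * e * c\<^sup>2", OF T])
    fix a b assume ab: "0 \<le> a" "a \<le> b" "b \<le> T"
    have sub: "{a..b} \<subseteq> {0..T}" using ab by auto
    have J_inc: "J b - J a = (LINT r:{a..b}|lborel. w r * exp (I r))"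
      unfolding J_def using ab wI
      by (subst set_integral_Icc_split[of 0 a b]) (auto intro!: set_integrable_bounded_Icc[of _ _ _ "c * e"])
    define d where "d = I b - I a"
    have e: "exp (I a) \<le> e" using I_bd[of a] ab by (auto simp: e_def)
    have d: "\<bar>d\<bar> \<le> c * (b - a)" "exp \<bar>d\<bar> \<le> e"
    proof -
      show 1: "\<bar>d\<bar> \<le> c * (b - a)" using I_inc(2) ab by (simp add: d_def)
      also have "\<dots> \<le> c * T" using ab c by (intro mult_left_mono) auto
      finally show "exp \<bar>d\<bar> \<le> e" by (simp add: e_def)
    qed
    have 1: "\<bar>exp d - 1 - d\<bar> \<le> c\<^sup>2 * (b - a)\<^sup>2 * e"
    proof -
      have "d\<^sup>2 \<le> (c * (b - a))\<^sup>2" using d(1) by (metis abs_ge_zero power2_abs power_mono)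
      then have "d\<^sup>2 * exp \<bar>d\<bar> \<le> (c * (b - a))\<^sup>2 * e" using d by (intro mult_mono) auto
      with abs_exp_minus_linear_le[of d] show ?thesis by (simp add: power_mult_distrib)
    qed
    have 2: "\<bar>LINT r:{a..b}|lborel. w r * (exp (I r - I a) - 1)\<bar> \<le> c * (c * (b - a) * e) * (b - a)"
    proof (rule set_integral_bounded_Icc[OF ab(2)])
      fix r assume r: "r \<in> {a..b}"
      have 1: "\<bar>I r - I a\<bar> \<le> c * (b - a)"
        using I_inc(2)[of a r] ab r c by (auto elim!: order_trans intro!: mult_left_mono)
      also have "\<dots> \<le> c * T" using ab c by (intro mult_left_mono) auto
      finally have "exp \<bar>I r - I a\<bar> \<le> e" by (simp add: e_def)
      then have "\<bar>I r - I a\<bar> * exp \<bar>I r - I a\<bar> \<le> c * (b - a) * e"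
        using 1 by (intro mult_mono) auto
      then have "\<bar>exp (I r - I a) - 1\<bar> \<le> c * (b - a) * e"
        using abs_exp_minus_one_le[of "I r - I a"] by linarith
      then show "\<bar>w r * (exp (I r - I a) - 1)\<bar> \<le> c * (c * (b - a) * e)"
        unfolding abs_mult using w[of r] c by (intro mult_mono) auto
    qed
    have int1: "set_integrable lborel {a..b} w"
      using w by (intro set_integrable_bounded_Icc[of _ _ _ c]) auto
    have int2: "set_integrable lborel {a..b} (\<lambda>r. w r * exp (I r))"
      using wI sub by (intro set_integrable_bounded_Icc[of _ _ _ "c * e"]) auto
    have "exp (I a) * (LINT r:{a..b}|lborel. w r * (exp (I r - I a) - 1))
        = (LINT r:{a..b}|lborel. w r * exp (I r) - exp (I a) * w r)"
      unfolding set_integral_mult_right[symmetric]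
      by (intro set_lebesgue_integral_cong) (auto simp: algebra_simps exp_diff)
    also have "\<dots> = (J b - J a) - exp (I a) * d"
      unfolding J_inc d_def I_inc(1)[OF ab(1,2)] using int1 int2 by (subst set_integral_diff) auto
    finally have 3: "(exp (I b) - J b) - (exp (I a) - J a)
        = exp (I a) * ((exp d - 1 - d) - (LINT r:{a..b}|lborel. w r * (exp (I r - I a) - 1)))"
      by (simp add: d_def exp_diff algebra_simps)
    have "\<bar>(exp (I b) - J b) - (exp (I a) - J a)\<bar>
        \<le> e * (c\<^sup>2 * (b - a)\<^sup>2 * e + c * (c * (b - a) * e) * (b - a))"
      unfolding 3 abs_mult
    proof (rule mult_mono)
      show "\<bar>exp d - 1 - d - (LINT r:{a..b}|lborel. w r * (exp (I r - I a) - 1))\<bar>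
          \<le> c\<^sup>2 * (b - a)\<^sup>2 * e + c * (c * (b - a) * e) * (b - a)"
        using 1 2 by linarith
      show "0 \<le> e" by (simp add: e_def)
    qed (use e in auto)
    also have "\<dots> = 2 * e * e * c\<^sup>2 * (b - a)\<^sup>2" by (simp add: power2_eq_square algebra_simps)
    finally show "\<bar>(exp (I b) - J b) - (exp (I a) - J a)\<bar> \<le> 2 * e * e * c\<^sup>2 * (b - a)\<^sup>2" .
  qed
  moreover have "J 0 = 0"
    using set_integral_bounded_Icc[of 0 0 "\<lambda>r. w r * exp (I r)" "c * e"] wI T by (simp add: J_def)
  ultimately show ?thesis using I0 by (simp add: J_def)
qed

section \<open>Joint measurability of a cadlag Markov process\<close>

locale cadlag_markov =
  fixes S :: "'x::{second_countable_topology, metric_space} set" and \<Omega> :: "'w measure"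
    and X :: "real \<Rightarrow> 'w \<Rightarrow> 'x" and Pr :: "'x \<Rightarrow> 'w measure"
  assumes process: "cadlag_markov_process S \<Omega> X Pr"
begin

abbreviation N :: "'x measure" where "N \<equiv> restrict_space borel S"

lemma X_measurable: "t \<ge> 0 \<Longrightarrow> X t \<in> measurable \<Omega> N"
  using process by (simp add: cadlag_markov_process_def)

lemma X_in: "\<omega> \<in> space \<Omega> \<Longrightarrow> t \<ge> 0 \<Longrightarrow> X t \<omega> \<in> S"
  using process by (simp add: cadlag_markov_process_def cadlag_on_def)

lemma X_right: "\<omega> \<in> space \<Omega> \<Longrightarrow> t \<ge> 0 \<Longrightarrow> ((\<lambda>t. X t \<omega>) \<longlongrightarrow> X t \<omega>) (at_right t)"
  using process by (simp add: cadlag_markov_process_def cadlag_on_def)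

lemma Pr_measurable [measurable]: "Pr \<in> measurable N (prob_algebra \<Omega>)"
  using process by (simp add: cadlag_markov_process_def)

lemma Pr_prob: "x \<in> S \<Longrightarrow> prob_space (Pr x)"
  and Pr_sets: "x \<in> S \<Longrightarrow> sets (Pr x) = sets \<Omega>"
  using measurable_space[OF Pr_measurable, of x]
  by (auto simp: space_prob_algebra space_restrict_space)

lemma Pr_space: "x \<in> S \<Longrightarrow> space (Pr x) = space \<Omega>"
  using Pr_sets sets_eq_imp_space_eq by blast

lemma X_start: "x \<in> S \<Longrightarrow> AE \<omega> in Pr x. X 0 \<omega> = x"
  using process by (simp add: cadlag_markov_process_def)

text \<open>
  Progressive measurability: the process sampled at the next point of a grid takes countably many
  times, and right continuity recovers the process as the grid is refined. Capping the grid points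
  at \<open>s\<close> keeps the approximations measurable with respect to the information up to time \<open>s\<close>.
\<close>

lemma progressively_measurable:
  assumes s: "0 \<le> s" and F: "space F = space \<Omega>" "\<And>u. u \<in> {0..s} \<Longrightarrow> X u \<in> measurable F N"
  shows "(\<lambda>(t, \<omega>). X (min s (max 0 t)) \<omega>) \<in> measurable (borel \<Otimes>\<^sub>M F) N"
proof -
  define c where "c t = min s (max 0 t)" for t
  define k where "k n t = \<lfloor>real (Suc n) * c t\<rfloor>" for n t
  define a where "a n j = min s (max 0 ((of_int j + 1) / real (Suc n)))" for n and j :: int
  have c: "0 \<le> c t" "c t \<le> s" for t using s by (auto simp: c_def)
  have [measurable]: "c \<in> borel_measurable borel" unfolding c_def by measurable
  \<comment> \<open>\<open>a n (k n t)\<close> is the first grid point strictly to the right of \<open>c t\<close>, or \<open>s\<close> if \<open>s\<close> comes earlier.\<close>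
  have step: "(\<lambda>p. X (a n (k n (fst p))) (snd p)) \<in> measurable (borel \<Otimes>\<^sub>M F) N" for n
  proof (rule measurable_compose_countable[where f="\<lambda>j p. X (a n j) (snd p)"])
    show "(\<lambda>p. X (a n j) (snd p)) \<in> measurable (borel \<Otimes>\<^sub>M F) N" for j
      using s by (intro measurable_compose[OF measurable_snd] F(2)) (auto simp: a_def)
    show "(\<lambda>p. k n (fst p)) \<in> measurable (borel \<Otimes>\<^sub>M F) (count_space UNIV)"
      unfolding k_def by measurable
  qed
  have conv: "(\<lambda>n. X (a n (k n t)) \<omega>) \<longlonglongrightarrow> X (c t) \<omega>" if w: "\<omega> \<in> space \<Omega>" for t \<omega>
  proof (cases "c t = s")
    case True
    have "a n (k n t) = s" for n
    proof -
      have "c t \<le> (of_int (k n t) + 1) / real (Suc n)"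
        using floor_correct[of "real (Suc n) * c t"] by (simp add: k_def field_simps)
      with True show ?thesis using s by (simp add: a_def)
    qed
    with True show ?thesis by simp
  next
    case False
    then have cs: "c t < s" using c[of t] by linarith
    have gt: "c t < a n (k n t)" and le: "a n (k n t) \<le> c t + inverse (real (Suc n))" for n
    proof -
      have 1: "c t < (of_int (k n t) + 1) / real (Suc n)"
        using floor_correct[of "real (Suc n) * c t"] by (simp add: k_def field_simps)
      then show "c t < a n (k n t)" using cs by (simp add: a_def)
      have "(of_int (k n t) + 1) / real (Suc n) \<le> (real (Suc n) * c t + 1) / real (Suc n)"
        by (intro divide_right_mono) (auto simp: k_def)
      also have "\<dots> = c t + inverse (real (Suc n))" by (simp add: field_simps)
      finally show "a n (k n t) \<le> c t + inverse (real (Suc n))"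
        using 1 c(1)[of t] by (simp add: a_def)
    qed
    have "(\<lambda>n. a n (k n t)) \<longlonglongrightarrow> c t"
    proof (rule tendsto_sandwich)
      show "(\<lambda>n. c t) \<longlonglongrightarrow> c t" by simp
      show "(\<lambda>n. c t + inverse (real (Suc n))) \<longlonglongrightarrow> c t"
        using tendsto_add[OF tendsto_const LIMSEQ_inverse_real_of_nat, of "c t"] by simp
    qed (use gt le in \<open>auto intro!: always_eventually less_imp_le simp del: of_nat_Suc\<close>)
    then have "filterlim (\<lambda>n. a n (k n t)) (at_right (c t)) sequentially"
      using gt by (simp add: filterlim_at less_imp_neq[symmetric])
    from filterlim_compose[OF X_right[OF w c(1)] this] show ?thesis .
  qed
  have "(\<lambda>p. X (c (fst p)) (snd p)) \<in> borel_measurable (borel \<Otimes>\<^sub>M F)"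
  proof (rule borel_measurable_LIMSEQ_metric)
    show "(\<lambda>p. X (a n (k n (fst p))) (snd p)) \<in> borel_measurable (borel \<Otimes>\<^sub>M F)" for n
      using step[of n] by (simp add: measurable_restrict_space2_iff)
    show "(\<lambda>n. X (a n (k n (fst p))) (snd p)) \<longlonglongrightarrow> X (c (fst p)) (snd p)"
      if "p \<in> space (borel \<Otimes>\<^sub>M F)" for p
    proof (rule conv)
      show "snd p \<in> space \<Omega>" using that F(1) by (simp add: space_pair_measure mem_Times_iff)
    qed
  qed
  then have "(\<lambda>p. X (c (fst p)) (snd p)) \<in> measurable (borel \<Otimes>\<^sub>M F) N"
  proof (rule measurable_restrict_space2[rotated])
    show "(\<lambda>p. X (c (fst p)) (snd p)) \<in> space (borel \<Otimes>\<^sub>M F) \<rightarrow> S"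
    proof
      fix p :: "real \<times> 'w" assume "p \<in> space (borel \<Otimes>\<^sub>M F)"
      then have "snd p \<in> space \<Omega>" using F(1) by (simp add: space_pair_measure mem_Times_iff)
      then show "X (c (fst p)) (snd p) \<in> S" using c(1) by (rule X_in)
    qed
  qed
  then show ?thesis unfolding c_def by (simp add: case_prod_beta')
qed

text \<open>
  Times are truncated at \<open>0\<close> because nothing is known about \<open>X\<close> at negative times.
\<close>

lemma X_joint_measurable [measurable]:
  "(\<lambda>p. X (max 0 (fst p)) (snd p)) \<in> measurable (borel \<Otimes>\<^sub>M \<Omega>) N"
proof -
  have step: "(\<lambda>p. X (min (real n) (max 0 (fst p))) (snd p)) \<in> measurable (borel \<Otimes>\<^sub>M \<Omega>) N" for n
    using progressively_measurable[of "real n" \<Omega>] X_measurable by (simp add: case_prod_beta')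
  have "(\<lambda>p. X (max 0 (fst p)) (snd p)) \<in> borel_measurable (borel \<Otimes>\<^sub>M \<Omega>)"
  proof (rule borel_measurable_LIMSEQ_metric)
    show "(\<lambda>p. X (min (real n) (max 0 (fst p))) (snd p)) \<in> borel_measurable (borel \<Otimes>\<^sub>M \<Omega>)" for n
      using step[of n] by (simp add: measurable_restrict_space2_iff)
    fix p :: "real \<times> 'w"
    obtain m :: nat where m: "max 0 (fst p) \<le> real m" using real_arch_simple by blast
    have "eventually (\<lambda>n. X (min (real n) (max 0 (fst p))) (snd p) = X (max 0 (fst p)) (snd p)) sequentially"
      using eventually_ge_at_top[of m]
    proof eventually_elim
      case (elim n)
      then have "max 0 (fst p) \<le> real n" using m by linarith
      then show ?case by (simp add: min_absorb2)
    qed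
    then show "(\<lambda>n. X (min (real n) (max 0 (fst p))) (snd p)) \<longlonglongrightarrow> X (max 0 (fst p)) (snd p)"
      by (rule tendsto_eventually)
  qed
  then show ?thesis
    by (auto simp: measurable_restrict_space2_iff space_pair_measure intro!: X_in)
qed

lemma X_path_measurable:
  assumes "\<omega> \<in> space \<Omega>"
  shows "(\<lambda>t. X (max 0 t) \<omega>) \<in> measurable borel N"
  using measurable_compose[OF measurable_Pair2'[OF assms] X_joint_measurable] by simp

text \<open>
  The parameter is carried along by pushing the kernel forward to the product space, where the integrand
  no longer depends on the base point.
\<close>

lemma kernel_integral_measurable:
  fixes H :: "'k \<times> 'w \<Rightarrow> real"
  assumes [measurable]: "H \<in> borel_measurable (K \<Otimes>\<^sub>M \<Omega>)"
  shows "(\<lambda>p. LINT \<omega>|Pr (snd p). H (fst p, \<omega>)) \<in> borel_measurable (K \<Otimes>\<^sub>M N)"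
proof -
  have L: "(\<lambda>p. Pr (snd p)) \<in> measurable (K \<Otimes>\<^sub>M N) (subprob_algebra \<Omega>)"
    by (intro measurable_prob_algebraD measurable_compose[OF measurable_snd Pr_measurable])
  have "(\<lambda>p. integral\<^sup>L (distr (Pr (snd p)) (K \<Otimes>\<^sub>M \<Omega>) (\<lambda>\<omega>. (fst p, \<omega>))) H) \<in> borel_measurable (K \<Otimes>\<^sub>M N)"
    by (intro measurable_compose[OF _ integral_measurable_subprob_algebra[OF assms]]
        measurable_distr2[OF _ L]) measurable
  then show ?thesis
  proof (rule measurable_cong[THEN iffD1, rotated])
    fix p assume p: "p \<in> space (K \<Otimes>\<^sub>M N)"
    then have "sets (Pr (snd p)) = sets \<Omega>" by (intro Pr_sets) (auto simp: space_pair_measure space_restrict_space)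
    then have "(\<lambda>\<omega>. (fst p, \<omega>)) \<in> measurable (Pr (snd p)) (K \<Otimes>\<^sub>M \<Omega>)"
      using p measurable_Pair1'[of "fst p" K \<Omega>] by (auto simp: space_pair_measure cong: measurable_cong_sets)
    then show "integral\<^sup>L (distr (Pr (snd p)) (K \<Otimes>\<^sub>M \<Omega>) (\<lambda>\<omega>. (fst p, \<omega>))) H = (LINT \<omega>|Pr (snd p). H (fst p, \<omega>))"
      by (intro integral_distr assms)
  qed
qed

end

section \<open>The Feynman--Kac semigroup\<close>

lemma Fubini_Icc:
  fixes h :: "real \<Rightarrow> 'y \<Rightarrow> real"
  assumes M: "finite_measure M"
    and h [measurable]: "(\<lambda>p. h (fst p) (snd p)) \<in> borel_measurable (borel \<Otimes>\<^sub>M M)"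
    and c: "\<And>r x. r \<in> {0..t} \<Longrightarrow> x \<in> space M \<Longrightarrow> \<bar>h r x\<bar> \<le> c"
  shows "(LINT x|M. (LINT r:{0..t}|lborel. h r x)) = (LINT r:{0..t}|lborel. (LINT x|M. h r x))"
    and "integrable M (\<lambda>x. LINT r:{0..t}|lborel. h r x)"
proof -
  interpret M: finite_measure M by fact
  interpret P: pair_sigma_finite lborel M ..
  have h' [measurable]: "(\<lambda>p. h (fst p) (snd p)) \<in> borel_measurable (lborel \<Otimes>\<^sub>M M)"
    using h by (simp cong: measurable_cong_sets sets_pair_measure_cong)
  have int: "integrable (lborel \<Otimes>\<^sub>M M) (\<lambda>(r, x). indicator {0..t} r *\<^sub>R h r x)"
  proof (rule Bochner_Integration.integrable_bound)
    have "emeasure (lborel \<Otimes>\<^sub>M M) ({0..t} \<times> space M) < \<infinity>"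
      by (subst M.emeasure_pair_measure_Times)
        (auto simp: emeasure_lborel_Icc_eq M.emeasure_eq_measure ennreal_mult_less_top)
    then show "integrable (lborel \<Otimes>\<^sub>M M) (\<lambda>p. indicator ({0..t} \<times> space M) p *\<^sub>R \<bar>c\<bar>)"
      by (intro integrable_scaleR_left impI integrable_real_indicator) auto
    show "(\<lambda>(r, x). indicator {0..t} r *\<^sub>R h r x) \<in> borel_measurable (lborel \<Otimes>\<^sub>M M)"
      unfolding case_prod_beta' by measurable
    show "AE p in lborel \<Otimes>\<^sub>M M. norm (case p of (r, x) \<Rightarrow> indicator {0..t} r *\<^sub>R h r x)
        \<le> norm (indicator ({0..t} \<times> space M) p *\<^sub>R \<bar>c\<bar>)"
      using c by (intro AE_I2) (auto simp: indicator_def space_pair_measure intro: order_trans[OF _ abs_ge_self])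
  qed
  show "(LINT x|M. (LINT r:{0..t}|lborel. h r x)) = (LINT r:{0..t}|lborel. (LINT x|M. h r x))"
    using P.Fubini_integral[OF int] by (simp add: set_lebesgue_integral_def)
  show "integrable M (\<lambda>x. LINT r:{0..t}|lborel. h r x)"
    using P.integrable_snd[OF int] by (simp add: set_lebesgue_integral_def)
qed

context cadlag_markov
begin

definition acc :: "('x \<Rightarrow> real) \<Rightarrow> real \<Rightarrow> 'w \<Rightarrow> real" where
  "acc W t \<omega> = (LINT r:{0..t}|lborel. W (X r \<omega>))"

text \<open>
  The Feynman--Kac operator with potential \<open>W\<close>; for \<open>W = 0\<close> it is the transition semigroup, so that all its
  properties cover the latter as well.
\<close>

definition FK :: "('x \<Rightarrow> real) \<Rightarrow> real \<Rightarrow> ('x \<Rightarrow> real) \<Rightarrow> 'x \<Rightarrow> real" where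
  "FK W t g x = (LINT \<omega>|Pr x. exp (acc W t \<omega>) * g (X t \<omega>))"

text \<open>
  The bound is carried along explicitly: it makes every integral below absolutely convergent and drives the
  series argument for the semigroup law.
\<close>

definition bfun :: "real \<Rightarrow> ('x \<Rightarrow> real) \<Rightarrow> bool" where
  "bfun c g \<longleftrightarrow> g \<in> borel_measurable N \<and> 0 \<le> c \<and> (\<forall>x\<in>S. \<bar>g x\<bar> \<le> c)"

abbreviation U :: "real \<Rightarrow> ('x \<Rightarrow> real) \<Rightarrow> 'x \<Rightarrow> real" where "U \<equiv> transition X Pr"

lemma bfun_measurable: "bfun c g \<Longrightarrow> g \<in> borel_measurable N"
  and bfun_nonneg: "bfun c g \<Longrightarrow> 0 \<le> c"
  and bfun_bound: "bfun c g \<Longrightarrow> x \<in> S \<Longrightarrow> \<bar>g x\<bar> \<le> c"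
  by (auto simp: bfun_def)

lemma bfun_const: "bfun \<bar>c\<bar> (\<lambda>_. c)"
  by (auto simp: bfun_def)

lemma bfun_mult: "bfun a W \<Longrightarrow> bfun c g \<Longrightarrow> bfun (a * c) (\<lambda>x. W x * g x)"
  by (auto simp: bfun_def abs_mult intro!: mult_mono)

lemma bfun_lin: "bfun c g \<Longrightarrow> bfun d h \<Longrightarrow> bfun (\<bar>a\<bar> * c + \<bar>b\<bar> * d) (\<lambda>x. a * g x + b * h x)"
  by (auto simp: bfun_def abs_mult intro!: order_trans[OF abs_triangle_ineq] add_mono mult_left_mono)

lemma X_comp_measurable:
  assumes "f \<in> borel_measurable K" "h \<in> measurable K \<Omega>"
  shows "(\<lambda>k. X (max 0 (f k)) (h k)) \<in> measurable K N"
  using measurable_compose[OF measurable_Pair[OF assms] X_joint_measurable] by simp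

lemma acc_eq: "acc W t \<omega> = (LINT r|lborel. (if 0 \<le> r \<and> r \<le> t then W (X (max 0 r) \<omega>) else 0))"
  unfolding acc_def set_lebesgue_integral_def
  by (intro Bochner_Integration.integral_cong) (auto simp: indicator_def max_def)

lemma acc_comp_measurable:
  assumes [measurable]: "W \<in> borel_measurable N" "f \<in> borel_measurable K" "h \<in> measurable K \<Omega>"
  shows "(\<lambda>k. acc W (f k) (h k)) \<in> borel_measurable K"
proof -
  have [measurable]: "(\<lambda>p. X (max 0 (snd p)) (h (fst p))) \<in> measurable (K \<Otimes>\<^sub>M lborel) N"
    by (intro X_comp_measurable) measurable
  have [measurable]: "(\<lambda>p. W (X (max 0 (snd p)) (h (fst p)))) \<in> borel_measurable (K \<Otimes>\<^sub>M lborel)"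
    by (rule measurable_compose[OF _ assms(1)]) measurable
  show ?thesis
    unfolding acc_eq by (rule lborel.borel_measurable_lebesgue_integral) (simp add: case_prod_beta')
qed

lemma natural_filtration_space [simp]: "space (natural_filtration S \<Omega> X s) = space \<Omega>"
  unfolding natural_filtration_def by (rule space_measure_of) auto

lemma natural_filtration_sets:
  "sets (natural_filtration S \<Omega> X s) = sigma_sets (space \<Omega>)
     {X u -` E \<inter> space \<Omega> | u E. u \<in> {0..s} \<and> E \<in> sets N}"
  unfolding natural_filtration_def by (rule sets_measure_of) auto

lemma X_adapted:
  assumes "u \<in> {0..s}"
  shows "X u \<in> measurable (natural_filtration S \<Omega> X s) N"
proof (rule measurableI)
  fix A assume "A \<in> sets N"
  then show "X u -` A \<inter> space (natural_filtration S \<Omega> X s) \<in> sets (natural_filtration S \<Omega> X s)"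
    using assms unfolding natural_filtration_sets natural_filtration_space
    by (intro sigma_sets.Basic) auto
qed (use assms in \<open>auto simp: space_restrict_space intro: X_in\<close>)

lemma natural_filtration_subalgebra:
  assumes "x \<in> S"
  shows "subalgebra (Pr x) (natural_filtration S \<Omega> X s)"
  unfolding subalgebra_def natural_filtration_sets natural_filtration_space Pr_sets[OF assms] Pr_space[OF assms]
  by (intro conjI refl sets.sigma_sets_subset) (auto intro!: measurable_sets[OF X_measurable])

lemma acc_adapted:
  assumes W [measurable]: "W \<in> borel_measurable N" and s: "0 \<le> s"
  shows "acc W s \<in> borel_measurable (natural_filtration S \<Omega> X s)"
proof -
  let ?F = "natural_filtration S \<Omega> X s"
  have "(\<lambda>p. X (min s (max 0 (snd p))) (fst p)) \<in> measurable (?F \<Otimes>\<^sub>M lborel) N"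
    using measurable_compose[OF measurable_pair_swap' progressively_measurable[OF s, of ?F]] X_adapted
    by (simp add: case_prod_beta' cong: measurable_cong_sets sets_pair_measure_cong)
  from measurable_compose[OF this W]
  have [measurable]: "(\<lambda>p. W (X (min s (max 0 (snd p))) (fst p))) \<in> borel_measurable (?F \<Otimes>\<^sub>M lborel)" .
  have "acc W s = (\<lambda>\<omega>. LINT r|lborel. (if 0 \<le> r \<and> r \<le> s then W (X (min s (max 0 r)) \<omega>) else 0))"
    unfolding acc_eq by (intro ext Bochner_Integration.integral_cong) (auto simp: max_def min_def)
  also have "\<dots> \<in> borel_measurable ?F"
    by (rule lborel.borel_measurable_lebesgue_integral) (simp add: case_prod_beta')
  finally show ?thesis .
qed

lemma acc_bound:
  assumes W: "bfun a W" and t: "0 \<le> t" and w: "\<omega> \<in> space \<Omega>"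
  shows "\<bar>acc W t \<omega>\<bar> \<le> a * t"
  using set_integral_bounded_Icc[of 0 t "\<lambda>r. W (X r \<omega>)" a] t X_in[OF w] bfun_bound[OF W]
  by (auto simp: acc_def)

lemma exp_acc_bound:
  assumes "bfun a W" "0 \<le> t" "\<omega> \<in> space \<Omega>"
  shows "exp (acc W t \<omega>) \<le> exp (a * t)"
  using acc_bound[OF assms] by auto

text \<open>
  The weight of the path up to an intermediate time \<open>s + r\<close> stands in front of the potential, so that every
  factor of the integrand is known at time \<open>s + r\<close>.
\<close>

lemma exp_acc_increment:
  assumes W: "bfun a W" and s: "0 \<le> s" and t: "0 \<le> t" and w: "\<omega> \<in> space \<Omega>"
  shows "exp (acc W (s + t) \<omega>) = exp (acc W s \<omega>)
    + (LINT r:{0..t}|lborel. exp (acc W (s + r) \<omega>) * W (X (s + r) \<omega>))"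
proof -
  define v where "v r = W (X (max 0 r) \<omega>)" for r
  have [measurable]: "v \<in> borel_measurable borel"
    unfolding v_def by (rule measurable_compose[OF X_path_measurable[OF w] bfun_measurable[OF W]])
  have v: "\<bar>v r\<bar> \<le> a" for r unfolding v_def by (intro bfun_bound[OF W] X_in[OF w]) auto
  have acc_v: "acc W t \<omega> = (LINT r:{0..t}|lborel. v r)" for t
    unfolding acc_def v_def by (intro set_lebesgue_integral_cong) auto
  have split: "acc W (s + t) \<omega> = acc W s \<omega> + (LINT r:{0..t}|lborel. v (s + r))" if "0 \<le> t" for t
    unfolding acc_v set_integral_Icc_shift[symmetric] using s that v
    by (intro set_integral_Icc_split set_integrable_bounded_Icc[of _ _ _ a]) auto
  have "exp (acc W (s + t) \<omega>) = exp (acc W s \<omega>) * exp (LINT r:{0..t}|lborel. v (s + r))"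
    by (simp add: split[OF t] exp_add)
  also have "exp (LINT r:{0..t}|lborel. v (s + r))
      = 1 + (LINT r:{0..t}|lborel. v (s + r) * exp (LINT q:{0..r}|lborel. v (s + q)))"
    using v t by (intro exp_set_integral[of _ a]) auto
  also have "exp (acc W s \<omega>) * \<dots> = exp (acc W s \<omega>)
      + (LINT r:{0..t}|lborel. exp (acc W s \<omega>) * (v (s + r) * exp (LINT q:{0..r}|lborel. v (s + q))))"
    by (simp add: distrib_left)
  also have "(LINT r:{0..t}|lborel. exp (acc W s \<omega>) * (v (s + r) * exp (LINT q:{0..r}|lborel. v (s + q))))
      = (LINT r:{0..t}|lborel. exp (acc W (s + r) \<omega>) * W (X (s + r) \<omega>))"
    using s by (intro set_lebesgue_integral_cong) (auto simp: split exp_add v_def)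
  finally show ?thesis .
qed

lemma integrable_Pr:
  fixes h :: "'w \<Rightarrow> real"
  assumes x: "x \<in> S" and [measurable]: "h \<in> borel_measurable \<Omega>" and "\<And>\<omega>. \<omega> \<in> space \<Omega> \<Longrightarrow> \<bar>h \<omega>\<bar> \<le> c"
  shows "integrable (Pr x) h"
proof -
  interpret prob_space "Pr x" using x by (rule Pr_prob)
  show ?thesis
    using assms by (intro integrable_const_bound[of _ c]) (auto simp: Pr_space Pr_sets cong: measurable_cong_sets intro!: AE_I2)
qed

lemma integral_Pr_bound:
  fixes h :: "'w \<Rightarrow> real"
  assumes x: "x \<in> S" and h: "h \<in> borel_measurable \<Omega>" "\<And>\<omega>. \<omega> \<in> space \<Omega> \<Longrightarrow> \<bar>h \<omega>\<bar> \<le> c"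
  shows "\<bar>LINT \<omega>|Pr x. h \<omega>\<bar> \<le> c"
proof -
  interpret prob_space "Pr x" using x by (rule Pr_prob)
  have "\<bar>LINT \<omega>|Pr x. h \<omega>\<bar> \<le> (LINT \<omega>|Pr x. \<bar>h \<omega>\<bar>)" by (rule integral_abs_bound)
  also have "\<dots> \<le> (LINT \<omega>|Pr x. c)"
    using integrable_Pr[OF x h] h(2) by (intro integral_mono) (auto simp: Pr_space[OF x])
  finally show ?thesis by (simp add: prob_space)
qed

lemma markov:
  assumes x: "x \<in> S" and s: "0 \<le> s" and t: "0 \<le> t" and g: "bfun c g"
    and Y: "Y \<in> borel_measurable (natural_filtration S \<Omega> X s)" "\<And>\<omega>. \<omega> \<in> space \<Omega> \<Longrightarrow> \<bar>Y \<omega>\<bar> \<le> k"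
  shows "(LINT \<omega>|Pr x. Y \<omega> * g (X (s + t) \<omega>)) = (LINT \<omega>|Pr x. Y \<omega> * U t g (X s \<omega>))"
proof -
  interpret prob_space "Pr x" using x by (rule Pr_prob)
  let ?F = "natural_filtration S \<Omega> X s"
  note sub = natural_filtration_subalgebra[OF x, of s]
  interpret finite_measure_subalgebra "Pr x" ?F by unfold_locales (rule sub)
  have Ym: "Y \<in> borel_measurable (Pr x)" by (rule measurable_from_subalg[OF sub Y(1)])
  have gX: "(\<lambda>\<omega>. g (X (s + t) \<omega>)) \<in> borel_measurable \<Omega>"
    using s t by (intro measurable_compose[OF X_measurable bfun_measurable[OF g]]) simp
  have gXm: "(\<lambda>\<omega>. g (X (s + t) \<omega>)) \<in> borel_measurable (Pr x)"
    using gX by (simp add: Pr_sets[OF x] cong: measurable_cong_sets)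
  have int: "integrable (Pr x) (\<lambda>\<omega>. Y \<omega> * g (X (s + t) \<omega>))"
  proof (rule integrable_const_bound[of _ "k * c"])
    show "AE \<omega> in Pr x. norm (Y \<omega> * g (X (s + t) \<omega>)) \<le> k * c"
    proof (rule AE_I2)
      fix \<omega> assume "\<omega> \<in> space (Pr x)"
      then have w: "\<omega> \<in> space \<Omega>" by (simp add: Pr_space[OF x])
      have "\<bar>g (X (s + t) \<omega>)\<bar> \<le> c" using s t by (intro bfun_bound[OF g] X_in[OF w]) auto
      then show "norm (Y \<omega> * g (X (s + t) \<omega>)) \<le> k * c"
        using Y(2)[OF w] by (auto simp: abs_mult intro!: mult_mono)
    qed
  qed (use Ym gXm in measurable)
  have "bounded (g ` S)"
    using bfun_bound[OF g] by (auto simp: bounded_iff intro!: exI[of _ c])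
  then have ae: "AE \<omega> in Pr x. real_cond_exp (Pr x) ?F (\<lambda>\<omega>. g (X (s + t) \<omega>)) \<omega> = U t g (X s \<omega>)"
    using process x s t bfun_measurable[OF g] unfolding cadlag_markov_process_def by blast
  have "(LINT \<omega>|Pr x. Y \<omega> * g (X (s + t) \<omega>))
      = (LINT \<omega>|Pr x. Y \<omega> * real_cond_exp (Pr x) ?F (\<lambda>\<omega>. g (X (s + t) \<omega>)) \<omega>)"
    using real_cond_exp_intg(2)[OF int Y(1) gXm] by simp
  also have "\<dots> = (LINT \<omega>|Pr x. Y \<omega> * U t g (X s \<omega>))"
  proof -
    have "(\<lambda>p. LINT \<omega>|Pr (snd p). g (X t \<omega>)) \<in> borel_measurable ((borel :: real measure) \<Otimes>\<^sub>M N)"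
      using kernel_integral_measurable[OF measurable_compose[OF measurable_snd
          measurable_compose[OF X_measurable[OF t] bfun_measurable[OF g]]], of "borel :: real measure"]
      by simp
    from measurable_compose[OF measurable_Pair1' this, of "0::real"]
    have "U t g \<in> borel_measurable N" by (simp add: transition_def)
    from measurable_compose[OF X_measurable[OF s] this]
    have "(\<lambda>\<omega>. U t g (X s \<omega>)) \<in> borel_measurable (Pr x)"
      by (simp add: Pr_sets[OF x] cong: measurable_cong_sets)
    with ae Ym show ?thesis
      by (intro integral_cong_AE borel_measurable_times borel_measurable_cond_exp2) auto
  qed
  finally show ?thesis .
qed

lemma transition_eq_FK: "U t g = FK (\<lambda>_. 0) t g"
  by (rule ext) (simp add: transition_def FK_def acc_def set_lebesgue_integral_def)

lemma FK_comp_measurable: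
  assumes W: "W \<in> borel_measurable N" and \<tau>: "\<tau> \<in> borel_measurable K"
    and G: "(\<lambda>p. G (fst p) (snd p)) \<in> borel_measurable (K \<Otimes>\<^sub>M N)"
  shows "(\<lambda>p. FK W (max 0 (\<tau> (fst p))) (G (fst p)) (snd p)) \<in> borel_measurable (K \<Otimes>\<^sub>M N)"
proof -
  note [measurable] = \<tau>
  have "(\<lambda>q. (fst q, X (max 0 (\<tau> (fst q))) (snd q))) \<in> measurable (K \<Otimes>\<^sub>M \<Omega>) (K \<Otimes>\<^sub>M N)"
    by (intro measurable_Pair X_comp_measurable) measurable
  from measurable_compose[OF this G]
  have [measurable]: "(\<lambda>q. G (fst q) (X (max 0 (\<tau> (fst q))) (snd q))) \<in> borel_measurable (K \<Otimes>\<^sub>M \<Omega>)" by simp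
  have [measurable]: "(\<lambda>q. acc W (max 0 (\<tau> (fst q))) (snd q)) \<in> borel_measurable (K \<Otimes>\<^sub>M \<Omega>)"
    by (intro acc_comp_measurable[OF W]) measurable
  have "(\<lambda>q. exp (acc W (max 0 (\<tau> (fst q))) (snd q)) * G (fst q) (X (max 0 (\<tau> (fst q))) (snd q)))
      \<in> borel_measurable (K \<Otimes>\<^sub>M \<Omega>)" by measurable
  from kernel_integral_measurable[OF this] show ?thesis by (simp add: FK_def)
qed

lemma FK_measurable:
  assumes W: "W \<in> borel_measurable N" and t: "0 \<le> t" and g: "g \<in> borel_measurable N"
  shows "FK W t g \<in> borel_measurable N"
proof -
  have "(\<lambda>p. FK W (max 0 t) g (snd p)) \<in> borel_measurable ((borel :: real measure) \<Otimes>\<^sub>M N)"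
    by (intro FK_comp_measurable[where \<tau>="\<lambda>_. t" and G="\<lambda>_. g"] W measurable_compose[OF measurable_snd g]) auto
  from measurable_compose[OF measurable_Pair1' this, of "0::real"] show ?thesis using t by simp
qed

lemma FK_integrand:
  assumes W: "bfun a W" and g: "bfun c g" and t: "0 \<le> t"
  shows "(\<lambda>\<omega>. exp (acc W t \<omega>) * g (X t \<omega>)) \<in> borel_measurable \<Omega>"
    and "\<And>\<omega>. \<omega> \<in> space \<Omega> \<Longrightarrow> \<bar>exp (acc W t \<omega>) * g (X t \<omega>)\<bar> \<le> exp (a * t) * c"
proof -
  have [measurable]: "acc W t \<in> borel_measurable \<Omega>"
    using acc_comp_measurable[OF bfun_measurable[OF W], of "\<lambda>_. t" \<Omega> "\<lambda>\<omega>. \<omega>"] by simp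
  have [measurable]: "(\<lambda>\<omega>. g (X t \<omega>)) \<in> borel_measurable \<Omega>"
    by (rule measurable_compose[OF X_measurable[OF t] bfun_measurable[OF g]])
  show "(\<lambda>\<omega>. exp (acc W t \<omega>) * g (X t \<omega>)) \<in> borel_measurable \<Omega>" by measurable
  fix \<omega> assume w: "\<omega> \<in> space \<Omega>"
  show "\<bar>exp (acc W t \<omega>) * g (X t \<omega>)\<bar> \<le> exp (a * t) * c"
    unfolding abs_mult using exp_acc_bound[OF W t w] bfun_bound[OF g X_in[OF w t]]
    by (intro mult_mono) auto
qed

lemma FK_bfun:
  assumes W: "bfun a W" and g: "bfun c g" and t: "0 \<le> t"
  shows "bfun (exp (a * t) * c) (FK W t g)"
  using integral_Pr_bound[OF _ FK_integrand[OF W g t]] bfun_nonneg[OF g]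
    FK_measurable[OF bfun_measurable[OF W] t bfun_measurable[OF g]]
  by (simp add: bfun_def FK_def)

lemma U_bfun: "bfun c g \<Longrightarrow> 0 \<le> t \<Longrightarrow> bfun c (U t g)"
  using FK_bfun[of 0 "\<lambda>_. 0" c g t] bfun_const[of 0] by (simp add: transition_eq_FK)

lemma FK_lin:
  assumes W: "bfun a W" and g: "bfun c g" and h: "bfun d h" and t: "0 \<le> t" and x: "x \<in> S"
  shows "FK W t (\<lambda>x. p * g x + q * h x) x = p * FK W t g x + q * FK W t h x"
proof -
  have "FK W t (\<lambda>x. p * g x + q * h x) x
      = (LINT \<omega>|Pr x. p * (exp (acc W t \<omega>) * g (X t \<omega>)) + q * (exp (acc W t \<omega>) * h (X t \<omega>)))"
    unfolding FK_def by (intro Bochner_Integration.integral_cong) (auto simp: algebra_simps)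
  also have "\<dots> = p * FK W t g x + q * FK W t h x"
    unfolding FK_def using integrable_Pr[OF x FK_integrand[OF W g t]] integrable_Pr[OF x FK_integrand[OF W h t]]
    by simp
  finally show ?thesis .
qed

lemma FK_cong:
  assumes "\<And>y. y \<in> S \<Longrightarrow> g y = h y" "0 \<le> t" "x \<in> S"
  shows "FK W t g x = FK W t h x"
  unfolding FK_def using assms by (intro Bochner_Integration.integral_cong) (auto simp: Pr_space X_in)

lemma FK_zero:
  assumes x: "x \<in> S" and g: "g \<in> borel_measurable N"
  shows "FK W 0 g x = g x"
proof -
  interpret prob_space "Pr x" using x by (rule Pr_prob)
  have 0: "acc W 0 \<omega> = 0" for \<omega>
    unfolding acc_def set_lebesgue_integral_def
    by (rule integral_eq_zero_AE) (use AE_lborel_singleton[of "0::real"] in \<open>eventually_elim, auto\<close>)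
  have "FK W 0 g x = (LINT \<omega>|Pr x. g x)"
    unfolding FK_def 0
  proof (rule integral_cong_AE)
    show "(\<lambda>\<omega>. exp 0 * g (X 0 \<omega>)) \<in> borel_measurable (Pr x)"
      using measurable_compose[OF X_measurable[of 0] g] by (simp add: Pr_sets[OF x] cong: measurable_cong_sets)
    show "AE \<omega> in Pr x. exp 0 * g (X 0 \<omega>) = g x" using X_start[OF x] by eventually_elim simp
  qed simp
  then show ?thesis by (simp add: prob_space)
qed

text \<open>
  Expand the exponential weight over the last \<open>t\<close> units of time. The weight accumulated up to an
  intermediate time is known at that time, so only the Markov property at single times is used.
\<close>

lemma Duhamel:
  assumes W: "bfun a W" and g: "bfun c g" and s: "0 \<le> s" and t: "0 \<le> t" and x: "x \<in> S"
  shows "FK W (s + t) g x = FK W s (U t g) x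
    + (LINT r:{0..t}|lborel. FK W (s + r) (\<lambda>y. W y * U (t - r) g y) x)"
proof -
  interpret prob_space "Pr x" using x by (rule Pr_prob)
  have fin: "finite_measure (Pr x)" by (rule finite_measure_axioms)
  have ac: "(\<lambda>q. acc W (max 0 (s + fst q)) (snd q)) \<in> borel_measurable (borel \<Otimes>\<^sub>M \<Omega>)"
    by (intro acc_comp_measurable[OF bfun_measurable[OF W]]) measurable
  have WX: "(\<lambda>q. W (X (max 0 (s + fst q)) (snd q))) \<in> borel_measurable (borel \<Otimes>\<^sub>M \<Omega>)"
    by (intro measurable_compose[OF X_comp_measurable bfun_measurable[OF W]]) measurable
  have gX0: "(\<lambda>\<omega>. g (X (s + t) \<omega>)) \<in> borel_measurable \<Omega>"
    using s t by (intro measurable_compose[OF X_measurable bfun_measurable[OF g]]) auto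
  have gX: "(\<lambda>q. g (X (s + t) (snd q))) \<in> borel_measurable ((borel :: real measure) \<Otimes>\<^sub>M \<Omega>)"
    by (rule measurable_compose[OF measurable_snd gX0])
  define h where "h r \<omega> = exp (acc W (max 0 (s + r)) \<omega>) * W (X (max 0 (s + r)) \<omega>) * g (X (s + t) \<omega>)" for r \<omega>
  have hm: "(\<lambda>q. h (fst q) (snd q)) \<in> borel_measurable (borel \<Otimes>\<^sub>M Pr x)"
    unfolding h_def using ac WX gX
    by (simp add: Pr_sets[OF x] cong: measurable_cong_sets sets_pair_measure_cong)
  have hb: "\<bar>h r \<omega>\<bar> \<le> exp (a * (s + t)) * a * c" if r: "r \<in> {0..t}" and w: "\<omega> \<in> space (Pr x)" for r \<omega>
  proof -
    have w': "\<omega> \<in> space \<Omega>" using w by (simp add: Pr_space[OF x])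
    have "exp (acc W (max 0 (s + r)) \<omega>) \<le> exp (a * max 0 (s + r))" by (intro exp_acc_bound[OF W] w') simp
    also have "\<dots> \<le> exp (a * (s + t))" using r s t bfun_nonneg[OF W] by (auto intro!: mult_left_mono)
    finally have 1: "exp (acc W (max 0 (s + r)) \<omega>) \<le> exp (a * (s + t))" .
    have 2: "\<bar>W (X (max 0 (s + r)) \<omega>)\<bar> \<le> a" "\<bar>g (X (s + t) \<omega>)\<bar> \<le> c"
      using s t by (auto intro!: bfun_bound[OF W] bfun_bound[OF g] X_in[OF w'])
    show ?thesis unfolding h_def abs_mult using 1 2 bfun_nonneg[OF W]
      by (intro mult_mono mult_nonneg_nonneg) auto
  qed
  have int2: "integrable (Pr x) (\<lambda>\<omega>. LINT r:{0..t}|lborel. h r \<omega>)"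
    by (rule Fubini_Icc(2)[OF fin hm hb])
  have acs: "acc W s \<in> borel_measurable \<Omega>"
    using acc_comp_measurable[OF bfun_measurable[OF W], of "\<lambda>_. s" \<Omega> "\<lambda>\<omega>. \<omega>"] by simp
  have int1: "integrable (Pr x) (\<lambda>\<omega>. exp (acc W s \<omega>) * g (X (s + t) \<omega>))"
  proof (rule integrable_Pr[OF x, where c="exp (a * s) * c"])
    show "\<bar>exp (acc W s \<omega>) * g (X (s + t) \<omega>)\<bar> \<le> exp (a * s) * c" if w: "\<omega> \<in> space \<Omega>" for \<omega>
      unfolding abs_mult using s t exp_acc_bound[OF W s w]
      by (intro mult_mono bfun_bound[OF g] X_in[OF w]) auto
  qed (use acs gX0 in measurable)
  have "FK W (s + t) g x = (LINT \<omega>|Pr x. exp (acc W s \<omega>) * g (X (s + t) \<omega>) + (LINT r:{0..t}|lborel. h r \<omega>))"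
    unfolding FK_def
  proof (intro Bochner_Integration.integral_cong refl)
    fix \<omega> assume "\<omega> \<in> space (Pr x)"
    then have w: "\<omega> \<in> space \<Omega>" by (simp add: Pr_space[OF x])
    have "(LINT r:{0..t}|lborel. h r \<omega>)
        = (LINT r:{0..t}|lborel. exp (acc W (s + r) \<omega>) * W (X (s + r) \<omega>) * g (X (s + t) \<omega>))"
      using s by (intro set_lebesgue_integral_cong) (auto simp: h_def)
    then show "exp (acc W (s + t) \<omega>) * g (X (s + t) \<omega>)
        = exp (acc W s \<omega>) * g (X (s + t) \<omega>) + (LINT r:{0..t}|lborel. h r \<omega>)"
      by (simp add: exp_acc_increment[OF W s t w] distrib_right)
  qed
  also have "\<dots> = (LINT \<omega>|Pr x. exp (acc W s \<omega>) * g (X (s + t) \<omega>)) + (LINT \<omega>|Pr x. (LINT r:{0..t}|lborel. h r \<omega>))"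
    by (rule Bochner_Integration.integral_add[OF int1 int2])
  also have "(LINT \<omega>|Pr x. exp (acc W s \<omega>) * g (X (s + t) \<omega>)) = FK W s (U t g) x"
    unfolding FK_def
  proof (rule markov[OF x s t g])
    show "(\<lambda>\<omega>. exp (acc W s \<omega>)) \<in> borel_measurable (natural_filtration S \<Omega> X s)"
      using acc_adapted[OF bfun_measurable[OF W] s] by measurable
    show "\<bar>exp (acc W s \<omega>)\<bar> \<le> exp (a * s)" if "\<omega> \<in> space \<Omega>" for \<omega>
      using exp_acc_bound[OF W s that] by simp
  qed
  also have "(LINT \<omega>|Pr x. (LINT r:{0..t}|lborel. h r \<omega>)) = (LINT r:{0..t}|lborel. (LINT \<omega>|Pr x. h r \<omega>))"
    by (rule Fubini_Icc(1)[OF fin hm hb])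
  also have "\<dots> = (LINT r:{0..t}|lborel. FK W (s + r) (\<lambda>y. W y * U (t - r) g y) x)"
  proof (intro set_lebesgue_integral_cong allI impI)
    fix r assume r: "r \<in> {0..t}"
    then have sr: "0 \<le> s + r" "0 \<le> t - r" using s by auto
    have "(LINT \<omega>|Pr x. h r \<omega>) = (LINT \<omega>|Pr x. (exp (acc W (s + r) \<omega>) * W (X (s + r) \<omega>)) * g (X ((s + r) + (t - r)) \<omega>))"
      using sr by (simp add: h_def)
    also have "\<dots> = (LINT \<omega>|Pr x. (exp (acc W (s + r) \<omega>) * W (X (s + r) \<omega>)) * U (t - r) g (X (s + r) \<omega>))"
    proof (rule markov[OF x sr g])
      have "X (s + r) \<in> measurable (natural_filtration S \<Omega> X (s + r)) N"
        using sr by (intro X_adapted) simp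
      from measurable_compose[OF this bfun_measurable[OF W]] acc_adapted[OF bfun_measurable[OF W] sr(1)]
      show "(\<lambda>\<omega>. exp (acc W (s + r) \<omega>) * W (X (s + r) \<omega>)) \<in> borel_measurable (natural_filtration S \<Omega> X (s + r))"
        by measurable
      show "\<bar>exp (acc W (s + r) \<omega>) * W (X (s + r) \<omega>)\<bar> \<le> exp (a * (s + r)) * a" if "\<omega> \<in> space \<Omega>" for \<omega>
        using FK_integrand(2)[OF W W sr(1) that] .
    qed
    also have "\<dots> = FK W (s + r) (\<lambda>y. W y * U (t - r) g y) x"
      by (simp add: FK_def mult.assoc)
    finally show "(LINT \<omega>|Pr x. h r \<omega>) = FK W (s + r) (\<lambda>y. W y * U (t - r) g y) x" .
  qed simp
  finally show ?thesis .
qed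

lemma Duhamel_kernel_measurable:
  assumes W: "bfun a W" and g: "bfun c g"
  shows "(\<lambda>p. FK W (max 0 (s + fst p)) (\<lambda>y. W y * U (max 0 (t - fst p)) g y) (snd p))
    \<in> borel_measurable (borel \<Otimes>\<^sub>M N)"
proof (rule FK_comp_measurable[OF bfun_measurable[OF W], where \<tau>="\<lambda>r. s + r"])
  have "(\<lambda>p. FK (\<lambda>_. 0) (max 0 (t - fst p)) g (snd p)) \<in> borel_measurable ((borel :: real measure) \<Otimes>\<^sub>M N)"
    by (intro FK_comp_measurable[where \<tau>="\<lambda>r. t - r" and G="\<lambda>_. g"]
        measurable_compose[OF measurable_snd bfun_measurable[OF g]]) auto
  then show "(\<lambda>p. W (snd p) * U (max 0 (t - fst p)) g (snd p)) \<in> borel_measurable ((borel :: real measure) \<Otimes>\<^sub>M N)"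
    using measurable_compose[OF measurable_snd bfun_measurable[OF W]]
    by (auto simp: transition_eq_FK intro!: borel_measurable_times)
qed measurable

lemma Duhamel_source_bfun:
  "bfun a W \<Longrightarrow> bfun c g \<Longrightarrow> 0 \<le> t \<Longrightarrow> bfun (a * c) (\<lambda>y. W y * U t g y)"
  by (intro bfun_mult U_bfun)

lemma FK_source_bfun:
  assumes W: "bfun a W" and g: "bfun c g" and r: "r \<in> {0..t}"
  shows "bfun (exp (a * t) * (a * c)) (FK W r (\<lambda>y. W y * U (t - r) g y))"
proof -
  have "bfun (exp (a * r) * (a * c)) (FK W r (\<lambda>y. W y * U (t - r) g y))"
    using r by (intro FK_bfun[OF W] Duhamel_source_bfun[OF W g]) auto
  moreover have "exp (a * r) * (a * c) \<le> exp (a * t) * (a * c)"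
    using r bfun_nonneg[OF W] bfun_nonneg[OF g] by (intro mult_right_mono) (auto intro: mult_left_mono)
  ultimately show ?thesis unfolding bfun_def by (auto intro: order_trans)
qed

text \<open>
  The composition satisfies the same formula: expand the inner operator starting from time \<open>0\<close> and let
  the outer one act under the time integral.
\<close>

lemma FK_Duhamel:
  assumes W: "bfun a W" and g: "bfun c g" and s: "0 \<le> s" and t: "0 \<le> t" and x: "x \<in> S"
  shows "FK W s (FK W t g) x = FK W s (U t g) x
    + (LINT r:{0..t}|lborel. FK W s (FK W r (\<lambda>y. W y * U (t - r) g y)) x)"
proof -
  interpret prob_space "Pr x" using x by (rule Pr_prob)
  have fin: "finite_measure (Pr x)" by (rule finite_measure_axioms)
  define k where "k r = FK W (max 0 r) (\<lambda>y. W y * U (max 0 (t - r)) g y)" for r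
  have km: "(\<lambda>p. k (fst p) (snd p)) \<in> borel_measurable (borel \<Otimes>\<^sub>M N)"
    using Duhamel_kernel_measurable[OF W g, of 0 t] by (simp add: k_def)
  have k_eq: "k r = FK W r (\<lambda>y. W y * U (t - r) g y)" if "r \<in> {0..t}" for r
    using that by (simp add: k_def)
  have acs: "acc W s \<in> borel_measurable \<Omega>"
    using acc_comp_measurable[OF bfun_measurable[OF W], of "\<lambda>_. s" \<Omega> "\<lambda>\<omega>. \<omega>"] by simp
  define h where "h r \<omega> = exp (acc W s \<omega>) * k r (X s \<omega>)" for r \<omega>
  have pm: "(\<lambda>q. (fst q, X s (snd q))) \<in> measurable ((borel :: real measure) \<Otimes>\<^sub>M \<Omega>) (borel \<Otimes>\<^sub>M N)"
    by (intro measurable_Pair measurable_compose[OF measurable_snd X_measurable[OF s]]) simp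
  have [measurable]: "(\<lambda>q. k (fst q) (X s (snd q))) \<in> borel_measurable (borel \<Otimes>\<^sub>M \<Omega>)"
    using measurable_compose[OF pm km] by simp
  have "(\<lambda>q. h (fst q) (snd q)) \<in> borel_measurable (borel \<Otimes>\<^sub>M \<Omega>)"
    unfolding h_def using acs by measurable
  then have hm: "(\<lambda>q. h (fst q) (snd q)) \<in> borel_measurable (borel \<Otimes>\<^sub>M Pr x)"
    by (simp add: Pr_sets[OF x] cong: measurable_cong_sets sets_pair_measure_cong)
  have hb: "\<bar>h r \<omega>\<bar> \<le> exp (a * s) * (exp (a * t) * (a * c))" if r: "r \<in> {0..t}" and w: "\<omega> \<in> space (Pr x)" for r \<omega>
    using FK_integrand(2)[OF W FK_source_bfun[OF W g r] s, of \<omega>] w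
    by (simp add: h_def k_eq[OF r] Pr_space[OF x])
  note int1 = integrable_Pr[OF x FK_integrand[OF W U_bfun[OF g t] s]]
  have int2: "integrable (Pr x) (\<lambda>\<omega>. LINT r:{0..t}|lborel. h r \<omega>)"
    by (rule Fubini_Icc(2)[OF fin hm hb])
  have "FK W s (FK W t g) x
      = (LINT \<omega>|Pr x. exp (acc W s \<omega>) * U t g (X s \<omega>) + (LINT r:{0..t}|lborel. h r \<omega>))"
    unfolding FK_def[of W s]
  proof (intro Bochner_Integration.integral_cong refl)
    fix \<omega> assume "\<omega> \<in> space (Pr x)"
    then have y: "X s \<omega> \<in> S" using s by (simp add: Pr_space[OF x] X_in)
    have "FK W t g (X s \<omega>) = U t g (X s \<omega>)
        + (LINT r:{0..t}|lborel. FK W r (\<lambda>y. W y * U (t - r) g y) (X s \<omega>))"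
      using Duhamel[OF W g order_refl t y] FK_zero[OF y bfun_measurable[OF U_bfun[OF g t]], of W] by simp
    also have "(LINT r:{0..t}|lborel. FK W r (\<lambda>y. W y * U (t - r) g y) (X s \<omega>))
        = (LINT r:{0..t}|lborel. k r (X s \<omega>))"
      by (intro set_lebesgue_integral_cong) (auto simp: k_eq)
    finally show "exp (acc W s \<omega>) * FK W t g (X s \<omega>)
        = exp (acc W s \<omega>) * U t g (X s \<omega>) + (LINT r:{0..t}|lborel. h r \<omega>)"
      by (simp add: h_def distrib_left)
  qed
  also have "\<dots> = FK W s (U t g) x + (LINT \<omega>|Pr x. (LINT r:{0..t}|lborel. h r \<omega>))"
    unfolding FK_def by (rule Bochner_Integration.integral_add[OF int1 int2])
  also have "(LINT \<omega>|Pr x. (LINT r:{0..t}|lborel. h r \<omega>)) = (LINT r:{0..t}|lborel. (LINT \<omega>|Pr x. h r \<omega>))"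
    by (rule Fubini_Icc(1)[OF fin hm hb])
  also have "\<dots> = (LINT r:{0..t}|lborel. FK W s (FK W r (\<lambda>y. W y * U (t - r) g y)) x)"
    by (intro set_lebesgue_integral_cong) (auto simp: FK_def[of W s] h_def k_eq)
  finally show ?thesis .
qed

lemma set_integral_power_bound:
  fixes q :: "real \<Rightarrow> real"
  assumes t: "0 \<le> t" and A: "0 \<le> A" and q: "\<And>r. r \<in> {0..t} \<Longrightarrow> \<bar>q r\<bar> \<le> A * r ^ n"
  shows "\<bar>LINT r:{0..t}|lborel. q r\<bar> \<le> A * t ^ Suc n / real (Suc n)"
proof -
  have int: "integrable lborel (\<lambda>r::real. r ^ n * indicator {0..t} r)"
    using borel_integrable_atLeastAtMost'[of 0 t "\<lambda>r. r ^ n"]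
    by (simp add: set_integrable_def mult.commute continuous_intros)
  have "norm (LINT r:{0..t}|lborel. q r) \<le> (LINT r|lborel. norm (indicator {0..t} r *\<^sub>R q r))"
    unfolding set_lebesgue_integral_def by (rule integral_norm_bound)
  also have "\<dots> \<le> (LINT r|lborel. A * (r ^ n * indicator {0..t} r))"
    using q int A by (intro integral_mono_AE') (auto simp: indicator_def)
  also have "\<dots> = A * t ^ Suc n / real (Suc n)"
    using t by (simp add: integral_power)
  finally show ?thesis by simp
qed

text \<open>
  The law expresses the Markov property for a functional of the whole future path. Both sides satisfy the same
  Duhamel equation, so the defect reproduces itself under time integration and is bounded by every term
  of an exponential series.
\<close>

lemma FK_semigroup:
  assumes W: "bfun a W" and g: "bfun c g" and s: "0 \<le> s" and t: "0 \<le> t" and x: "x \<in> S"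
  shows "FK W (s + t) g x = FK W s (FK W t g) x"
proof -
  note a0 = bfun_nonneg[OF W]
  define D where "D t g = FK W (s + t) g x - FK W s (FK W t g) x" for t g
  have D_eq: "D t g = (LINT r:{0..t}|lborel. D r (\<lambda>y. W y * U (t - r) g y))"
    if g: "bfun c g" and t: "0 \<le> t" for t g c
  proof -
    define k1 where "k1 r = FK W (max 0 (s + r)) (\<lambda>y. W y * U (max 0 (t - r)) g y) x" for r
    define k where "k r = FK W (max 0 r) (\<lambda>y. W y * U (max 0 (t - r)) g y)" for r
    have km: "(\<lambda>p. k (fst p) (snd p)) \<in> borel_measurable (borel \<Otimes>\<^sub>M N)"
      using Duhamel_kernel_measurable[OF W g, of 0 t] by (simp add: k_def)
    have xN: "x \<in> space N" using x by (simp add: space_restrict_space)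
    have m1: "k1 \<in> borel_measurable borel"
      using measurable_compose[OF measurable_Pair2'[OF xN] Duhamel_kernel_measurable[OF W g, of s t]]
      by (simp add: k1_def[abs_def])
    have "(\<lambda>p. FK W (max 0 s) (k (fst p)) (snd p)) \<in> borel_measurable ((borel :: real measure) \<Otimes>\<^sub>M N)"
      by (rule FK_comp_measurable[OF bfun_measurable[OF W], where \<tau>="\<lambda>_. s"]) (use km in auto)
    from measurable_compose[OF measurable_Pair2'[OF xN] this]
    have m2: "(\<lambda>r. FK W s (k r) x) \<in> borel_measurable borel" using s by simp
    have k_eq: "k1 r = FK W (s + r) (\<lambda>y. W y * U (t - r) g y) x"
      "k r = FK W r (\<lambda>y. W y * U (t - r) g y)" if "r \<in> {0..t}" for r
      using that s by (simp_all add: k_def k1_def)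
    have i1: "set_integrable lborel {0..t} k1"
    proof (rule set_integrable_bounded_Icc[OF m1])
      fix r assume r: "r \<in> {0..t}"
      have "\<bar>k1 r\<bar> \<le> exp (a * (s + r)) * (a * c)"
        unfolding k_eq[OF r] using r s
        by (intro bfun_bound[OF FK_bfun[OF W Duhamel_source_bfun[OF W g]] x]) auto
      also have "\<dots> \<le> exp (a * (s + t)) * (a * c)"
        using r a0 bfun_nonneg[OF g] by (intro mult_right_mono) (auto intro!: mult_left_mono)
      finally show "\<bar>k1 r\<bar> \<le> exp (a * (s + t)) * (a * c)" .
    qed
    have i2: "set_integrable lborel {0..t} (\<lambda>r. FK W s (k r) x)"
    proof (rule set_integrable_bounded_Icc[OF m2])
      fix r assume r: "r \<in> {0..t}"
      show "\<bar>FK W s (k r) x\<bar> \<le> exp (a * s) * (exp (a * t) * (a * c))"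
        unfolding k_eq[OF r] by (intro bfun_bound[OF FK_bfun[OF W FK_source_bfun[OF W g r] s] x])
    qed
    have "D t g = (LINT r:{0..t}|lborel. k1 r) - (LINT r:{0..t}|lborel. FK W s (k r) x)"
      unfolding D_def Duhamel[OF W g s t x] FK_Duhamel[OF W g s t x]
      by (auto simp: k_eq intro!: arg_cong2[where f="(-)"] set_lebesgue_integral_cong)
    also have "\<dots> = (LINT r:{0..t}|lborel. k1 r - FK W s (k r) x)"
      by (rule set_integral_diff(2)[OF i1 i2, symmetric])
    also have "\<dots> = (LINT r:{0..t}|lborel. D r (\<lambda>y. W y * U (t - r) g y))"
      by (intro set_lebesgue_integral_cong) (auto simp: D_def k_eq)
    finally show ?thesis .
  qed
  have bound: "\<bar>D t' g\<bar> \<le> 2 * c * exp (a * (s + t)) * ((a * t') ^ n / fact n)"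
    if "bfun c g" "0 \<le> t'" "t' \<le> t" for n t' g c
    using that
  proof (induction n arbitrary: t' g c)
    case 0
    note c0 = bfun_nonneg[OF 0(1)]
    have "\<bar>FK W (s + t') g x\<bar> \<le> exp (a * (s + t')) * c"
      using 0 s by (intro bfun_bound[OF FK_bfun[OF W] x]) auto
    moreover have "\<bar>FK W s (FK W t' g) x\<bar> \<le> exp (a * s) * (exp (a * t') * c)"
      using 0 s by (intro bfun_bound[OF FK_bfun[OF W FK_bfun[OF W]] x]) auto
    ultimately have "\<bar>D t' g\<bar> \<le> 2 * (exp (a * (s + t')) * c)"
      by (simp add: D_def distrib_left exp_add abs_le_iff)
    also have "\<dots> \<le> 2 * (exp (a * (s + t)) * c)"
      using 0 a0 c0 by (intro mult_left_mono mult_right_mono) (auto intro!: mult_left_mono)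
    finally show ?case by (simp add: ac_simps)
  next
    case (Suc n)
    note c0 = bfun_nonneg[OF Suc.prems(1)]
    let ?A = "2 * (a * c) * exp (a * (s + t)) * (a ^ n / fact n)"
    have "\<bar>D t' g\<bar> \<le> ?A * t' ^ Suc n / real (Suc n)"
      unfolding D_eq[OF Suc.prems(1,2)]
    proof (rule set_integral_power_bound[OF Suc.prems(2)])
      fix r assume r: "r \<in> {0..t'}"
      have "\<bar>D r (\<lambda>y. W y * U (t' - r) g y)\<bar> \<le> 2 * (a * c) * exp (a * (s + t)) * ((a * r) ^ n / fact n)"
        using r Suc.prems by (intro Suc.IH Duhamel_source_bfun[OF W]) auto
      then show "\<bar>D r (\<lambda>y. W y * U (t' - r) g y)\<bar> \<le> ?A * r ^ n"
        by (simp add: power_mult_distrib mult.assoc)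
    qed (use a0 c0 in auto)
    also have "\<dots> = 2 * c * exp (a * (s + t)) * ((a * t') ^ Suc n / fact (Suc n))"
      by (simp add: power_mult_distrib field_simps)
    finally show ?case .
  qed
  have "(\<lambda>n. (a * t) ^ n / fact n) \<longlonglongrightarrow> 0"
    using summable_LIMSEQ_zero[OF summable_exp[of "a * t"]] by (simp add: divide_inverse mult.commute)
  then have "(\<lambda>n. 2 * c * exp (a * (s + t)) * ((a * t) ^ n / fact n)) \<longlonglongrightarrow> 2 * c * exp (a * (s + t)) * 0"
    by (intro tendsto_intros)
  then have "\<bar>D t g\<bar> \<le> 2 * c * exp (a * (s + t)) * 0"
    using bound[OF g t order_refl] by (intro LIMSEQ_le_const) auto
  then show ?thesis by (simp add: D_def)
qed

end

section \<open>Stationarity and the generator\<close>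

locale stationary_markov = cadlag_markov S \<Omega> X Pr + prob_space M
  for S :: "'x::{second_countable_topology, metric_space} set" and \<Omega> :: "'w measure"
    and X :: "real \<Rightarrow> 'w \<Rightarrow> 'x" and Pr :: "'x \<Rightarrow> 'w measure" and M :: "'x measure" +
  assumes M_sets: "sets M = sets (restrict_space borel S)"
    and invariant: "invariant_measure X Pr M"
    and semigroup: "strongly_continuous_semigroup M (transition X Pr)"
begin

lemma M_space: "space M = S"
  using sets_eq_imp_space_eq[OF M_sets] by (simp add: space_restrict_space)

lemma M_measurable: "g \<in> borel_measurable N \<Longrightarrow> g \<in> borel_measurable M"
  using M_sets by (simp cong: measurable_cong_sets)

lemma bfun_L2: "bfun c g \<Longrightarrow> g \<in> L2_fun M"
  by (rule L2_fun_bounded[of _ c]) (auto simp: M_space bfun_def intro: M_measurable)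

lemma invariant_nn_integral:
  assumes t: "0 \<le> t" and k: "k \<in> borel_measurable N"
  shows "(\<integral>\<^sup>+x. \<integral>\<^sup>+\<omega>. k (X t \<omega>) \<partial>Pr x \<partial>M) = (\<integral>\<^sup>+x. k x \<partial>M)"
proof -
  have P: "Pr \<in> measurable M (subprob_algebra \<Omega>)"
    using measurable_prob_algebraD[OF Pr_measurable] M_sets by (simp cong: measurable_cong_sets)
  have kX: "(\<lambda>\<omega>. k (X t \<omega>)) \<in> borel_measurable \<Omega>"
    by (rule measurable_compose[OF X_measurable[OF t] k])
  have sets: "sets (M \<bind> Pr) = sets \<Omega>"
    using not_empty by (intro sets_bind_measurable[OF P])
  have Xm: "X t \<in> measurable (M \<bind> Pr) M"
    using X_measurable[OF t] sets M_sets by (simp cong: measurable_cong_sets)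
  have "(\<integral>\<^sup>+x. k x \<partial>M) = (\<integral>\<^sup>+x. k x \<partial>distr (M \<bind> Pr) M (X t))"
    using invariant t by (simp add: invariant_measure_def)
  also have "\<dots> = (\<integral>\<^sup>+\<omega>. k (X t \<omega>) \<partial>(M \<bind> Pr))"
    using k M_sets by (intro nn_integral_distr[OF Xm]) (simp cong: measurable_cong_sets)
  also have "\<dots> = (\<integral>\<^sup>+x. \<integral>\<^sup>+\<omega>. k (X t \<omega>) \<partial>Pr x \<partial>M)"
    by (rule nn_integral_bind[OF kX P])
  finally show ?thesis by simp
qed

text \<open>
  Jensen's inequality under each \<open>Pr x\<close>, then invariance of \<open>M\<close>.
\<close>

lemma FK_contraction:
  assumes W: "bfun a W" and g: "bfun c g" and t: "0 \<le> t"
  shows "nrm M (FK W t g) \<le> exp (a * t) * nrm M g"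
proof -
  have "nrm M (FK W t g) \<le> nrm M (\<lambda>x. exp (a * t) * g x)"
  proof (rule L2_funI_nn_integral_le(2))
    show "(\<lambda>x. exp (a * t) * g x) \<in> L2_fun M" by (rule L2_fun_scale[OF bfun_L2[OF g]])
    show "FK W t g \<in> borel_measurable M" by (rule M_measurable[OF bfun_measurable[OF FK_bfun[OF W g t]]])
    have "(\<integral>\<^sup>+x. ennreal ((FK W t g x)\<^sup>2) \<partial>M)
        \<le> (\<integral>\<^sup>+x. \<integral>\<^sup>+\<omega>. ennreal ((exp (a * t) * g (X t \<omega>))\<^sup>2) \<partial>Pr x \<partial>M)"
    proof (rule nn_integral_mono)
      fix x assume "x \<in> space M"
      then have x: "x \<in> S" by (simp add: M_space)
      interpret P: prob_space "Pr x" using x by (rule Pr_prob)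
      have "ennreal ((FK W t g x)\<^sup>2) \<le> (\<integral>\<^sup>+\<omega>. ennreal ((exp (acc W t \<omega>) * g (X t \<omega>))\<^sup>2) \<partial>Pr x)"
        unfolding FK_def using FK_integrand(1)[OF W g t]
        by (intro P.nn_integral_centered_square_le(2)) (simp add: Pr_sets[OF x] cong: measurable_cong_sets)
      also have "\<dots> \<le> (\<integral>\<^sup>+\<omega>. ennreal ((exp (a * t) * g (X t \<omega>))\<^sup>2) \<partial>Pr x)"
      proof (rule nn_integral_mono)
        fix \<omega> assume "\<omega> \<in> space (Pr x)"
        then have "exp (acc W t \<omega>) \<le> exp (a * t)" by (intro exp_acc_bound[OF W t]) (simp add: Pr_space[OF x])
        then have "(exp (acc W t \<omega>))\<^sup>2 * (g (X t \<omega>))\<^sup>2 \<le> (exp (a * t))\<^sup>2 * (g (X t \<omega>))\<^sup>2"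
          by (intro mult_right_mono power_mono) auto
        then show "ennreal ((exp (acc W t \<omega>) * g (X t \<omega>))\<^sup>2) \<le> ennreal ((exp (a * t) * g (X t \<omega>))\<^sup>2)"
          by (simp add: power_mult_distrib)
      qed
      finally show "ennreal ((FK W t g x)\<^sup>2) \<le> \<dots>" .
    qed
    also have "\<dots> = (\<integral>\<^sup>+x. ennreal ((exp (a * t) * g x)\<^sup>2) \<partial>M)"
      using bfun_measurable[OF g] by (intro invariant_nn_integral[OF t, where k="\<lambda>x. ennreal ((exp (a * t) * g x)\<^sup>2)"]) simp
    finally show "(\<integral>\<^sup>+x. ennreal ((FK W t g x)\<^sup>2) \<partial>M) \<le> \<dots>" .
  qed
  then show ?thesis by (simp add: nrm_scale)
qed

lemma U_continuous:
  assumes g: "bfun c g" and e: "0 < e"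
  obtains h0 where "0 < h0" "\<And>h. 0 \<le> h \<Longrightarrow> h < h0 \<Longrightarrow> nrm M (\<lambda>x. U h g x - g x) < e"
proof -
  have "((\<lambda>t. nrm M (\<lambda>x. U t g x - g x)) \<longlongrightarrow> 0) (at_right 0)"
    using semigroup bfun_L2[OF g] by (simp add: strongly_continuous_semigroup_def)
  then have "eventually (\<lambda>t. nrm M (\<lambda>x. U t g x - g x) < e) (at_right 0)"
    using e by (rule order_tendstoD)
  then obtain h0 where h0: "0 < h0" "\<And>h. 0 < h \<Longrightarrow> h < h0 \<Longrightarrow> nrm M (\<lambda>x. U h g x - g x) < e"
    unfolding eventually_at_right_field by blast
  have "nrm M (\<lambda>x. U 0 g x - g x) = nrm M (\<lambda>_. 0)"
    by (rule nrm_cong) (simp add: M_space transition_eq_FK FK_zero[OF _ bfun_measurable[OF g]])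
  also have "\<dots> < e" using e by (simp add: nrm_def ip_def)
  finally show thesis
    using h0 by (intro that[of h0]) (auto simp: le_less)
qed

text \<open>Test the average against itself and exchange the integrals.\<close>

lemma nrm_time_average_le:
  assumes h: "0 < h" and Fm: "(\<lambda>p. F (fst p) (snd p)) \<in> borel_measurable (borel \<Otimes>\<^sub>M N)"
    and Fk: "\<And>r x. r \<in> {0..h} \<Longrightarrow> x \<in> S \<Longrightarrow> \<bar>F r x\<bar> \<le> k"
    and e: "\<And>r. r \<in> {0..h} \<Longrightarrow> nrm M (F r) \<le> e"
  shows "nrm M (\<lambda>x. (1 / h) * (LINT r:{0..h}|lborel. F r x)) \<le> e"
proof -
  define G where "G x = (1 / h) * (LINT r:{0..h}|lborel. F r x)" for x
  have fin: "finite_measure M" by (rule finite_measure_axioms)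
  have Fm': "(\<lambda>p. F (fst p) (snd p)) \<in> borel_measurable (borel \<Otimes>\<^sub>M M)"
    using Fm M_sets by (simp cong: measurable_cong_sets sets_pair_measure_cong)
  have FrL: "F r \<in> L2_fun M" if r: "r \<in> {0..h}" for r
  proof (rule L2_fun_bounded)
    show "F r \<in> borel_measurable M" using measurable_compose[OF measurable_Pair1' Fm', of r] by simp
  qed (use Fk r in \<open>auto simp: M_space\<close>)
  have Gm: "G \<in> borel_measurable M"
    unfolding G_def using Fubini_Icc(2)[OF fin Fm', of h k] Fk
    by (intro borel_measurable_times) (auto simp: M_space)
  have Gk: "\<bar>G x\<bar> \<le> k" if "x \<in> S" for x
  proof -
    have "\<bar>LINT r:{0..h}|lborel. F r x\<bar> \<le> k * (h - 0)"
      using Fk that h by (intro set_integral_bounded_Icc) auto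
    then show ?thesis using h by (simp add: G_def abs_mult field_simps)
  qed
  have GL: "G \<in> L2_fun M" using Gm Gk by (intro L2_fun_bounded) (auto simp: M_space)
  obtain x0 where "x0 \<in> S" using not_empty M_space by auto
  then have k0: "0 \<le> k" using Gk[of x0] by linarith
  have FGm: "(\<lambda>p. F (fst p) (snd p) * G (snd p)) \<in> borel_measurable (borel \<Otimes>\<^sub>M M)"
    by (intro borel_measurable_times Fm' measurable_compose[OF measurable_snd Gm])
  have FGb: "\<bar>F r x * G x\<bar> \<le> k * k" if "r \<in> {0..h}" "x \<in> space M" for r x
    unfolding abs_mult using Fk[OF that(1)] Gk that k0 by (intro mult_mono) (auto simp: M_space)
  have "(nrm M G)\<^sup>2 = (LINT x|M. (1 / h) * (LINT r:{0..h}|lborel. F r x * G x))"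
    unfolding nrm_square ip_def by (intro Bochner_Integration.integral_cong) (auto simp: G_def)
  also have "\<dots> = (1 / h) * (LINT r:{0..h}|lborel. ip M (F r) G)"
    unfolding ip_def using Fubini_Icc(1)[OF fin FGm FGb, where t=h] by simp
  also have "\<dots> \<le> (1 / h) * (e * nrm M G * (h - 0))"
  proof (intro mult_left_mono)
    have "\<bar>LINT r:{0..h}|lborel. ip M (F r) G\<bar> \<le> (e * nrm M G) * (h - 0)"
    proof (rule set_integral_bounded_Icc)
      fix r assume r: "r \<in> {0..h}"
      have "\<bar>ip M (F r) G\<bar> \<le> nrm M (F r) * nrm M G" by (rule ip_Cauchy_Schwarz[OF FrL[OF r] GL])
      also have "\<dots> \<le> e * nrm M G" using e[OF r] by (intro mult_right_mono) auto
      finally show "\<bar>ip M (F r) G\<bar> \<le> e * nrm M G" .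
    qed (use h in simp)
    then show "(LINT r:{0..h}|lborel. ip M (F r) G) \<le> e * nrm M G * (h - 0)" by linarith
  qed (use h in simp)
  also have "\<dots> = e * nrm M G" using h by simp
  finally have "nrm M G * nrm M G \<le> e * nrm M G" by (simp add: power2_eq_square)
  moreover have "0 \<le> e" using order_trans[OF nrm_nonneg e[of 0]] h by simp
  ultimately have "nrm M G \<le> e"
    using nrm_nonneg[of M G] by (cases "nrm M G = 0") (auto simp: mult_le_cancel_right)
  then show ?thesis by (simp add: G_def[abs_def])
qed

lemma FK_minus_U_le:
  assumes W: "bfun a W" and g: "bfun c g" and t: "0 \<le> t" and x: "x \<in> S"
  shows "\<bar>FK W t g x - U t g x\<bar> \<le> a * t * exp (a * t) * c"
proof -
  have z: "bfun 0 (\<lambda>_. 0)" using bfun_const[of 0] by simp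
  note i1 = FK_integrand[OF W g t] and i2 = FK_integrand[OF z g t]
  have acc0: "acc (\<lambda>_. 0) t \<omega> = 0" for \<omega> by (simp add: acc_def set_lebesgue_integral_def)
  have "FK W t g x - U t g x = (LINT \<omega>|Pr x. exp (acc W t \<omega>) * g (X t \<omega>) - exp (acc (\<lambda>_. 0) t \<omega>) * g (X t \<omega>))"
    unfolding transition_eq_FK FK_def
    using integrable_Pr[OF x i1] integrable_Pr[OF x i2] by simp
  also have "\<bar>\<dots>\<bar> \<le> a * t * exp (a * t) * c"
  proof (rule integral_Pr_bound[OF x borel_measurable_diff[OF i1(1) i2(1)]])
    fix \<omega> assume w: "\<omega> \<in> space \<Omega>"
    note ab = acc_bound[OF W t w]
    have "\<bar>exp (acc W t \<omega>) - 1\<bar> \<le> \<bar>acc W t \<omega>\<bar> * exp \<bar>acc W t \<omega>\<bar>" by (rule abs_exp_minus_one_le)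
    also have "\<dots> \<le> a * t * exp (a * t)" using ab by (intro mult_mono) auto
    finally have "\<bar>exp (acc W t \<omega>) - 1\<bar> * \<bar>g (X t \<omega>)\<bar> \<le> a * t * exp (a * t) * c"
      using bfun_bound[OF g X_in[OF w t]] by (intro mult_mono) auto
    then show "\<bar>exp (acc W t \<omega>) * g (X t \<omega>) - exp (acc (\<lambda>_. 0) t \<omega>) * g (X t \<omega>)\<bar> \<le> a * t * exp (a * t) * c"
      by (simp add: acc0 left_diff_distrib[symmetric] abs_mult[symmetric] del: abs_mult)
        (simp add: left_diff_distrib)
  qed
  finally show ?thesis .
qed

text \<open>
  By Duhamel's formula the difference quotient is the time average of \<open>FK\<^sub>r (W U\<^sub>h\<^sub>-\<^sub>r u)\<close>, which is close
  to \<open>W u\<close> uniformly in \<open>r \<le> h\<close> since the semigroup is strongly continuous. Boundedness of \<open>u\<close>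
  keeps \<open>W u\<close> under control.
\<close>

lemma FK_perturbation:
  assumes W: "bfun a W" and u: "bfun c u"
  shows "((\<lambda>h. nrm M (\<lambda>x. (FK W h u x - U h u x) / h - W x * u x)) \<longlongrightarrow> 0) (at_right 0)"
proof -
  note a0 = bfun_nonneg[OF W] and c0 = bfun_nonneg[OF u]
  have Wu: "bfun (a * c) (\<lambda>x. W x * u x)" by (rule bfun_mult[OF W u])
  define D where "D = exp a * a + a * exp a * (a * c) + 1"
  have D: "0 < D" using a0 c0 by (simp add: D_def add_nonneg_pos)
  have main: "eventually (\<lambda>h. nrm M (\<lambda>x. (FK W h u x - U h u x) / h - W x * u x) \<le> D * e) (at_right 0)"
    if e: "0 < e" for e
  proof -
    obtain h1 where h1: "0 < h1" "\<And>h. 0 \<le> h \<Longrightarrow> h < h1 \<Longrightarrow> nrm M (\<lambda>x. U h u x - u x) < e"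
      using U_continuous[OF u e] by blast
    obtain h2 where h2: "0 < h2" "\<And>h. 0 \<le> h \<Longrightarrow> h < h2 \<Longrightarrow> nrm M (\<lambda>x. U h (\<lambda>x. W x * u x) x - W x * u x) < e"
      using U_continuous[OF Wu e] by blast
    define h0 where "h0 = Min {h1, h2, e, 1}"
    have h0: "0 < h0" using h1(1) h2(1) e by (simp add: h0_def)
    have "nrm M (\<lambda>x. (FK W h u x - U h u x) / h - W x * u x) \<le> D * e" if h: "0 < h" "h < h0" for h
    proof -
      have h': "h < h1" "h < h2" "h < e" "h < 1" using h by (auto simp: h0_def)
      define F where "F r x = FK W (max 0 r) (\<lambda>y. W y * U (max 0 (h - r)) u y) x - W x * u x" for r x
      have km: "(\<lambda>p. F (fst p) (snd p)) \<in> borel_measurable (borel \<Otimes>\<^sub>M N)"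
        unfolding F_def using Duhamel_kernel_measurable[OF W u, of 0 h]
        by (intro borel_measurable_diff measurable_compose[OF measurable_snd bfun_measurable[OF Wu]]) simp
      have F_eq: "F r x = FK W r (\<lambda>y. W y * U (h - r) u y) x - W x * u x" if "r \<in> {0..h}" for r x
        using that by (simp add: F_def)
      have src: "bfun (exp (a * h) * (a * c)) (FK W r (\<lambda>y. W y * U (h - r) u y))" if "r \<in> {0..h}" for r
        by (rule FK_source_bfun[OF W u that])
      have Fk: "\<bar>F r x\<bar> \<le> exp (a * h) * (a * c) + a * c" if r: "r \<in> {0..h}" and x: "x \<in> S" for r x
        unfolding F_eq[OF r] using bfun_bound[OF src[OF r] x] bfun_bound[OF Wu x] by linarith
      have Fe: "nrm M (F r) \<le> D * e" if r: "r \<in> {0..h}" for r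
      proof -
        have r': "0 \<le> r" "0 \<le> h - r" "r \<le> h" "r < h2" "h - r < h1" "r < 1" using r h' by auto
        define d where "d = (\<lambda>x. U (h - r) u x - u x)"
        have d: "bfun (2 * c) d"
          using bfun_lin[OF U_bfun[OF u r'(2)] u, of 1 "-1"] by (simp add: d_def)
        have Wd: "bfun (a * (2 * c)) (\<lambda>x. W x * d x)" by (rule bfun_mult[OF W d])
        define f1 where "f1 = FK W r (\<lambda>x. W x * d x)"
        define f2 where "f2 = (\<lambda>x. FK W r (\<lambda>x. W x * u x) x - U r (\<lambda>x. W x * u x) x)"
        define f3 where "f3 = (\<lambda>x. U r (\<lambda>x. W x * u x) x - W x * u x)"
        have L: "f1 \<in> L2_fun M" "f2 \<in> L2_fun M" "f3 \<in> L2_fun M"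
          unfolding f1_def f2_def f3_def
          by (intro L2_fun_diff bfun_L2[OF FK_bfun[OF W Wd r'(1)]] bfun_L2[OF FK_bfun[OF W Wu r'(1)]]
              bfun_L2[OF U_bfun[OF Wu r'(1)]] bfun_L2[OF Wu])+
        have "nrm M (F r) = nrm M (\<lambda>x. f1 x + (f2 x + f3 x))"
        proof (rule nrm_cong)
          fix x assume "x \<in> space M"
          then have x: "x \<in> S" by (simp add: M_space)
          have "FK W r (\<lambda>y. W y * U (h - r) u y) x = FK W r (\<lambda>y. 1 * (W y * d y) + 1 * (W y * u y)) x"
            using r' x by (intro FK_cong) (auto simp: d_def algebra_simps)
          also have "\<dots> = 1 * f1 x + 1 * FK W r (\<lambda>y. W y * u y) x"
            unfolding f1_def by (rule FK_lin[OF W Wd Wu r'(1) x])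
          finally show "F r x = f1 x + (f2 x + f3 x)"
            unfolding F_eq[OF r] by (simp add: f2_def f3_def)
        qed
        also have "\<dots> \<le> nrm M f1 + (nrm M f2 + nrm M f3)"
          by (intro order_trans[OF nrm_add_le[OF L(1) L2_fun_add[OF L(2,3)]]] add_left_mono nrm_add_le L)
        also have "nrm M f1 \<le> exp a * (a * e)"
        proof -
          have "nrm M f1 \<le> exp (a * r) * nrm M (\<lambda>x. W x * d x)"
            unfolding f1_def by (rule FK_contraction[OF W Wd r'(1)])
          also have "nrm M (\<lambda>x. W x * d x) \<le> nrm M (\<lambda>x. a * d x)"
            using bfun_bound[OF W] a0
            by (intro nrm_mono L2_fun_scale bfun_L2[OF d] M_measurable bfun_measurable[OF Wd] AE_I2)
              (auto simp: M_space abs_mult intro!: mult_right_mono)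
          also have "\<dots> = a * nrm M d" using a0 by (simp add: nrm_scale)
          also have "exp (a * r) * (a * nrm M d) \<le> exp a * (a * e)"
            using h1(2)[OF r'(2,5)] r' a0 mult_left_mono[of r 1 a] unfolding d_def[symmetric]
            by (intro mult_mono mult_left_mono) auto
          finally show ?thesis by simp
        qed
        also have "nrm M f2 \<le> a * e * exp a * (a * c)"
        proof (rule nrm_bounded)
          show "f2 \<in> borel_measurable M" using L(2) by (rule L2_fun_measurable)
          fix x assume "x \<in> space M"
          then have "\<bar>f2 x\<bar> \<le> a * r * exp (a * r) * (a * c)"
            unfolding f2_def by (intro FK_minus_U_le[OF W Wu r'(1)]) (simp add: M_space)
          also have "\<dots> \<le> a * e * exp a * (a * c)"
            using r' h' a0 c0 mult_left_mono[of r 1 a] by (intro mult_mono mult_nonneg_nonneg) auto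
          finally show "\<bar>f2 x\<bar> \<le> a * e * exp a * (a * c)" .
        qed
        also have "nrm M f3 \<le> e" using h2(2)[OF r'(1,4)] by (simp add: f3_def)
        finally show ?thesis by (simp add: D_def algebra_simps)
      qed
      have "nrm M (\<lambda>x. (FK W h u x - U h u x) / h - W x * u x)
          = nrm M (\<lambda>x. (1 / h) * (LINT r:{0..h}|lborel. F r x))"
      proof (rule nrm_cong)
        fix x assume "x \<in> space M"
        then have x: "x \<in> S" by (simp add: M_space)
        have xN: "x \<in> space N" using x by (simp add: space_restrict_space)
        have i: "set_integrable lborel {0..h} (\<lambda>r. F r x)"
          using measurable_compose[OF measurable_Pair2'[OF xN] km] Fk[OF _ x]
          by (intro set_integrable_bounded_Icc) auto
        have j: "set_integrable lborel {0..h} (\<lambda>r. W x * u x)"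
          by (intro set_integrable_bounded_Icc[where c="\<bar>W x * u x\<bar>"]) auto
        have "FK W h u x = U h u x + (LINT r:{0..h}|lborel. FK W r (\<lambda>y. W y * U (h - r) u y) x)"
          using Duhamel[OF W u order_refl less_imp_le[OF h(1)] x]
            FK_zero[OF x bfun_measurable[OF U_bfun[OF u less_imp_le[OF h(1)]]], of W] by simp
        also have "(LINT r:{0..h}|lborel. FK W r (\<lambda>y. W y * U (h - r) u y) x)
            = (LINT r:{0..h}|lborel. F r x + W x * u x)"
          by (intro set_lebesgue_integral_cong) (auto simp: F_eq)
        also have "\<dots> = (LINT r:{0..h}|lborel. F r x) + (LINT r:{0..h}|lborel. W x * u x)"
          by (rule set_integral_add(2)[OF i j])
        also have "(LINT r:{0..h}|lborel. W x * u x) = h * (W x * u x)"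
          using h by (simp add: set_lebesgue_integral_def)
        finally show "(FK W h u x - U h u x) / h - W x * u x = (1 / h) * (LINT r:{0..h}|lborel. F r x)"
          using h by (simp add: field_simps)
      qed
      also have "\<dots> \<le> D * e"
        by (rule nrm_time_average_le[OF h(1) km Fk Fe])
      finally show ?thesis .
    qed
    then show ?thesis
      unfolding eventually_at_right_field using h0 by blast
  qed
  show ?thesis
  proof (rule order_tendstoI)
    fix e :: real assume e: "0 < e"
    have "eventually (\<lambda>h. nrm M (\<lambda>x. (FK W h u x - U h u x) / h - W x * u x) \<le> D * (e / (2 * D))) (at_right 0)"
      using e D by (intro main) simp
    then show "eventually (\<lambda>h. nrm M (\<lambda>x. (FK W h u x - U h u x) / h - W x * u x) < e) (at_right 0)"
      using e D by (auto elim!: eventually_mono)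
  next
    fix e :: real assume "e < 0"
    then show "eventually (\<lambda>h. e < nrm M (\<lambda>x. (FK W h u x - U h u x) / h - W x * u x)) (at_right 0)"
      by (intro always_eventually allI) (rule less_le_trans[OF _ nrm_nonneg])
  qed
qed

text \<open>
  The error of the expansion \<open>FK\<^sub>h 1 \<approx> 1 + h W\<close>, divided by \<open>h\<close>.
\<close>

definition remainder :: "('x \<Rightarrow> real) \<Rightarrow> real \<Rightarrow> 'x \<Rightarrow> real" where
  "remainder W h x = (FK W h (\<lambda>_. 1) x - 1) / h - W x"

lemma one_bfun: "bfun 1 (\<lambda>_. 1)"
  using bfun_const[of 1] by simp

lemma nrm_one: "nrm M (\<lambda>_. 1) = 1"
  by (simp add: nrm_def ip_def prob_space)

lemma U_one: "x \<in> S \<Longrightarrow> U t (\<lambda>_. 1) x = 1"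
  unfolding transition_def using prob_space.prob_space[OF Pr_prob] by simp

lemma remainder_bfun:
  assumes W: "bfun a W" and h: "0 < h"
  shows "\<exists>c. bfun c (remainder W h)"
proof -
  note b1 = FK_bfun[OF W one_bfun less_imp_le[OF h]]
  have "bfun (\<bar>1\<bar> * (\<bar>1 / h\<bar> * (exp (a * h) * 1) + \<bar>- 1 / h\<bar> * 1) + \<bar>- 1\<bar> * a)
      (\<lambda>x. 1 * ((1 / h) * FK W h (\<lambda>_. 1) x + (- 1 / h) * 1) + (- 1) * W x)"
    by (rule bfun_lin[OF bfun_lin[OF b1 one_bfun] W])
  moreover have "(\<lambda>x. 1 * ((1 / h) * FK W h (\<lambda>_. 1) x + (- 1 / h) * 1) + (- 1) * W x) = remainder W h"
    by (auto simp: remainder_def diff_divide_distrib)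
  ultimately show ?thesis by metis
qed

lemma remainder_tendsto:
  assumes W: "bfun a W"
  shows "((\<lambda>h. nrm M (remainder W h)) \<longlongrightarrow> 0) (at_right 0)"
proof -
  have "nrm M (\<lambda>x. (FK W h (\<lambda>_. 1) x - U h (\<lambda>_. 1) x) / h - W x * 1) = nrm M (remainder W h)" for h
    by (rule nrm_cong) (simp add: remainder_def M_space U_one)
  with FK_perturbation[OF W one_bfun] show ?thesis by simp
qed

lemma FK_one_increment:
  assumes W: "bfun a W" and t: "0 \<le> t" and h: "0 < h" and x: "x \<in> S"
  shows "FK W (t + h) (\<lambda>_. 1) x
    = FK W t (\<lambda>_. 1) x + h * (FK W t W x + FK W t (remainder W h) x)"
proof -
  obtain c where c: "bfun c (remainder W h)" using remainder_bfun[OF W h] by blast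
  note Wr = bfun_lin[OF W c, of 1 1]
  have "FK W (t + h) (\<lambda>_. 1) x = FK W t (FK W h (\<lambda>_. 1)) x"
    using h by (intro FK_semigroup[OF W one_bfun t _ x]) simp
  also have "\<dots> = FK W t (\<lambda>y. 1 * 1 + h * (1 * W y + 1 * remainder W h y)) x"
    using h t x by (intro FK_cong) (auto simp: remainder_def field_simps)
  also have "\<dots> = 1 * FK W t (\<lambda>_. 1) x + h * FK W t (\<lambda>y. 1 * W y + 1 * remainder W h y) x"
    by (rule FK_lin[OF W one_bfun Wr t x])
  also have "FK W t (\<lambda>y. 1 * W y + 1 * remainder W h y) x = 1 * FK W t W x + 1 * FK W t (remainder W h) x"
    by (rule FK_lin[OF W W c t x])
  finally show ?thesis by simp
qed

text \<open>
  The semigroup law lets an increment of time act from the outside, which gives the time derivative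
  \<open>FK\<^sub>t W\<close>, or from the inside, where it differs from the action of the transition semigroup by \<open>W\<close>.
\<close>

lemma FK_one_generator:
  assumes W: "bfun a W" and t: "0 \<le> t"
  shows "(FK W t (\<lambda>_. 1), \<lambda>x. FK W t W x - W x * FK W t (\<lambda>_. 1) x) \<in> generator M U"
proof -
  define u where "u = FK W t (\<lambda>_. 1)"
  have u: "bfun (exp (a * t) * 1) u" unfolding u_def by (rule FK_bfun[OF W one_bfun t])
  have w: "bfun (exp (a * t) * a) (FK W t W)" by (rule FK_bfun[OF W W t])
  have v: "(\<lambda>x. FK W t W x - W x * u x) \<in> L2_fun M"
    by (intro L2_fun_diff bfun_L2[OF w] bfun_L2[OF bfun_mult[OF W u]])
  let ?f = "\<lambda>h. nrm M (\<lambda>x. (U h u x - u x) / h - (FK W t W x - W x * u x))"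
  let ?p = "\<lambda>h x. (FK W h u x - U h u x) / h - W x * u x"
  have "(?f \<longlongrightarrow> 0) (at_right 0)"
  proof (rule tendsto_sandwich[of "\<lambda>_. 0"])
    show "eventually (\<lambda>h. ?f h \<le> exp (a * t) * nrm M (remainder W h) + nrm M (?p h)) (at_right 0)"
      unfolding eventually_at_right_field
    proof (intro exI[of _ 1] conjI allI impI)
      fix h :: real assume h: "0 < h"
      obtain c where c: "bfun c (remainder W h)" using remainder_bfun[OF W h] by blast
      have rL: "FK W t (remainder W h) \<in> L2_fun M" by (rule bfun_L2[OF FK_bfun[OF W c t]])
      have Uu: "bfun (exp (a * t) * 1) (U h u)" using h by (intro U_bfun[OF u]) simp
      have "(\<lambda>x. (1 / h) * (FK W h u x - U h u x) - W x * u x) \<in> L2_fun M"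
        using h by (intro L2_fun_diff L2_fun_scale bfun_L2[OF FK_bfun[OF W u]] bfun_L2[OF Uu] bfun_L2[OF bfun_mult[OF W u]]) simp
      then have pL: "?p h \<in> L2_fun M" by simp
      have "?f h = nrm M (\<lambda>x. FK W t (remainder W h) x - ?p h x)"
      proof (rule nrm_cong)
        fix x assume "x \<in> space M"
        then have x: "x \<in> S" by (simp add: M_space)
        have "FK W h u x = FK W (t + h) (\<lambda>_. 1) x"
          using FK_semigroup[OF W one_bfun less_imp_le[OF h] t x] by (simp add: u_def add.commute)
        also have "\<dots> = u x + h * (FK W t W x + FK W t (remainder W h) x)"
          unfolding u_def by (rule FK_one_increment[OF W t h x])
        finally show "(U h u x - u x) / h - (FK W t W x - W x * u x) = FK W t (remainder W h) x - ?p h x"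
          using h by (simp add: field_simps)
      qed
      also have "\<dots> \<le> nrm M (FK W t (remainder W h)) + nrm M (?p h)"
        by (rule nrm_diff_le[OF rL pL])
      also have "nrm M (FK W t (remainder W h)) \<le> exp (a * t) * nrm M (remainder W h)"
        by (rule FK_contraction[OF W c t])
      finally show "?f h \<le> exp (a * t) * nrm M (remainder W h) + nrm M (?p h)" by simp
    qed simp
    have "((\<lambda>h. exp (a * t) * nrm M (remainder W h) + nrm M (?p h)) \<longlongrightarrow> exp (a * t) * 0 + 0) (at_right 0)"
      by (intro tendsto_intros remainder_tendsto[OF W] FK_perturbation[OF W u])
    then show "((\<lambda>h. exp (a * t) * nrm M (remainder W h) + nrm M (?p h)) \<longlongrightarrow> 0) (at_right 0)" by simp
  qed auto
  then show ?thesis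
    using bfun_L2[OF u] v by (simp add: generator_def u_def)
qed

end

section \<open>Growth in the modified norm\<close>

locale hypocoercive_markov = stationary_markov S \<Omega> X Pr M + half_contraction M b \<epsilon>
  for S :: "'x::{second_countable_topology, metric_space} set" and \<Omega> :: "'w measure"
    and X :: "real \<Rightarrow> 'w \<Rightarrow> 'x" and Pr :: "'x \<Rightarrow> 'w measure" and M :: "'x measure"
    and b :: "('x \<Rightarrow> real) \<Rightarrow> ('x \<Rightarrow> real)" and \<epsilon> :: real
begin

abbreviation E :: "('x \<Rightarrow> real) \<Rightarrow> ('x \<Rightarrow> real) \<Rightarrow> real" where "E \<equiv> mform M b \<epsilon>"

text \<open>
  The remainder at time \<open>t\<close> is the image under \<open>FK\<^sub>t\<close> of the remainder at time \<open>0\<close>. Hence the differential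
  inequality for \<open>E u\<^sub>t u\<^sub>t\<close> holds in the form of an explicit Euler step, with an error
  that is uniform in time.
\<close>

lemma FK_one_step:
  assumes W: "bfun a W" and \<Psi>: "0 \<le> \<Psi>"
    and dissip: "\<And>g Ag c. (g, Ag) \<in> generator M U \<Longrightarrow> bfun c g \<Longrightarrow>
      E Ag g + E (\<lambda>x. W x * g x) g \<le> \<Psi> * E g g"
    and t: "0 \<le> t" "t \<le> T" and h: "0 < h" "h \<le> e" and e: "e \<le> 1"
    and rem: "nrm M (remainder W h) \<le> e"
  shows "E (FK W (t + h) (\<lambda>_. 1)) (FK W (t + h) (\<lambda>_. 1))
    \<le> (1 + 2 * \<Psi> * h) * E (FK W t (\<lambda>_. 1)) (FK W t (\<lambda>_. 1))
      + h * e * (4 * (exp (a * T))\<^sup>2 + 2 * (exp (a * T) * (a + 1))\<^sup>2)"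
proof -
  define C where "C = exp (a * T)"
  note a0 = bfun_nonneg[OF W]
  obtain c where c: "bfun c (remainder W h)" using remainder_bfun[OF W h(1)] by blast
  define u where "u = FK W t (\<lambda>_. 1)"
  define w where "w = FK W t W"
  define \<rho> where "\<rho> = FK W t (remainder W h)"
  define k where "k = (\<lambda>x. 1 * w x + 1 * \<rho> x)"
  have ub: "bfun (exp (a * t) * 1) u" unfolding u_def by (rule FK_bfun[OF W one_bfun t(1)])
  have uL: "u \<in> L2_fun M" by (rule bfun_L2[OF ub])
  have wL: "w \<in> L2_fun M" unfolding w_def by (rule bfun_L2[OF FK_bfun[OF W W t(1)]])
  have rL: "\<rho> \<in> L2_fun M" unfolding \<rho>_def by (rule bfun_L2[OF FK_bfun[OF W c t(1)]])
  have kL: "k \<in> L2_fun M" unfolding k_def by (rule L2_fun_lin[OF wL rL])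
  have WuL: "(\<lambda>x. W x * u x) \<in> L2_fun M" by (rule bfun_L2[OF bfun_mult[OF W ub]])
  have C: "exp (a * t) \<le> C" "0 \<le> C" using t a0 by (auto simp: C_def intro: mult_left_mono)
  have nu: "nrm M u \<le> C"
    using FK_contraction[OF W one_bfun t(1)] C by (simp add: u_def nrm_one)
  have nw: "nrm M w \<le> C * a"
  proof -
    have "nrm M w \<le> exp (a * t) * nrm M W" unfolding w_def by (rule FK_contraction[OF W W t(1)])
    also have "nrm M W \<le> a"
      using bfun_bound[OF W] by (intro nrm_bounded M_measurable bfun_measurable[OF W]) (simp add: M_space)
    also have "exp (a * t) * a \<le> C * a" using C a0 by (intro mult_right_mono)
    finally show ?thesis by simp
  qed
  have nr: "nrm M \<rho> \<le> C * e"
  proof -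
    have "nrm M \<rho> \<le> exp (a * t) * nrm M (remainder W h)" unfolding \<rho>_def by (rule FK_contraction[OF W c t(1)])
    also have "\<dots> \<le> C * e" using C rem by (intro mult_mono) auto
    finally show ?thesis .
  qed
  have nk: "nrm M k \<le> C * (a + 1)"
  proof -
    have "nrm M k \<le> \<bar>1\<bar> * nrm M w + \<bar>1\<bar> * nrm M \<rho>" unfolding k_def by (rule nrm_lin_le[OF wL rL])
    also have "\<dots> \<le> C * a + C * e" using nw nr by simp
    also have "\<dots> \<le> C * (a + 1)" using e C mult_left_mono[OF e C(2)] by (simp add: distrib_left)
    finally show ?thesis .
  qed
  have Ewu: "E w u \<le> \<Psi> * E u u"
  proof -
    have gen: "(u, \<lambda>x. w x - W x * u x) \<in> generator M U"
      unfolding u_def w_def by (rule FK_one_generator[OF W t(1)])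
    have vL: "(\<lambda>x. w x - W x * u x) \<in> L2_fun M" by (rule L2_fun_diff[OF wL WuL])
    have "E (\<lambda>x. 1 * (w x - W x * u x) + 1 * (W x * u x)) u = 1 * E (\<lambda>x. w x - W x * u x) u + 1 * E (\<lambda>x. W x * u x) u"
      by (rule mform_lin_left[OF vL WuL uL])
    then show ?thesis using dissip[OF gen ub] by simp
  qed
  have Eru: "E \<rho> u \<le> 2 * (C * e * C)"
  proof -
    have "E \<rho> u \<le> (1 + \<epsilon>) * (nrm M \<rho> * nrm M u)" using mform_bound[OF rL uL] by linarith
    also have "\<dots> \<le> 2 * (C * e * C)" using eps nr nu C h by (intro mult_mono) auto
    finally show ?thesis .
  qed
  have Ekk: "E k k \<le> 2 * (C * (a + 1))\<^sup>2"
  proof -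
    have "E k k \<le> (1 + \<epsilon>) * (nrm M k * nrm M k)" using mform_bound[OF kL kL] by linarith
    also have "\<dots> \<le> 2 * (C * (a + 1) * (C * (a + 1)))" using eps nk C a0 by (intro mult_mono) auto
    finally show ?thesis by (simp add: power2_eq_square)
  qed
  define z where "z = FK W (t + h) (\<lambda>_. 1)"
  have zL: "z \<in> L2_fun M" unfolding z_def using t h by (intro bfun_L2[OF FK_bfun[OF W one_bfun]]) simp
  have sL: "(\<lambda>x. 1 * u x + h * k x) \<in> L2_fun M" by (rule L2_fun_lin[OF uL kL])
  have zae: "AE x in M. z x = 1 * u x + h * k x"
    using FK_one_increment[OF W t(1) h(1)] by (intro AE_I2) (simp add: M_space z_def u_def k_def w_def \<rho>_def)
  have "E z z = E (\<lambda>x. 1 * u x + h * k x) z" by (rule mform_cong_AE_left[OF zL sL zae zL])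
  also have "\<dots> = E z (\<lambda>x. 1 * u x + h * k x)" by (rule mform_commute)
  also have "\<dots> = E (\<lambda>x. 1 * u x + h * k x) (\<lambda>x. 1 * u x + h * k x)"
    by (rule mform_cong_AE_left[OF zL sL zae sL])
  also have "\<dots> = 1 * E u (\<lambda>x. 1 * u x + h * k x) + h * E k (\<lambda>x. 1 * u x + h * k x)"
    by (rule mform_lin_left[OF uL kL sL])
  also have "E u (\<lambda>x. 1 * u x + h * k x) = 1 * E u u + h * E u k" by (rule mform_lin_right[OF uL kL uL])
  also have "E k (\<lambda>x. 1 * u x + h * k x) = 1 * E k u + h * E k k" by (rule mform_lin_right[OF uL kL kL])
  also have "E u k = E k u" by (rule mform_commute)
  also have "E k u = 1 * E w u + 1 * E \<rho> u" unfolding k_def by (rule mform_lin_left[OF wL rL uL])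
  finally have "E z z = E u u + h * (2 * (E w u + E \<rho> u) + h * E k k)" by (simp add: algebra_simps)
  also have "\<dots> \<le> E u u + h * (2 * (\<Psi> * E u u + 2 * (C * e * C)) + e * (2 * (C * (a + 1))\<^sup>2))"
  proof -
    have "h * E k k \<le> e * (2 * (C * (a + 1))\<^sup>2)"
      using Ekk h mform_self_nonneg[OF kL] by (intro mult_mono) auto
    then show ?thesis using Ewu Eru h by (intro add_left_mono mult_left_mono add_mono) auto
  qed
  also have "\<dots> = (1 + 2 * \<Psi> * h) * E u u + h * e * (4 * C\<^sup>2 + 2 * (C * (a + 1))\<^sup>2)"
    by (simp add: power2_eq_square algebra_simps)
  finally show ?thesis by (simp add: z_def u_def C_def)
qed

text \<open>
  Take \<open>n\<close> steps of length \<open>T / n\<close>. The errors add up to a multiple of \<open>T e\<close>, and \<open>e\<close> is arbitrary.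
\<close>

lemma FK_one_growth:
  assumes W: "bfun a W" and \<Psi>: "0 \<le> \<Psi>" and T: "0 < T"
    and dissip: "\<And>g Ag c. (g, Ag) \<in> generator M U \<Longrightarrow> bfun c g \<Longrightarrow>
      E Ag g + E (\<lambda>x. W x * g x) g \<le> \<Psi> * E g g"
  shows "E (FK W T (\<lambda>_. 1)) (FK W T (\<lambda>_. 1)) \<le> exp (2 * \<Psi> * T)"
proof -
  define y where "y t = E (FK W t (\<lambda>_. 1)) (FK W t (\<lambda>_. 1))" for t
  define D where "D = 4 * (exp (a * T))\<^sup>2 + 2 * (exp (a * T) * (a + 1))\<^sup>2"
  have D0: "0 \<le> D" by (simp add: D_def)
  have y0: "y 0 = 1"
  proof -
    have L: "FK W 0 (\<lambda>_. 1) \<in> L2_fun M" by (rule bfun_L2[OF FK_bfun[OF W one_bfun]]) simp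
    have ae: "AE x in M. FK W 0 (\<lambda>_. 1) x = 1"
      by (intro AE_I2) (simp add: M_space FK_zero)
    have "y 0 = E (\<lambda>_. 1) (FK W 0 (\<lambda>_. 1))" unfolding y_def by (rule mform_cong_AE_left[OF L L2_one ae L])
    also have "\<dots> = E (FK W 0 (\<lambda>_. 1)) (\<lambda>_. 1)" by (rule mform_commute)
    also have "\<dots> = E (\<lambda>_. 1) (\<lambda>_. 1)" by (rule mform_cong_AE_left[OF L L2_one ae L2_one])
    also have "\<dots> = 1" using mform_one[OF L2_one] by (simp add: prob_space)
    finally show ?thesis .
  qed
  have key: "y T \<le> exp (2 * \<Psi> * T) * (1 + T * e * D)" if e: "0 < e" "e \<le> 1" for e
  proof -
    have "eventually (\<lambda>h. nrm M (remainder W h) < e) (at_right 0)"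
      using remainder_tendsto[OF W] e(1) by (rule order_tendstoD)
    then obtain h0 where h0: "0 < h0" "\<And>h. 0 < h \<Longrightarrow> h < h0 \<Longrightarrow> nrm M (remainder W h) < e"
      unfolding eventually_at_right_field by blast
    obtain n :: nat where n: "T / min h0 e < real n" using reals_Archimedean2 by blast
    define h where "h = T / real n"
    have n0: "0 < real n" using n T h0(1) e(1) by (smt (verit) divide_pos_pos)
    have m: "0 < min h0 e" using h0(1) e(1) by simp
    have "T < real n * min h0 e" using n m by (simp only: pos_divide_less_eq)
    then have "h < min h0 e" using n0 by (simp only: h_def pos_divide_less_eq mult.commute)
    then have h: "0 < h" "h < h0" "h \<le> e" "real n * h = T"
      using n0 T by (auto simp: h_def)
    have "y (real k * h) \<le> exp (2 * \<Psi> * (real k * h)) * (1 + real k * h * e * D)" if "k \<le> n" for k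
      using that
    proof (induction k)
      case 0
      then show ?case by (simp add: y0)
    next
      case (Suc k)
      have tk: "0 \<le> real k * h" "real k * h \<le> T"
        using h Suc.prems mult_right_mono[of "real k" "real n" h] by auto
      have "y (real (Suc k) * h) = y (real k * h + h)" by (simp add: algebra_simps)
      also have "\<dots> \<le> (1 + 2 * \<Psi> * h) * y (real k * h) + h * e * D"
        unfolding y_def D_def using h tk e h0(2)[OF h(1,2)]
        by (intro FK_one_step[OF W \<Psi> dissip]) auto
      also have "\<dots> \<le> exp (2 * \<Psi> * h) * (exp (2 * \<Psi> * (real k * h)) * (1 + real k * h * e * D))
          + exp (2 * \<Psi> * (real (Suc k) * h)) * (h * e * D)"
      proof (rule add_mono, rule mult_mono)
        show "1 + 2 * \<Psi> * h \<le> exp (2 * \<Psi> * h)" by (rule exp_ge_add_one_self)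
        show "y (real k * h) \<le> exp (2 * \<Psi> * (real k * h)) * (1 + real k * h * e * D)"
          using Suc by simp
        show "0 \<le> y (real k * h)"
          unfolding y_def by (intro mform_self_nonneg bfun_L2[OF FK_bfun[OF W one_bfun tk(1)]])
        have "1 * (h * e * D) \<le> exp (2 * \<Psi> * (real (Suc k) * h)) * (h * e * D)"
          using h(1) e D0 \<Psi> by (intro mult_right_mono) auto
        then show "h * e * D \<le> exp (2 * \<Psi> * (real (Suc k) * h)) * (h * e * D)" by simp
      qed simp
      also have "\<dots> = exp (2 * \<Psi> * (real (Suc k) * h)) * (1 + real (Suc k) * h * e * D)"
      proof -
        have e1: "exp (2 * \<Psi> * h) * (exp (2 * \<Psi> * (real k * h)) * x) = exp (2 * \<Psi> * (real (Suc k) * h)) * x" for x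
          by (simp add: exp_add[symmetric] distrib_left distrib_right)
        have e2: "c * (1 + real k * h * e * D) + c * (h * e * D) = c * (1 + real (Suc k) * h * e * D)" for c
          by (simp add: algebra_simps)
        show ?thesis unfolding e1 e2 ..
      qed
      finally show ?case .
    qed
    from this[of n] show ?thesis using h by simp
  qed
  have "((\<lambda>e. exp (2 * \<Psi> * T) * (1 + T * e * D)) \<longlongrightarrow> exp (2 * \<Psi> * T) * (1 + T * 0 * D)) (at_right 0)"
    by (intro tendsto_intros)
  moreover have "eventually (\<lambda>e. y T \<le> exp (2 * \<Psi> * T) * (1 + T * e * D)) (at_right 0)"
    unfolding eventually_at_right_field using key by (intro exI[of _ 1]) auto
  ultimately have "y T \<le> exp (2 * \<Psi> * T) * (1 + T * 0 * D)"
    by (intro tendsto_lowerbound) auto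
  then show ?thesis by (simp add: y_def)
qed

end

section \<open>Exponential moments and deviations of time averages\<close>

text \<open>
  For \<open>v > 0\<close> the optimal parameter is \<open>s / (1 + b s)\<close> with \<open>s = sqrt (2 \<eta> / v)\<close>; the exponent is then exactly \<open>- \<eta>\<close>
  if \<open>v' = v\<close> and \<open>b' = b\<close>. For \<open>v = 0\<close> the optimum is the endpoint \<open>1 / b\<close>, which is admissible because \<open>b' < b\<close>.
\<close>

lemma Bernstein_exponent:
  fixes v v' b b' \<eta> :: real
  assumes "0 < b" "b' < b" "0 \<le> v'" "v' \<le> v" "0 < \<eta>"
  obtains lam where "0 < lam" "lam * b' < 1"
    "lam\<^sup>2 * v' / (2 * (1 - lam * b')) - lam * (sqrt (2 * v * \<eta>) + b * \<eta>) \<le> - \<eta>"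
proof (cases "v = 0")
  case True
  then have "v' = 0" using assms by simp
  then show thesis using assms True by (intro that[of "1 / b"]) auto
next
  case False
  then have v: "0 < v" using assms by simp
  define s where "s = sqrt (2 * \<eta> / v)"
  define lam where "lam = s / (1 + b * s)"
  have s: "0 < s" using v assms by (simp add: s_def)
  have s2: "s\<^sup>2 * v = 2 * \<eta>" using v assms by (simp add: s_def)
  have bs: "0 < 1 + b * s" using s assms by (simp add: add_pos_pos)
  have lam: "0 < lam" using s bs by (simp add: lam_def)
  have lamb: "1 - lam * b = 1 / (1 + b * s)" using bs by (simp add: lam_def field_simps)
  have le: "lam * b' \<le> lam * b" using assms lam by simp
  have pos: "0 < 1 - lam * b" using lamb bs by simp
  have "sqrt (2 * v * \<eta>) = sqrt ((s * v)\<^sup>2)"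
    using s2 by (simp add: power2_eq_square algebra_simps)
  then have root: "sqrt (2 * v * \<eta>) = s * v" using s v by simp
  have "lam\<^sup>2 * v' / (2 * (1 - lam * b')) \<le> lam\<^sup>2 * v / (2 * (1 - lam * b))"
    using assms pos le lam by (intro frac_le mult_left_mono mult_nonneg_nonneg) auto
  also have "\<dots> = lam * (lam * (1 + b * s)) * v / 2"
    unfolding lamb by (simp add: power2_eq_square)
  also have "lam * (1 + b * s) = s" using bs by (simp add: lam_def)
  finally have "lam\<^sup>2 * v' / (2 * (1 - lam * b')) - lam * (s * v + b * \<eta>) \<le> lam * s * v / 2 - lam * (s * v + b * \<eta>)"
    by simp
  also have "\<dots> = - (lam * (s * v / 2 + b * \<eta>))" by (simp add: algebra_simps)
  also have "s * v / 2 + b * \<eta> = (s * v / 2) * (1 + b * s)"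
    using s2 by (simp add: power2_eq_square algebra_simps)
  also have "lam * ((s * v / 2) * (1 + b * s)) = (lam * (1 + b * s)) * (s * v / 2)" by simp
  also have "lam * (1 + b * s) = s" using bs by (simp add: lam_def)
  also have "s * (s * v / 2) = \<eta>" using s2 by (simp add: power2_eq_square)
  finally have "lam\<^sup>2 * v' / (2 * (1 - lam * b')) - lam * (sqrt (2 * v * \<eta>) + b * \<eta>) \<le> - \<eta>"
    by (simp only: root)
  moreover have "lam * b' < 1" using le pos by linarith
  ultimately show thesis using lam by (intro that[of lam])
qed

context stationary_markov
begin

lemma path_law_prob:
  assumes \<mu>: "prob_space \<mu>" "sets \<mu> = sets N"
  shows "prob_space (\<mu> \<bind> Pr)" "sets (\<mu> \<bind> Pr) = sets \<Omega>" "Pr \<in> measurable \<mu> (subprob_algebra \<Omega>)"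
proof -
  interpret \<mu>: prob_space \<mu> by fact
  have sp: "space \<mu> = S" using sets_eq_imp_space_eq[OF \<mu>(2)] by (simp add: space_restrict_space)
  show P: "Pr \<in> measurable \<mu> (subprob_algebra \<Omega>)"
    using measurable_prob_algebraD[OF Pr_measurable] \<mu>(2) by (simp cong: measurable_cong_sets)
  show "prob_space (\<mu> \<bind> Pr)"
    by (intro \<mu>.prob_space_bind[OF _ P] AE_I2 Pr_prob) (simp add: sp)
  show "sets (\<mu> \<bind> Pr) = sets \<Omega>"
    by (rule sets_bind_measurable[OF P \<mu>.not_empty])
qed

text \<open>
  Change the initial law from \<open>\<mu>\<close> to \<open>M\<close> and apply the Cauchy--Schwarz inequality.
\<close>

lemma exponential_moment:
  assumes \<mu>: "prob_space \<mu>" "sets \<mu> = sets N" and ac: "absolutely_continuous M \<mu>"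
    and dens: "(\<lambda>x. enn2real (RN_deriv M \<mu> x)) \<in> L2_fun M"
    and W: "bfun a W" and T: "0 \<le> T"
  shows "(\<integral>\<^sup>+\<omega>. ennreal (exp (acc W T \<omega>)) \<partial>(\<mu> \<bind> Pr))
    \<le> ennreal (nrm M (\<lambda>x. enn2real (RN_deriv M \<mu> x)) * nrm M (FK W T (\<lambda>_. 1)))"
proof -
  interpret \<mu>: prob_space \<mu> by fact
  have sp: "space \<mu> = S" using sets_eq_imp_space_eq[OF \<mu>(2)] by (simp add: space_restrict_space)
  define u where "u = FK W T (\<lambda>_. 1)"
  have ub: "bfun (exp (a * T) * 1) u" unfolding u_def by (rule FK_bfun[OF W one_bfun T])
  have acm: "(\<lambda>\<omega>. exp (acc W T \<omega>)) \<in> borel_measurable \<Omega>"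
    using FK_integrand(1)[OF W one_bfun T] by simp
  have u0: "0 \<le> u x" for x unfolding u_def FK_def by simp
  have um: "u \<in> borel_measurable \<mu>" using bfun_measurable[OF ub] \<mu>(2) by (simp cong: measurable_cong_sets)
  have "(\<integral>\<^sup>+\<omega>. ennreal (exp (acc W T \<omega>)) \<partial>(\<mu> \<bind> Pr)) = (\<integral>\<^sup>+x. \<integral>\<^sup>+\<omega>. ennreal (exp (acc W T \<omega>)) \<partial>Pr x \<partial>\<mu>)"
    using acm by (intro nn_integral_bind[OF _ path_law_prob(3)[OF \<mu>]]) simp
  also have "\<dots> = (\<integral>\<^sup>+x. ennreal (u x) \<partial>\<mu>)"
  proof (rule nn_integral_cong)
    fix x assume "x \<in> space \<mu>"
    then have x: "x \<in> S" by (simp add: sp)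
    show "(\<integral>\<^sup>+\<omega>. ennreal (exp (acc W T \<omega>)) \<partial>Pr x) = ennreal (u x)"
      using integrable_Pr[OF x FK_integrand[OF W one_bfun T]]
      by (simp add: u_def FK_def nn_integral_eq_integral)
  qed
  also have "\<dots> = ennreal (LINT x|\<mu>. u x)"
  proof (rule nn_integral_eq_integral)
    show "integrable \<mu> u"
      using bfun_bound[OF ub] um by (intro \<mu>.integrable_const_bound[of _ "exp (a * T) * 1"]) (auto simp: sp intro!: AE_I2)
  qed (simp add: u0)
  also have "(LINT x|\<mu>. u x) = (LINT x|M. enn2real (RN_deriv M \<mu> x) * u x)"
    using \<mu>(2) M_sets M_measurable[OF bfun_measurable[OF ub]]
    by (intro RN_deriv_integral[OF \<mu>.sigma_finite_measure_axioms ac]) auto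
  also have "\<dots> \<le> nrm M (\<lambda>x. enn2real (RN_deriv M \<mu> x)) * nrm M u"
    using ip_Cauchy_Schwarz[OF dens bfun_L2[OF ub]] by (simp add: ip_def)
  finally show ?thesis by (simp add: u_def ennreal_leI)
qed

lemma nrm_density_ge_one:
  assumes \<mu>: "prob_space \<mu>" "sets \<mu> = sets N" and ac: "absolutely_continuous M \<mu>"
    and dens: "(\<lambda>x. enn2real (RN_deriv M \<mu> x)) \<in> L2_fun M"
  shows "1 \<le> nrm M (\<lambda>x. enn2real (RN_deriv M \<mu> x))"
proof -
  interpret \<mu>: prob_space \<mu> by fact
  have "1 = (LINT x|\<mu>. 1::real)" by (simp add: \<mu>.prob_space)
  also have "\<dots> = (LINT x|M. enn2real (RN_deriv M \<mu> x) * 1)"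
    using \<mu>(2) M_sets by (intro RN_deriv_integral[OF \<mu>.sigma_finite_measure_axioms ac]) auto
  also have "\<dots> \<le> nrm M (\<lambda>x. enn2real (RN_deriv M \<mu> x)) * nrm M (\<lambda>_. 1)"
    using ip_Cauchy_Schwarz[OF dens bfun_L2[OF one_bfun]] by (simp add: ip_def)
  finally show ?thesis by (simp add: nrm_one)
qed

lemma acc_measurable:
  assumes f: "bfun c f"
  shows "acc f T \<in> borel_measurable \<Omega>"
  using acc_comp_measurable[OF bfun_measurable[OF f], of "\<lambda>_. T" \<Omega> "\<lambda>\<omega>. \<omega>"] by simp

lemma Chernoff_bound:
  assumes \<mu>: "prob_space \<mu>" "sets \<mu> = sets N" and ac: "absolutely_continuous M \<mu>"
    and dens: "(\<lambda>x. enn2real (RN_deriv M \<mu> x)) \<in> L2_fun M"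
    and f: "bfun F f" and T: "0 \<le> T" and lam: "0 \<le> lam"
  shows "measure (\<mu> \<bind> Pr) {\<omega> \<in> space \<Omega>. l \<le> acc f T \<omega>}
    \<le> exp (- (lam * l)) * (nrm M (\<lambda>x. enn2real (RN_deriv M \<mu> x)) * nrm M (FK (\<lambda>x. lam * f x) T (\<lambda>_. 1)))"
proof -
  let ?P = "\<mu> \<bind> Pr" and ?A = "{\<omega> \<in> space \<Omega>. l \<le> acc f T \<omega>}" and ?W = "\<lambda>x. lam * f x"
  let ?K = "nrm M (\<lambda>x. enn2real (RN_deriv M \<mu> x)) * nrm M (FK ?W T (\<lambda>_. 1))"
  interpret P: prob_space ?P by (rule path_law_prob(1)[OF \<mu>])
  note setsP = path_law_prob(2)[OF \<mu>]
  have W: "bfun (lam * F) ?W" using bfun_lin[OF f f, of lam 0] lam by simp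
  have acc_W: "acc ?W T \<omega> = lam * acc f T \<omega>" for \<omega> by (simp add: acc_def)
  have A: "?A \<in> sets ?P"
    unfolding setsP using acc_measurable[OF f, of T] by measurable
  have em: "(\<lambda>\<omega>. ennreal (exp (acc ?W T \<omega>))) \<in> borel_measurable ?P"
    using acc_measurable[OF W, of T] setsP by (simp cong: measurable_cong_sets)
  have "emeasure ?P ?A = (\<integral>\<^sup>+\<omega>. indicator ?A \<omega> \<partial>?P)" using A by simp
  also have "\<dots> \<le> (\<integral>\<^sup>+\<omega>. ennreal (exp (- (lam * l))) * ennreal (exp (acc ?W T \<omega>)) \<partial>?P)"
  proof (rule nn_integral_mono)
    fix \<omega>
    show "indicator ?A \<omega> \<le> ennreal (exp (- (lam * l))) * ennreal (exp (acc ?W T \<omega>))"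
    proof (cases "\<omega> \<in> ?A")
      case True
      then have "lam * l \<le> acc ?W T \<omega>" using lam by (simp add: acc_W mult_left_mono)
      then have "1 \<le> exp (- (lam * l)) * exp (acc ?W T \<omega>)" by (simp add: exp_add[symmetric])
      then have "ennreal 1 \<le> ennreal (exp (- (lam * l)) * exp (acc ?W T \<omega>))" by (rule ennreal_leI)
      then show ?thesis using True by (simp add: ennreal_mult)
    qed simp
  qed
  also have "\<dots> = ennreal (exp (- (lam * l))) * (\<integral>\<^sup>+\<omega>. ennreal (exp (acc ?W T \<omega>)) \<partial>?P)"
    by (rule nn_integral_cmult[OF em])
  also have "\<dots> \<le> ennreal (exp (- (lam * l))) * ennreal ?K"
    by (intro mult_left_mono exponential_moment[OF \<mu> ac dens W T]) simp
  also have "\<dots> = ennreal (exp (- (lam * l)) * ?K)" by (simp add: ennreal_mult)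
  finally have "ennreal (measure ?P ?A) \<le> ennreal (exp (- (lam * l)) * ?K)"
    by (simp add: P.emeasure_eq_measure)
  then show ?thesis by (subst (asm) ennreal_le_iff) auto
qed

end

context hypocoercive_markov
begin

text \<open>
  The growth estimate produces the constants \<open>v'\<close> and \<open>b'\<close> of the proof, which do not exceed \<open>v\<close> and \<open>bb\<close>.
  The strict inequality \<open>b' < bb\<close> covers functions \<open>f\<close> that vanish almost everywhere but not identically.
\<close>

lemma Bernstein_one_sided:
  assumes hyp: "\<And>g Ag. (g, Ag) \<in> generator M U \<Longrightarrow> \<Lambda> * variance g \<le> E (\<lambda>x. - Ag x) g"
    and \<Lambda>: "0 < \<Lambda>" and f: "bfun F f" and F: "0 < F" and mean: "(LINT x|M. f x) = 0"
    and \<mu>: "prob_space \<mu>" "sets \<mu> = sets N" and ac: "absolutely_continuous M \<mu>"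
    and dens: "(\<lambda>x. enn2real (RN_deriv M \<mu> x)) \<in> L2_fun M"
    and T: "0 < T" and \<eta>: "0 < \<eta>"
    and v: "v = (1 + \<epsilon>) * (1 - \<epsilon>\<^sup>2 / 4) / (1 - \<epsilon>) * (2 * (nrm M f)\<^sup>2 / \<Lambda>)"
    and b: "bb = (1 + \<epsilon>)\<^sup>2 / (1 - \<epsilon>) * (F / \<Lambda>)"
  shows "measure (\<mu> \<bind> Pr) {\<omega> \<in> space \<Omega>. T * (sqrt (2 * v * \<eta>) + bb * \<eta>) \<le> acc f T \<omega>}
    \<le> 1 / sqrt (1 - \<epsilon>) * nrm M (\<lambda>x. enn2real (RN_deriv M \<mu> x)) * exp (- (\<eta> * T))"
proof -
  define v' where "v' = (1 + \<epsilon> / 2)\<^sup>2 * (2 * (nrm M f)\<^sup>2 / \<Lambda>)"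
  define b' where "b' = (1 + \<epsilon>) * (F / \<Lambda>)"
  have vv: "v' \<le> v"
  proof -
    have "(1 + \<epsilon> / 2) * (1 - \<epsilon>) \<le> (1 + \<epsilon>) * (1 - \<epsilon> / 2)"
    proof -
      have "(1 + \<epsilon>) * (1 - \<epsilon> / 2) - (1 + \<epsilon> / 2) * (1 - \<epsilon>) = \<epsilon>" by (simp add: field_simps)
      then show ?thesis using eps by linarith
    qed
    then have "(1 + \<epsilon> / 2) * ((1 + \<epsilon> / 2) * (1 - \<epsilon>)) \<le> (1 + \<epsilon> / 2) * ((1 + \<epsilon>) * (1 - \<epsilon> / 2))"
      using eps by (intro mult_left_mono) auto
    moreover have "(1 + \<epsilon> / 2) * ((1 + \<epsilon>) * (1 - \<epsilon> / 2)) = (1 + \<epsilon>) * (1 - \<epsilon>\<^sup>2 / 4)"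
      by (simp add: power2_eq_square field_simps)
    ultimately have "(1 + \<epsilon> / 2)\<^sup>2 * (1 - \<epsilon>) \<le> (1 + \<epsilon>) * (1 - \<epsilon>\<^sup>2 / 4)"
      by (simp add: power2_eq_square mult.assoc)
    then have "(1 + \<epsilon> / 2)\<^sup>2 \<le> (1 + \<epsilon>) * (1 - \<epsilon>\<^sup>2 / 4) / (1 - \<epsilon>)" using eps by (simp add: pos_le_divide_eq)
    then show ?thesis unfolding v v'_def using \<Lambda> by (intro mult_right_mono) auto
  qed
  have bb: "b' < bb" "0 < bb"
  proof -
    have "(1 + \<epsilon>) * 1 < (1 + \<epsilon>) * ((1 + \<epsilon>) / (1 - \<epsilon>))" using eps by (intro mult_strict_left_mono) (auto simp: field_simps)
    then have "1 + \<epsilon> < (1 + \<epsilon>)\<^sup>2 / (1 - \<epsilon>)" by (simp add: power2_eq_square)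
    then show "b' < bb" unfolding b b'_def using F \<Lambda> by (intro mult_strict_right_mono) auto
    moreover have "0 < b'" using F \<Lambda> eps by (simp add: b'_def)
    ultimately show "0 < bb" by simp
  qed
  obtain lam where lam: "0 < lam" "lam * b' < 1"
    and rate: "lam\<^sup>2 * v' / (2 * (1 - lam * b')) - lam * (sqrt (2 * v * \<eta>) + bb * \<eta>) \<le> - \<eta>"
    using Bernstein_exponent[OF bb(2,1) _ vv \<eta>] \<Lambda> v'_def by auto
  define \<Psi> where "\<Psi> = (lam * (1 + \<epsilon> / 2) * nrm M f)\<^sup>2 / (\<Lambda> - lam * (1 + \<epsilon>) * F)"
  have lamF: "lam * (1 + \<epsilon>) * F < \<Lambda>" using lam(2) \<Lambda> by (simp add: b'_def field_simps)
  have \<Psi>0: "0 \<le> \<Psi>" using lamF by (simp add: \<Psi>_def)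
  have \<Psi>_eq: "\<Psi> = lam\<^sup>2 * v' / (2 * (1 - lam * b'))"
  proof -
    have "\<Lambda> - lam * (1 + \<epsilon>) * F = \<Lambda> * (1 - lam * b')" using \<Lambda> by (simp add: b'_def field_simps)
    moreover have "(lam * (1 + \<epsilon> / 2) * nrm M f)\<^sup>2 = \<Lambda> * (lam\<^sup>2 * v' / 2)"
      using \<Lambda> by (simp add: v'_def power_mult_distrib)
    ultimately have "\<Psi> = \<Lambda> * (lam\<^sup>2 * v' / 2) / (\<Lambda> * (1 - lam * b'))" by (simp only: \<Psi>_def)
    also have "\<dots> = (lam\<^sup>2 * v' / 2) / (1 - lam * b')" using \<Lambda> by (intro mult_divide_mult_cancel_left) simp
    finally show ?thesis by simp
  qed
  define W where "W = (\<lambda>x. lam * f x)"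
  have W: "bfun (lam * F) W" using bfun_lin[OF f f, of lam 0] lam by (simp add: W_def)
  define u where "u = FK W T (\<lambda>_. 1)"
  have uL: "u \<in> L2_fun M" unfolding u_def by (rule bfun_L2[OF FK_bfun[OF W one_bfun]]) (use T in simp)
  have growth: "E u u \<le> exp (2 * \<Psi> * T)"
    unfolding u_def
  proof (rule FK_one_growth[OF W \<Psi>0 T])
    fix g Ag c assume gen: "(g, Ag) \<in> generator M U" and g: "bfun c g"
    have L: "g \<in> L2_fun M" "Ag \<in> L2_fun M" using gen by (auto simp: generator_def)
    have fgL: "(\<lambda>x. f x * g x) \<in> L2_fun M" by (rule bfun_L2[OF bfun_mult[OF f g]])
    have "E (\<lambda>x. (-1) * Ag x + 0 * Ag x) g = (-1) * E Ag g + 0 * E Ag g"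
      by (rule mform_lin_left[OF L(2,2,1)])
    with hyp[OF gen] have 1: "E Ag g \<le> - (\<Lambda> * variance g)" by simp
    have "E (\<lambda>x. lam * (f x * g x) + 0 * (f x * g x)) g = lam * E (\<lambda>x. f x * g x) g + 0 * E (\<lambda>x. f x * g x) g"
      by (rule mform_lin_left[OF fgL fgL L(1)])
    then have 2: "E (\<lambda>x. W x * g x) g = lam * E (\<lambda>x. f x * g x) g" by (simp add: W_def mult.assoc)
    have "lam * E (\<lambda>x. f x * g x) g - \<Lambda> * variance g \<le> \<Psi> * E g g"
      unfolding \<Psi>_def using bfun_bound[OF f] lam lamF
      by (intro mform_potential_bound[OF M_measurable[OF bfun_measurable[OF f]] _ mean L(1)]) (auto simp: M_space)
    then show "E Ag g + E (\<lambda>x. W x * g x) g \<le> \<Psi> * E g g" using 1 2 by simp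
  qed
  have nu: "nrm M u \<le> 1 / sqrt (1 - \<epsilon>) * exp (\<Psi> * T)"
  proof -
    have "(1 - \<epsilon>) * (nrm M u)\<^sup>2 \<le> exp (2 * \<Psi> * T)" using mform_self_ge[OF uL] growth by linarith
    also have "\<dots> = (exp (\<Psi> * T))\<^sup>2" by (simp add: power2_eq_square exp_add[symmetric])
    finally have "(sqrt (1 - \<epsilon>) * nrm M u)\<^sup>2 \<le> (exp (\<Psi> * T))\<^sup>2"
      using eps by (simp add: power_mult_distrib)
    then have "sqrt (1 - \<epsilon>) * nrm M u \<le> exp (\<Psi> * T)" by (rule power2_le_imp_le) simp
    then show ?thesis using eps by (simp add: field_simps)
  qed
  define K where "K = nrm M (\<lambda>x. enn2real (RN_deriv M \<mu> x))"
  define r where "r = sqrt (2 * v * \<eta>) + bb * \<eta>"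
  have K0: "0 \<le> K" by (simp add: K_def)
  have "measure (\<mu> \<bind> Pr) {\<omega> \<in> space \<Omega>. T * r \<le> acc f T \<omega>} \<le> exp (- (lam * (T * r))) * (K * nrm M u)"
    unfolding u_def W_def K_def using T lam by (intro Chernoff_bound[OF \<mu> ac dens f]) auto
  also have "\<dots> \<le> exp (- (lam * (T * r))) * (K * (1 / sqrt (1 - \<epsilon>) * exp (\<Psi> * T)))"
    using nu K0 by (intro mult_left_mono) auto
  also have "\<dots> = 1 / sqrt (1 - \<epsilon>) * K * exp ((\<Psi> - lam * r) * T)"
    by (simp add: left_diff_distrib exp_diff exp_minus field_simps)
  also have "\<dots> \<le> 1 / sqrt (1 - \<epsilon>) * K * exp (- (\<eta> * T))"
  proof -
    have "(\<Psi> - lam * r) * T \<le> (- \<eta>) * T"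
      using rate T by (intro mult_right_mono) (auto simp: \<Psi>_eq r_def)
    then show ?thesis using K0 eps by (intro mult_left_mono) auto
  qed
  finally show ?thesis by (simp add: r_def K_def)
qed

end

section \<open>Phase space, operator and rate of the model\<close>

lemma sets_restrict_borel_pair:
  fixes Q :: "'a::second_countable_topology set" and P :: "'b::second_countable_topology set"
  shows "sets (restrict_space borel Q \<Otimes>\<^sub>M restrict_space borel P) = sets (restrict_space borel (Q \<times> P))"
proof (rule antisym)
  let ?Q = "restrict_space borel Q" and ?P = "restrict_space borel P" and ?QP = "restrict_space borel (Q \<times> P)"
  have "sets (?Q \<Otimes>\<^sub>M ?P) = sigma_sets (space ?QP) {a \<times> b |a b. a \<in> sets ?Q \<and> b \<in> sets ?P}"
    by (simp add: sets_pair_measure space_restrict_space)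
  also have "\<dots> \<subseteq> sets ?QP"
  proof (rule sets.sigma_sets_subset, clarify)
    fix a b assume "a \<in> sets ?Q" "b \<in> sets ?P"
    then obtain a' b' where "a' \<in> sets borel" "b' \<in> sets borel" "a = Q \<inter> a'" "b = P \<inter> b'"
      by (auto simp: sets_restrict_space)
    then have "a \<times> b = (Q \<times> P) \<inter> (a' \<times> b')" "a' \<times> b' \<in> sets (borel :: ('a \<times> 'b) measure)"
      by (auto simp: borel_prod[symmetric])
    then show "a \<times> b \<in> sets ?QP" by (auto simp: sets_restrict_space)
  qed
  finally show "sets (?Q \<Otimes>\<^sub>M ?P) \<subseteq> sets ?QP" .
  have "(\<lambda>z. (fst z, snd z)) \<in> measurable (?Q \<Otimes>\<^sub>M ?P) (borel \<Otimes>\<^sub>M borel)"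
    by (intro measurable_Pair measurable_compose[OF measurable_fst] measurable_compose[OF measurable_snd]
        measurable_restrict_space1 measurable_ident_sets[OF refl])
  then have id: "(\<lambda>z. z) \<in> measurable (?Q \<Otimes>\<^sub>M ?P) borel" by (simp add: borel_prod)
  show "sets ?QP \<subseteq> sets (?Q \<Otimes>\<^sub>M ?P)"
  proof
    fix A assume "A \<in> sets ?QP"
    then obtain A' where A': "A' \<in> sets borel" "A = (Q \<times> P) \<inter> A'" by (auto simp: sets_restrict_space)
    have "(\<lambda>z. z) -` A' \<inter> space (?Q \<Otimes>\<^sub>M ?P) \<in> sets (?Q \<Otimes>\<^sub>M ?P)"
      by (rule measurable_sets[OF id A'(1)])
    also have "(\<lambda>z. z) -` A' \<inter> space (?Q \<Otimes>\<^sub>M ?P) = A"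
      using A'(2) by (auto simp: space_pair_measure space_restrict_space)
    finally show "A \<in> sets (?Q \<Otimes>\<^sub>M ?P)" .
  qed
qed

text \<open>
  The smallest eigenvalue is half the difference of trace and root, and the square of the trace exceeds the radicand by four
  times the determinant, \<open>\<epsilon> (4 lam_q lam_p - \<epsilon> (4 lam_q + R0\<^sup>2))\<close>.
\<close>

lemma hypo_Lambda_pos:
  assumes "0 < lam_q" "0 < lam_p" "0 < \<epsilon>" "\<epsilon> < 4 * lam_q * lam_p / (4 * lam_q + R0\<^sup>2)"
  shows "0 < hypo_Lambda lam_q lam_p R0 \<epsilon>"
proof -
  have den: "0 < 4 * lam_q + R0\<^sup>2" using assms by (simp add: add_pos_nonneg)
  have e: "\<epsilon> * (4 * lam_q + R0\<^sup>2) < 4 * lam_q * lam_p" using assms(4) den by (simp add: pos_less_divide_eq)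
  have "\<epsilon> * (4 * lam_q) \<le> \<epsilon> * (4 * lam_q + R0\<^sup>2)" using assms by (intro mult_left_mono) auto
  then have "\<epsilon> * (4 * lam_q) < lam_p * (4 * lam_q)" using e by (simp add: ac_simps)
  then have lp: "\<epsilon> < lam_p" using assms by simp
  let ?l = "(lam_q - 1) * \<epsilon> + lam_p"
  have l: "0 < ?l" using lp assms by (simp add: algebra_simps add_pos_pos) (smt (verit) mult_pos_pos)
  have "?l\<^sup>2 - (((lam_q + 1) * \<epsilon> - lam_p)\<^sup>2 + \<epsilon>\<^sup>2 * R0\<^sup>2) = \<epsilon> * (4 * lam_q * lam_p - \<epsilon> * (4 * lam_q + R0\<^sup>2))"
    by (simp add: power2_eq_square algebra_simps)
  also have "\<dots> > 0" using e assms by simp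
  finally have "sqrt (((lam_q + 1) * \<epsilon> - lam_p)\<^sup>2 + \<epsilon>\<^sup>2 * R0\<^sup>2) < sqrt (?l\<^sup>2)" by (intro real_sqrt_less_mono) simp
  then show ?thesis using l by (simp add: hypo_Lambda_def)
qed

lemma dms_half_contraction:
  assumes \<nu>: "prob_space \<nu>" and \<rho>: "prob_space \<rho>" and M: "M = \<nu> \<Otimes>\<^sub>M \<rho>"
    and B: "dms_standing M (momentum_proj M \<rho>) B" and \<epsilon>: "0 < \<epsilon>" "\<epsilon> < 1"
  shows "half_contraction M (op_app B) \<epsilon>" and "bounded_op M B"
proof -
  interpret \<nu>: prob_space \<nu> by fact
  interpret \<rho>: prob_space \<rho> by fact
  interpret pair_prob_space \<nu> \<rho> ..
  interpret M: prob_space M unfolding M by (rule prob_space_axioms)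
  show bop: "bounded_op M B" using B by (simp add: dms_standing_def Let_def)
  have one: "((\<lambda>_. 1), (\<lambda>_. 0)) \<in> B" "((\<lambda>_. 1), (\<lambda>_. 0)) \<in> op_adj M B"
    using B by (simp_all add: dms_standing_def Let_def)
  have L1: "(\<lambda>_. 1) \<in> L2_fun M" by (rule M.L2_fun_bounded[of _ 1]) auto
  show "half_contraction M (op_app B) \<epsilon>"
  proof
    show "op_app B f \<in> L2_fun M" if "f \<in> L2_fun M" for f using that by (rule bounded_op_app(2)[OF bop])
    show "AE x in M. op_app B (\<lambda>x. a * f x + a' * g x) x = a * op_app B f x + a' * op_app B g x"
      if "f \<in> L2_fun M" "g \<in> L2_fun M" for f g a a' by (rule bounded_op_app_lin[OF bop that])
    show "nrm M (op_app B f) \<le> nrm M f / 2" if f: "f \<in> L2_fun M" for f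
      using B f momentum_proj_complement_contraction[OF \<nu> \<rho>, of f]
      by (fastforce simp: dms_standing_def Let_def M)
    show "AE x in M. op_app B (\<lambda>_. 1) x = 0"
      by (rule bounded_op_AE_unique[OF bop bounded_op_app(1)[OF bop L1] one(1)]) simp
    show "(LINT x|M. op_app B f x) = 0" if f: "f \<in> L2_fun M" for f
      using one(2) bounded_op_app(1)[OF bop f] unfolding op_adj_def ip_def by fastforce
  qed (use \<epsilon> in auto)
qed

theorem theorem1p1:
  fixes Q :: "'a::euclidean_space set" and P :: "'b::euclidean_space set"
    and V :: "'a \<Rightarrow> real" and \<beta> :: real
    and \<nu>s :: "'a measure" and \<rho>s :: "'b measure" and \<mu>s \<mu> :: "('a \<times> 'b) measure"
    and \<Omega> :: "'w measure" and X :: "real \<Rightarrow> 'w \<Rightarrow> 'a \<times> 'b" and Pr :: "'a \<times> 'b \<Rightarrow> 'w measure"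
    and A B Pj :: "('a \<times> 'b) operator" and C :: "('a \<times> 'b \<Rightarrow> real) set"
    and lam_q lam_p R0 \<epsilon> \<Lambda> T \<delta> r v b N :: real
    and f fhat :: "'a \<times> 'b \<Rightarrow> real"
  assumes polish: "polish_set (Q \<times> P)"
    and V: "V \<in> borel_measurable (restrict_space borel Q)" and \<beta>: "\<beta> > 0"
    and \<nu>s: "\<nu>s = gibbs_measure \<beta> V Q" "prob_space \<nu>s"
    and \<rho>s: "momentum_measure P \<rho>s"
    and \<mu>s: "\<mu>s = \<nu>s \<Otimes>\<^sub>M \<rho>s"
    and process: "cadlag_markov_process (Q \<times> P) \<Omega> X Pr"
    and invariant: "invariant_measure X Pr \<mu>s"
    and ergodic: "ergodic_measure X Pr \<mu>s"
    and semigroup: "strongly_continuous_semigroup \<mu>s (transition X Pr)"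
    and A: "A = generator \<mu>s (transition X Pr)"
    and \<mu>: "prob_space \<mu>" "sets \<mu> = sets (restrict_space borel (Q \<times> P))"
    and ac: "absolutely_continuous \<mu>s \<mu>"
    and dens: "(\<lambda>x. enn2real (RN_deriv \<mu>s \<mu> x)) \<in> L2_fun \<mu>s"
    and Pj: "Pj = momentum_proj \<mu>s \<rho>s"
    and B: "B = dms_B \<mu>s Pj A" "dms_standing \<mu>s Pj B"
    and constants: "0 < lam_q" "lam_q < 1" "0 < lam_p" "0 < R0"
      "hypocoercivity_constants \<mu>s Pj A C lam_q lam_p R0"
    and \<epsilon>: "0 < \<epsilon>" "\<epsilon> < 1" "\<epsilon> < 4 * lam_q * lam_p / (4 * lam_q + R0\<^sup>2)"
    and \<Lambda>: "\<Lambda> = hypo_Lambda lam_q lam_p R0 \<epsilon>"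
    and hypocoercive: "\<And>g Ag. (g, Ag) \<in> A \<Longrightarrow>
      ip_eps \<mu>s B \<epsilon> (\<lambda>x. - Ag x) g \<ge> \<Lambda> * prob_space.variance \<mu>s g"
    and f: "f \<in> borel_measurable (restrict_space borel (Q \<times> P))" "bounded (f ` (Q \<times> P))"
    and T: "T > 0"
    and \<delta>: "0 < 1 - \<delta>" "1 - \<delta> < 1"
    and fhat: "fhat = (\<lambda>x. f x - (LINT y|\<mu>s. f y))"
    and N: "N = 1 / sqrt (1 - \<epsilon>) * nrm \<mu>s (\<lambda>x. enn2real (RN_deriv \<mu>s \<mu> x))"
    and v: "v = (1 + \<epsilon>) * (1 - \<epsilon>\<^sup>2 / 4) / (1 - \<epsilon>) * (2 * prob_space.variance \<mu>s f / \<Lambda>)"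
    and b: "b = (1 + \<epsilon>)\<^sup>2 / (1 - \<epsilon>) * ((SUP x \<in> Q \<times> P. \<bar>fhat x\<bar>) / \<Lambda>)"
    and r: "r = sqrt (2 * v * (1 / T) * ln (2 * N / \<delta>)) + b * (1 / T) * ln (2 * N / \<delta>)"
  shows "measure (path_law Pr \<mu>)
     {\<omega> \<in> space \<Omega>. \<bar>1 / T * (LINT t:{0..T}|lborel. f (X t \<omega>)) - (LINT x|\<mu>s. f x)\<bar> \<le> r} \<ge> 1 - \<delta>"
proof -
  have \<rho>_prob: "prob_space \<rho>s" and \<rho>_sets: "sets \<rho>s = sets (restrict_space borel P)"
    using \<rho>s by (auto simp: momentum_measure_def)
  have \<nu>_sets: "sets \<nu>s = sets (restrict_space borel Q)"
    unfolding \<nu>s(1) gibbs_measure_def Let_def by (simp add: sets_restrict_space)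
  have M_sets: "sets \<mu>s = sets (restrict_space borel (Q \<times> P))"
    unfolding \<mu>s sets_restrict_borel_pair[symmetric] by (rule sets_pair_measure_cong[OF \<nu>_sets \<rho>_sets])
  interpret nu: prob_space \<nu>s by (rule \<nu>s(2))
  interpret rho: prob_space \<rho>s by (rule \<rho>_prob)
  interpret nurho: pair_prob_space \<nu>s \<rho>s ..
  have M_prob: "prob_space \<mu>s" unfolding \<mu>s by (rule nurho.prob_space_axioms)
  have half: "half_contraction \<mu>s (op_app B) \<epsilon>" and bop: "bounded_op \<mu>s B"
    using dms_half_contraction[OF \<nu>s(2) \<rho>_prob \<mu>s _ \<epsilon>(1,2)] B(2) unfolding Pj by auto
  interpret hypocoercive_markov "Q \<times> P" \<Omega> X Pr \<mu>s "op_app B" \<epsilon>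
    using process M_prob M_sets invariant semigroup half
    by (intro hypocoercive_markov.intro stationary_markov.intro cadlag_markov.intro
        stationary_markov_axioms.intro)
  define m where "m = (LINT x|\<mu>s. f x)"
  define F where "F = (SUP x\<in>Q \<times> P. \<bar>fhat x\<bar>)"
  define \<eta> where "\<eta> = ln (2 * N / \<delta>) / T"
  have \<Lambda>_pos: "0 < \<Lambda>"
    unfolding \<Lambda> by (rule hypo_Lambda_pos[OF constants(1,3) \<epsilon>(1,3)])
  have N1: "1 \<le> N"
  proof -
    have "1 \<le> 1 / sqrt (1 - \<epsilon>)" using \<epsilon> by simp
    then have "1 * 1 \<le> 1 / sqrt (1 - \<epsilon>) * nrm \<mu>s (\<lambda>x. enn2real (RN_deriv \<mu>s \<mu> x))"
      using nrm_density_ge_one[OF \<mu> ac dens] \<epsilon> by (intro mult_mono) auto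
    then show ?thesis by (simp add: N)
  qed
  have \<delta>': "0 < \<delta>" "\<delta> < 1" using \<delta> by auto
  have "1 < 2 * N / \<delta>" using N1 \<delta>' by (simp add: pos_less_divide_eq)
  then have \<eta>_pos: "0 < \<eta>" using T by (simp add: \<eta>_def)
  have exp_\<eta>: "N * exp (- (\<eta> * T)) = \<delta> / 2"
    using T N1 \<delta>' by (simp add: \<eta>_def exp_minus)
  obtain c where c: "\<And>x. x \<in> Q \<times> P \<Longrightarrow> \<bar>f x\<bar> \<le> c"
    using f(2) unfolding bounded_iff by auto
  have ne: "Q \<times> P \<noteq> {}" using not_empty M_space by auto
  then have f_b: "bfun (max 0 c) f" using f(1) c by (auto simp: bfun_def le_max_iff_disj)
  have fhat_c: "\<bar>fhat x\<bar> \<le> c + \<bar>m\<bar>" if "x \<in> Q \<times> P" for x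
    using c[OF that] by (simp add: fhat m_def)
  have F_ge: "\<bar>fhat x\<bar> \<le> F" if "x \<in> Q \<times> P" for x
    unfolding F_def using fhat_c that by (intro cSUP_upper bdd_aboveI2[where M="c + \<bar>m\<bar>"]) auto
  have F0: "0 \<le> F" using ne F_ge by (metis abs_ge_zero ex_in_conv order_trans)
  have fhat_m: "fhat \<in> borel_measurable (restrict_space borel (Q \<times> P))"
    unfolding fhat using f(1) by measurable
  have fhat_b: "bfun F fhat" using fhat_m F0 F_ge by (simp add: bfun_def)
  have f_int: "integrable \<mu>s f" by (rule L2_fun_integrable[OF bfun_L2[OF f_b]])
  have mean: "(LINT x|\<mu>s. fhat x) = 0"
    using f_int by (simp add: fhat prob_space)
  have var: "variance f = (nrm \<mu>s fhat)\<^sup>2"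
    unfolding nrm_square ip_def fhat by (simp add: power2_eq_square)
  have b': "b = (1 + \<epsilon>)\<^sup>2 / (1 - \<epsilon>) * (F / \<Lambda>)" by (simp add: b F_def)
  have v': "v = (1 + \<epsilon>) * (1 - \<epsilon>\<^sup>2 / 4) / (1 - \<epsilon>) * (2 * (nrm \<mu>s fhat)\<^sup>2 / \<Lambda>)" by (simp add: v var)
  have r': "r = sqrt (2 * v * \<eta>) + b * \<eta>" by (simp add: r \<eta>_def)
  have time_average: "1 / T * (LINT t:{0..T}|lborel. f (X t \<omega>)) - m = acc fhat T \<omega> / T"
    if w: "\<omega> \<in> space \<Omega>" for \<omega>
  proof -
    have pm: "(\<lambda>t. f (X (max 0 t) \<omega>)) \<in> borel_measurable borel"
      by (rule measurable_compose[OF X_path_measurable[OF w] f(1)])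
    have i: "set_integrable lborel {0..T} (\<lambda>t. f (X (max 0 t) \<omega>))"
      by (rule set_integrable_bounded_Icc[OF pm, of _ _ c]) (intro c X_in[OF w], simp)
    have j: "set_integrable lborel {0..T} (\<lambda>t. m)"
      by (intro set_integrable_bounded_Icc[where c="\<bar>m\<bar>"]) auto
    have "acc fhat T \<omega> = (LINT t:{0..T}|lborel. f (X (max 0 t) \<omega>) - m)"
      unfolding acc_def by (intro set_lebesgue_integral_cong) (auto simp: fhat m_def)
    also have "\<dots> = (LINT t:{0..T}|lborel. f (X (max 0 t) \<omega>)) - (LINT t:{0..T}|lborel. m)"
      by (rule set_integral_diff(2)[OF i j])
    also have "(LINT t:{0..T}|lborel. f (X (max 0 t) \<omega>)) = (LINT t:{0..T}|lborel. f (X t \<omega>))"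
      by (intro set_lebesgue_integral_cong) auto
    also have "(LINT t:{0..T}|lborel. m) = T * m"
      using T by (simp add: set_lebesgue_integral_def)
    finally show ?thesis using T by (simp add: field_simps)
  qed
  let ?P = "path_law Pr \<mu>"
  interpret P: prob_space ?P by (rule path_law_prob(1)[OF \<mu>])
  note P_sets = path_law_prob(2)[OF \<mu>]
  have P_space: "space ?P = space \<Omega>" using P_sets by (rule sets_eq_imp_space_eq)
  let ?G = "{\<omega> \<in> space \<Omega>. \<bar>1 / T * (LINT t:{0..T}|lborel. f (X t \<omega>)) - (LINT x|\<mu>s. f x)\<bar> \<le> r}"
  have G_eq: "?G = {\<omega> \<in> space \<Omega>. \<bar>acc fhat T \<omega>\<bar> \<le> T * r}"
  proof (rule Collect_cong, rule conj_cong[OF refl])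
    fix \<omega> assume w: "\<omega> \<in> space \<Omega>"
    show "(\<bar>1 / T * (LINT t:{0..T}|lborel. f (X t \<omega>)) - (LINT x|\<mu>s. f x)\<bar> \<le> r) = (\<bar>acc fhat T \<omega>\<bar> \<le> T * r)"
      unfolding m_def[symmetric] time_average[OF w] using T by (simp add: pos_divide_le_eq mult.commute)
  qed
  have acc_m: "acc fhat T \<in> borel_measurable \<Omega>" by (rule acc_measurable[OF fhat_b])
  show ?thesis
  proof (cases "F = 0")
    \<comment> \<open>Here \<open>b = 0\<close>, which the optimization of the exponent excludes, but the deviation vanishes on every path.\<close>
    case True
    have "\<epsilon>\<^sup>2 \<le> 1" using \<epsilon> by (intro power_le_one) auto
    then have "0 \<le> v"
      unfolding v' using \<epsilon> \<Lambda>_pos by (intro mult_nonneg_nonneg divide_nonneg_nonneg) auto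
    then have "0 \<le> r" using \<eta>_pos True unfolding r' b' by simp
    moreover have "acc fhat T \<omega> = 0" if "\<omega> \<in> space \<Omega>" for \<omega>
      using acc_bound[OF fhat_b less_imp_le[OF T] that] True by simp
    ultimately have "?G = space ?P" unfolding G_eq P_space using T by auto
    then show ?thesis using P.prob_space \<delta>' by simp
  next
    case False
    then have F: "0 < F" using F0 by simp
    have hyp: "\<Lambda> * variance g \<le> E (\<lambda>x. - Ag x) g" if gen: "(g, Ag) \<in> generator \<mu>s U" for g Ag
    proof -
      have gL: "g \<in> L2_fun \<mu>s" "Ag \<in> L2_fun \<mu>s" using gen by (auto simp: generator_def)
      have "(\<lambda>x. - Ag x) \<in> L2_fun \<mu>s" using L2_fun_scale[OF gL(2), of "-1"] by simp
      from ip_eps_eq_mform[OF bop this gL(1)] show ?thesis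
        using hypocoercive[of g Ag] gen A by simp
    qed
    have upper: "measure ?P {\<omega> \<in> space \<Omega>. T * r \<le> acc fhat T \<omega>} \<le> \<delta> / 2"
      using Bernstein_one_sided[OF hyp \<Lambda>_pos fhat_b F mean \<mu> ac dens T \<eta>_pos v' b']
      unfolding r' N[symmetric] exp_\<eta> .
    have neg_b: "bfun F (\<lambda>x. - fhat x)" using fhat_b by (auto simp: bfun_def)
    have neg_nrm: "nrm \<mu>s (\<lambda>x. - fhat x) = nrm \<mu>s fhat" by (simp add: nrm_def ip_def)
    have neg_acc: "acc (\<lambda>x. - fhat x) T \<omega> = - acc fhat T \<omega>" for \<omega>
      by (simp add: acc_def set_lebesgue_integral_def)
    have lower: "measure ?P {\<omega> \<in> space \<Omega>. T * r \<le> - acc fhat T \<omega>} \<le> \<delta> / 2"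
      using Bernstein_one_sided[OF hyp \<Lambda>_pos neg_b F _ \<mu> ac dens T \<eta>_pos _ b'] mean v'
      unfolding r' N[symmetric] exp_\<eta> neg_nrm neg_acc by simp
    let ?U = "{\<omega> \<in> space \<Omega>. T * r \<le> acc fhat T \<omega>}" and ?L = "{\<omega> \<in> space \<Omega>. T * r \<le> - acc fhat T \<omega>}"
    have ms: "?U \<in> sets ?P" "?L \<in> sets ?P" "?G \<in> sets ?P"
      unfolding P_sets G_eq using acc_m by measurable
    have "space ?P - ?G \<subseteq> ?U \<union> ?L" unfolding G_eq P_space by auto
    then have "measure ?P (space ?P - ?G) \<le> measure ?P (?U \<union> ?L)"
      using ms by (intro P.finite_measure_mono) auto
    also have "\<dots> \<le> measure ?P ?U + measure ?P ?L" using ms by (intro measure_Un_le) auto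
    also have "\<dots> \<le> \<delta>" using upper lower by simp
    finally show ?thesis using P.prob_compl[OF ms(3)] by simp
  qed
qed

end
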